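(* Let $K=(\mathbb{R}\rtimes L)\times Sl(2,\mathbb{R})$ and $H=\Delta(L)$ be as in the context, and consider the $K$-invariant conformal class on $K/H$ represented in the coordinates $(x_1,x_2,x_3,x_4)$ by $$g=(e^{-4x_2+4x_3}-1)dx_1^2+e^{-2x_2+2x_3}(dx_1dx_4+dx_4dx_1)+dx_2^2+dx_3^2+2x_4e^{-2x_2+2x_3}(dx_3dx_1+dx_1dx_3).$$ Suppose $\rho=w_1\lambda_1+w_2\lambda_2+w_3\lambda_3$ for the fundamental weights $\lambda_i$ of the complexification of $\mathfrak{so}(2,4)$, and let $\mathbb{N}$, $\Phi$, $\pi:\mathbb{N}\to\mathbb{X}$ describe the normal solutions of the corresponding first BGG operator. - If $w_1\ne0$, then the corresponding first BGG operator does not have any (nonzero) normal solutions. - If $w_1=0$ and $w_2\neq w_3$, then there is a $2$-parameter family of normal solutions with $$\Phi(x_1,x_2,x_3,x_4)(v_1+iv_2)=\big((w_2+w_3)x_3+\tfrac12(w_2-w_3)ix_3\big)(v_1+iv_2)$$ and $\pi:\mathbb{N}\to\mathbb{X}$ identifying $v_1+iv_2$ with the $(v_1+iv_2)$-multiple of the lowest weight vector in $\mathbb{X}$. - If $w_1=0$ and $w_2=w_3$, there is a $1$-parameter family of normal solutions with $\Phi(x_1,x_2,x_3,x_4)v_1=2w_2x_3v_1$ and $\pi:\mathbb{N}\to\mathbb{X}$ identifying $v_1$ with the $v_1$-multiple of the lowest weight vector in $\mathbb{X}$. In particular, there is a $2$-parameter family of twistor spinors given by the functions $$s:\mathfrak{c}\to\mathbb{X}=\mathbb{C}^2[\tfrac12],\qquad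 s(x_1,x_2,x_3,x_4)=(0,e^{-x_3(1+\frac12i)}(v_1+iv_2))^t,$$ and there is a $1$-parameter family of normal conformal Killing vectors $v_1e^{-2x_3}\partial_{x_4}$.
   Context: $K$ is the group with Lie algebra $\mathfrak{k}$ of the block matrices $$\left[\begin{smallmatrix}x_3&x_5&0&0\\0&-x_3&0&0\\0&0&-x_2+x_3&2x_4+x_5-x_1\\0&0&x_1&x_2-x_3\end{smallmatrix}\right],$$ i.e. $\mathbb{R}\rtimes L$ corresponds to the upper $2\times2$ block (diagonal acting on strictly upper triangular matrices $L\cong\mathbb{R}$), and $H=\Delta(L)$, the diagonal in the product of $L$ and the strictly upper triangular unipotent subgroup of $Sl(2,\mathbb{R})$, has Lie algebra $\mathfrak{h}$ parametrized by $x_5$. $\mathfrak{c}$ is the complement with coordinates $(x_1,x_2,x_3,x_4)$ ($x_5=0$), and the coordinates on $K/H$ are $(x_1,\dots,x_4)\mapsto\tilde{\mathsf{c}}\,H$ with $\tilde{\mathsf{c}}=\exp(X_1)\exp(X_{23})\exp(X_4)$, where $X_1,X_{23},X_4$ are the matrices above with only $x_1$, only $x_2,x_3$, only $x_4$ nonzero. Frame: $e_1=e^{2x_2-2x_3}\partial_{x_1}-2x_4\partial_{x_2}-\frac12(4x_4^2+1-e^{4x_2-4x_3})\partial_{x_4}$, $e_2=\partial_{x_2}+2x_4\partial_{x_4}$, $e_3=\partial_{x_3}-2x_4\partial_{x_4}$, $e_4=\partial_{x_4}$; it is obtained from the Maurer–Cartan form modulo $\mathfrak{h}$ pulled back along $\tilde{\mathsf{c}}$,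 satisfies $g=2e^1e^4+(e^2)^2+(e^3)^2$ for the dual coframe, and is used to trivialize natural bundles (densities via $e^1\wedge\dots\wedge e^4$; $\mathbb{C}^2[\frac12]$ denotes the spinor space tensored with densities of weight $\frac12$, in a basis of weight vectors whose second element is of lowest weight). $\mathfrak{so}(2,4)$ consists of the $(1,4,1)$-block matrices $\left[\begin{smallmatrix} a&z&0\\ x&A&-\nu z^t\\ 0&-x^t\nu&-a\end{smallmatrix}\right]$, $\nu=\left[\begin{smallmatrix}0&0&0&1\\0&1&0&0\\0&0&1&0\\1&0&0&0\end{smallmatrix}\right]$, $A\in\mathfrak{so}(\nu)$; negative root spaces are below the diagonal; $E$ is the element with $a=1$, all else zero. $\lambda_1$ is the weight of the standard representation $\mathbb{R}^6$, and $\lambda_2,\lambda_3$ are those of the half-spin representations (with $\lambda_2$ that of $\mathfrak{so}(2,4)\cong\mathfrak{su}(2,2)$ on $\mathbb{C}^4$, for a suitable orientation convention). For $w_2=w_3$, $\rho$ is the real irreducible representation; for $w_2\ne w_3$ it is the complex irreducible representation viewed as a real one. The first BGG operator of $\rho:\mathfrak{so}(2,4)\to\mathfrak{gl}(\mathbb{V})$ acts on sections of the bundle with fibre $\mathbb{X}$ = lowest eigenspace of $\rho(E)$ (a quotient of $\mathbb{V}$): $\mathcal{D}=\pi_1\nabla\mathcal{L}_0$, with $\nabla$ the tractor connection of the normal conformal Cartan connection, $\mathcal{L}_0$ the unique differential splitting with $\partial^*\nabla\mathcal{L}_0=0$, $\partial^*$ the Kostant codifferential, $\pi_1$ the projection to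 its first cohomology. A solution is normal if its prolongation by $\mathcal{L}_0$ is a parallel tractor. $\mathbb{N}\subset\mathbb{V}$ is the space of values at the origin of (local) parallel tractors, regarded as $H$-equivariant functions on $K$; it is a representation $\Phi$ of $\mathfrak{k}$ such that $v\in\mathbb{N}$ corresponds to the parallel tractor $\exp(Y)\mapsto\exp(-\Phi(Y))v$ and to the solution obtained by composing with $\pi:\mathbb{N}\subset\mathbb{V}\to\mathbb{X}$. Twistor spinors correspond to the spin representation, conformal Killing vectors to the adjoint representation ($w_2=w_3=1$, $w_1=0$). *)

theory Defs
  imports "HOL-Analysis.Analysis"
begin

definition lie :: "real^'n^'n \<Rightarrow> real^'n^'n \<Rightarrow> real^'n^'n" where
  "lie X Y = X ** Y - Y ** X"

text \<open>The product on the type of matrices is componentwise, so that the library's \<^const>\<open>exp\<close>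
  is not available for them.\<close>

definition mexp :: "real^'n^'n \<Rightarrow> real^'n^'n" where
  "mexp A = (\<Sum>n. (1 / fact n) *\<^sub>R (((**) A ^^ n) (mat 1)))"

definition lin_exp :: "('v::real_normed_vector \<Rightarrow> 'v) \<Rightarrow> 'v \<Rightarrow> 'v" where
  "lin_exp T v = (\<Sum>n. (1 / fact n) *\<^sub>R (T ^^ n) v)"

primrec Ck_on :: "nat \<Rightarrow> 'a::euclidean_space set \<Rightarrow> ('a \<Rightarrow> 'b::real_normed_vector) \<Rightarrow> bool" where
  "Ck_on 0 U f \<longleftrightarrow> continuous_on U f"
| "Ck_on (Suc k) U f \<longleftrightarrow> (\<forall>x\<in>U. f differentiable (at x)) \<and>
     (\<forall>b\<in>Basis. Ck_on k U (\<lambda>x. frechet_derivative f (at x) b))"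

definition smooth_on :: "'a::euclidean_space set \<Rightarrow> ('a \<Rightarrow> 'b::real_normed_vector) \<Rightarrow> bool" where
  "smooth_on U f \<longleftrightarrow> (\<forall>k. Ck_on k U f)"

definition nu :: "real^4^4" where
  "nu = vector [vector [0,0,0,1], vector [0,1,0,0], vector [0,0,1,0], vector [1,0,0,0]]"

definition so_nu :: "(real^4^4) set" where
  "so_nu = {A. transpose A ** nu + nu ** A = 0}"

text \<open>The (1,4,1)-block matrix with diagonal blocks \<open>a\<close>, \<open>A\<close>, \<open>- a\<close>, first row \<open>z\<close> and first
  column \<open>x\<close>.  The row \<open>z\<close> spans the positive part of the grading, the column \<open>x\<close> the
  negative part.\<close>

definition so24_mat :: "real \<Rightarrow> real^4 \<Rightarrow> real^4 \<Rightarrow> real^4^4 \<Rightarrow> real^6^6" where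
  "so24_mat a z x A = (let y = - (nu *v z); w = - (x v* nu) in vector
    [vector [a,   z$1,   z$2,   z$3,   z$4,   0],
     vector [x$1, A$1$1, A$1$2, A$1$3, A$1$4, y$1],
     vector [x$2, A$2$1, A$2$2, A$2$3, A$2$4, y$2],
     vector [x$3, A$3$1, A$3$2, A$3$3, A$3$4, y$3],
     vector [x$4, A$4$1, A$4$2, A$4$3, A$4$4, y$4],
     vector [0,   w$1,   w$2,   w$3,   w$4,   - a]])"

definition so24 :: "(real^6^6) set" where
  "so24 = {so24_mat a z x A | a z x A. A \<in> so_nu}"

definition gradE :: "real^6^6" where
  "gradE = so24_mat 1 0 0 0"

text \<open>Strictly upper and strictly lower triangular elements, i.e. the sums of the positive and of
  the negative root spaces.  Membership in \<^const>\<open>so_nu\<close> forces the remaining entries to vanish.\<close>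

definition n_plus :: "(real^6^6) set" where
  "n_plus = {so24_mat 0 z 0 A | z A. A \<in> so_nu \<and> A$1$1 = 0 \<and> A$2$1 = 0 \<and> A$3$1 = 0 \<and> A$2$3 = 0}"

definition n_minus :: "(real^6^6) set" where
  "n_minus = {so24_mat 0 0 x A | x A. A \<in> so_nu \<and> A$1$1 = 0 \<and> A$1$2 = 0 \<and> A$1$3 = 0 \<and> A$2$3 = 0}"

text \<open>A maximally noncompact Cartan subalgebra; \<open>r\<close> is the coordinate of its compact direction, the
  rotation in the plane of the second and third vector of the middle block.\<close>

definition cartan :: "real \<Rightarrow> real \<Rightarrow> real \<Rightarrow> real^6^6" where
  "cartan a b r = so24_mat a 0 0
     (vector [vector [b,0,0,0], vector [0,0,-r,0], vector [0,r,0,0], vector [0,0,0,-b]])"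

text \<open>Weights, as functions of the coordinates of \<^const>\<open>cartan\<close>.  The standard representation has
  the weights \<open>\<plusminus> a\<close>, \<open>\<plusminus> b\<close>, \<open>\<plusminus> \<i> r\<close>.  Which half-spin representation is called the
  second one depends on the orientation; this is the choice compatible with the explicit
  formulas for the solutions.\<close>

definition fund_weight1 :: "real \<Rightarrow> real \<Rightarrow> real \<Rightarrow> complex" where
  "fund_weight1 a b r = of_real a"

definition fund_weight2 :: "real \<Rightarrow> real \<Rightarrow> real \<Rightarrow> complex" where
  "fund_weight2 a b r = (of_real a + of_real b + \<i> * of_real r) / 2"

definition fund_weight3 :: "real \<Rightarrow> real \<Rightarrow> real \<Rightarrow> complex" where
  "fund_weight3 a b r = (of_real a + of_real b - \<i> * of_real r) / 2"

text \<open>Representations live on a subspace \<open>V\<close> of a Euclidean space; only the values of \<open>\<rho>\<close> on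
  \<^const>\<open>so24\<close> and \<open>V\<close> are relevant.\<close>

definition lie_rep :: "'v::euclidean_space set \<Rightarrow> (real^6^6 \<Rightarrow> 'v \<Rightarrow> 'v) \<Rightarrow> bool" where
  "lie_rep V \<rho> \<longleftrightarrow> subspace V \<and>
     (\<forall>X\<in>so24. \<forall>v\<in>V. \<rho> X v \<in> V) \<and>
     (\<forall>X\<in>so24. \<forall>v\<in>V. \<forall>w\<in>V. \<forall>c. \<rho> X (v + c *\<^sub>R w) = \<rho> X v + c *\<^sub>R \<rho> X w) \<and>
     (\<forall>X\<in>so24. \<forall>Y\<in>so24. \<forall>v\<in>V. \<forall>c. \<rho> (X + c *\<^sub>R Y) v = \<rho> X v + c *\<^sub>R \<rho> Y v) \<and>
     (\<forall>X\<in>so24. \<forall>Y\<in>so24. \<forall>v\<in>V. \<rho> (lie X Y) v = \<rho> X (\<rho> Y v) - \<rho> Y (\<rho> X v))"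

definition cscale :: "('v::real_vector \<Rightarrow> 'v) \<Rightarrow> complex \<Rightarrow> 'v \<Rightarrow> 'v" where
  "cscale J z v = Re z *\<^sub>R v + Im z *\<^sub>R J v"

definition complex_structure ::
    "'v::euclidean_space set \<Rightarrow> (real^6^6 \<Rightarrow> 'v \<Rightarrow> 'v) \<Rightarrow> ('v \<Rightarrow> 'v) \<Rightarrow> bool" where
  "complex_structure V \<rho> J \<longleftrightarrow>
     (\<forall>v\<in>V. J v \<in> V \<and> J (J v) = - v) \<and>
     (\<forall>v\<in>V. \<forall>w\<in>V. \<forall>c. J (v + c *\<^sub>R w) = J v + c *\<^sub>R J w) \<and>
     (\<forall>X\<in>so24. \<forall>v\<in>V. \<rho> X (J v) = J (\<rho> X v))"

definition invariant_subspace ::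
    "'v::euclidean_space set \<Rightarrow> (real^6^6 \<Rightarrow> 'v \<Rightarrow> 'v) \<Rightarrow> 'v set \<Rightarrow> bool" where
  "invariant_subspace V \<rho> W \<longleftrightarrow> subspace W \<and> W \<subseteq> V \<and> (\<forall>X\<in>so24. \<rho> X ` W \<subseteq> W)"

text \<open>For equal second and third coefficient, this is the real irreducible representation; \<open>J\<close> then
  plays no role, since the highest weight is real on the real Cartan subalgebra.  Otherwise, it
  is the complex irreducible representation, viewed as a real one with complex structure \<open>J\<close>.\<close>

definition irrep_of_weight :: "nat \<Rightarrow> nat \<Rightarrow> nat \<Rightarrow>
    'v::euclidean_space set \<Rightarrow> (real^6^6 \<Rightarrow> 'v \<Rightarrow> 'v) \<Rightarrow> ('v \<Rightarrow> 'v) \<Rightarrow> bool" where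
  "irrep_of_weight w1 w2 w3 V \<rho> J \<longleftrightarrow> lie_rep V \<rho> \<and>
     (if w2 = w3
      then (\<forall>W. invariant_subspace V \<rho> W \<longrightarrow> W = {0} \<or> W = V)
      else complex_structure V \<rho> J \<and>
           (\<forall>W. invariant_subspace V \<rho> W \<and> J ` W \<subseteq> W \<longrightarrow> W = {0} \<or> W = V)) \<and>
     (\<exists>v\<in>V. v \<noteq> 0 \<and> (\<forall>X\<in>n_plus. \<rho> X v = 0) \<and>
        (\<forall>a b r. \<rho> (cartan a b r) v =
           cscale J (of_nat w1 * fund_weight1 a b r + of_nat w2 * fund_weight2 a b r
                     + of_nat w3 * fund_weight3 a b r) v))"

definition lowest_weight_vector ::
    "'v::euclidean_space set \<Rightarrow> (real^6^6 \<Rightarrow> 'v \<Rightarrow> 'v) \<Rightarrow> 'v \<Rightarrow> bool" where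
  "lowest_weight_vector V \<rho> l \<longleftrightarrow> l \<in> V \<and> l \<noteq> 0 \<and> (\<forall>X\<in>n_minus. \<rho> X l = 0)"

definition E_eigenspace ::
    "'v::euclidean_space set \<Rightarrow> (real^6^6 \<Rightarrow> 'v \<Rightarrow> 'v) \<Rightarrow> real \<Rightarrow> 'v set" where
  "E_eigenspace V \<rho> c = {v\<in>V. \<rho> gradE v = c *\<^sub>R v}"

definition lowest_E :: "'v::euclidean_space set \<Rightarrow> (real^6^6 \<Rightarrow> 'v \<Rightarrow> 'v) \<Rightarrow> real" where
  "lowest_E V \<rho> = Min {c. E_eigenspace V \<rho> c \<noteq> {0}}"

text \<open>The quotient \<open>\<bbbX>\<close> of \<open>V\<close> is realized as the lowest eigenspace, with the projection along the
  other eigenspaces.\<close>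

definition Xspace :: "'v::euclidean_space set \<Rightarrow> (real^6^6 \<Rightarrow> 'v \<Rightarrow> 'v) \<Rightarrow> 'v set" where
  "Xspace V \<rho> = E_eigenspace V \<rho> (lowest_E V \<rho>)"

definition Xproj :: "'v::euclidean_space set \<Rightarrow> (real^6^6 \<Rightarrow> 'v \<Rightarrow> 'v) \<Rightarrow> 'v \<Rightarrow> 'v" where
  "Xproj V \<rho> v = (THE u. u \<in> Xspace V \<rho> \<and>
     v - u \<in> span (\<Union>c\<in>{c. c \<noteq> lowest_E V \<rho>}. E_eigenspace V \<rho> c))"

text \<open>Forms on the negative part of the grading, with values in a representation, are given by their
  components in the standard basis.  The elements \<open>Zpos i\<close> form the basis of the positive part
  dual to it, up to a common factor, with respect to the trace form.  Since only kernel and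
  image matter, the codifferential is normalized only up to sign and a positive factor.  The
  usual bracket terms are absent because the positive part is abelian.\<close>

definition Zpos :: "4 \<Rightarrow> real^6^6" where
  "Zpos i = so24_mat 0 (axis i 1) 0 0"

definition codiff1 :: "(real^6^6 \<Rightarrow> 'v::real_vector \<Rightarrow> 'v) \<Rightarrow> (4 \<Rightarrow> 'v) \<Rightarrow> 'v" where
  "codiff1 \<rho> \<phi> = (\<Sum>i\<in>UNIV. \<rho> (Zpos i) (\<phi> i))"

definition codiff2 :: "(real^6^6 \<Rightarrow> 'v::real_vector \<Rightarrow> 'v) \<Rightarrow> (4 \<Rightarrow> 4 \<Rightarrow> 'v) \<Rightarrow> 4 \<Rightarrow> 'v" where
  "codiff2 \<rho> \<psi> j = (\<Sum>i\<in>UNIV. \<rho> (Zpos i) (\<psi> i j))"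

definition codiff2_image ::
    "'v::euclidean_space set \<Rightarrow> (real^6^6 \<Rightarrow> 'v \<Rightarrow> 'v) \<Rightarrow> (4 \<Rightarrow> 'v) set" where
  "codiff2_image V \<rho> = {codiff2 \<rho> \<psi> | \<psi>. \<forall>i j. \<psi> i j \<in> V \<and> \<psi> i j = - \<psi> j i}"

text \<open>Let \<open>g\<close> be a pseudo-Riemannian metric on \<open>\<real>\<^sup>4\<close> with a global frame \<open>e\<close> in which it is
  given by \<^const>\<open>nu\<close>.  The frame trivializes the Cartan bundle of the conformal class of \<open>g\<close>, and
  the Cartan connection becomes a one-form on \<open>\<real>\<^sup>4\<close> with values in \<^const>\<open>so24\<close>, whose negative part
  is the dual coframe.  The trivialization is unique up to functions with values in the
  exponential of the positive part; that freedom is fixed by using the Weyl structure of \<open>g\<close>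
  itself, i.e. by requiring the component along \<^const>\<open>gradE\<close> to vanish.\<close>

definition curv :: "(real^4 \<Rightarrow> real^4 \<Rightarrow> real^6^6) \<Rightarrow> real^4 \<Rightarrow> real^4 \<Rightarrow> real^4 \<Rightarrow> real^6^6" where
  "curv \<omega> x u w = frechet_derivative (\<lambda>y. \<omega> y w) (at x) u
     - frechet_derivative (\<lambda>y. \<omega> y u) (at x) w + lie (\<omega> x u) (\<omega> x w)"

definition normal_cartan_connection ::
    "(real^4 \<Rightarrow> real^4 \<Rightarrow> real^4 \<Rightarrow> real) \<Rightarrow> (real^4 \<Rightarrow> 4 \<Rightarrow> real^4) \<Rightarrow>
     (real^4 \<Rightarrow> real^4 \<Rightarrow> real^6^6) \<Rightarrow> bool" where
  "normal_cartan_connection g e \<omega> \<longleftrightarrow>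
     (\<forall>x i j. g x (e x i) (e x j) = nu $ i $ j) \<and>
     (\<forall>x. linear (\<omega> x)) \<and> (\<forall>u. smooth_on UNIV (\<lambda>x. \<omega> x u)) \<and>
     (\<forall>x i. \<exists>z A. A \<in> so_nu \<and> \<omega> x (e x i) = so24_mat 0 z (axis i 1) A) \<and>
     (\<forall>x j. codiff2 lie (\<lambda>i k. curv \<omega> x (e x i) (e x k)) j = 0)"

definition met :: "real^4 \<Rightarrow> real^4 \<Rightarrow> real^4 \<Rightarrow> real" where
  "met x u w =
     (exp (- 4 * x$2 + 4 * x$3) - 1) * u$1 * w$1
     + exp (- 2 * x$2 + 2 * x$3) * (u$1 * w$4 + u$4 * w$1)
     + u$2 * w$2 + u$3 * w$3
     + 2 * x$4 * exp (- 2 * x$2 + 2 * x$3) * (u$3 * w$1 + u$1 * w$3)"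

definition frame :: "real^4 \<Rightarrow> 4 \<Rightarrow> real^4" where
  "frame x i = (vector
     [vector [exp (2 * x$2 - 2 * x$3), - 2 * x$4, 0,
              - (1/2) * (4 * (x$4)\<^sup>2 + 1 - exp (4 * x$2 - 4 * x$3))],
      vector [0, 1, 0, 2 * x$4],
      vector [0, 0, 1, - 2 * x$4],
      vector [0, 0, 0, 1]] :: real^4^4) $ i"

definition cartan_form :: "real^4 \<Rightarrow> real^4 \<Rightarrow> real^6^6" where
  "cartan_form = (THE \<omega>. normal_cartan_connection met frame \<omega>)"

definition tractor_nabla ::
    "(real^6^6 \<Rightarrow> 'v::euclidean_space \<Rightarrow> 'v) \<Rightarrow> (real^4 \<Rightarrow> 'v) \<Rightarrow> real^4 \<Rightarrow> 4 \<Rightarrow> 'v" where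
  "tractor_nabla \<rho> s x i =
     frechet_derivative s (at x) (frame x i) + \<rho> (cartan_form x (frame x i)) (s x)"

definition tractor_on :: "'v::euclidean_space set \<Rightarrow> (real^4) set \<Rightarrow> (real^4 \<Rightarrow> 'v) \<Rightarrow> bool" where
  "tractor_on V U s \<longleftrightarrow> smooth_on U s \<and> (\<forall>x\<in>U. s x \<in> V)"

definition parallel_on :: "'v::euclidean_space set \<Rightarrow> (real^6^6 \<Rightarrow> 'v \<Rightarrow> 'v) \<Rightarrow>
    (real^4) set \<Rightarrow> (real^4 \<Rightarrow> 'v) \<Rightarrow> bool" where
  "parallel_on V \<rho> U s \<longleftrightarrow> tractor_on V U s \<and> (\<forall>x\<in>U. \<forall>i. tractor_nabla \<rho> s x i = 0)"

text \<open>The graph of the splitting operator: \<open>s\<close> is the value at \<open>\<sigma>\<close>.  The operator is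
  characterized by these conditions, as they determine \<open>s\<close> on \<open>U\<close>.\<close>

definition splitting :: "'v::euclidean_space set \<Rightarrow> (real^6^6 \<Rightarrow> 'v \<Rightarrow> 'v) \<Rightarrow>
    (real^4) set \<Rightarrow> (real^4 \<Rightarrow> 'v) \<Rightarrow> (real^4 \<Rightarrow> 'v) \<Rightarrow> bool" where
  "splitting V \<rho> U \<sigma> s \<longleftrightarrow> tractor_on V U s \<and>
     (\<forall>x\<in>U. Xproj V \<rho> (s x) = \<sigma> x \<and> codiff1 \<rho> (tractor_nabla \<rho> s x) = 0)"

text \<open>The first cohomology is the kernel of \<^const>\<open>codiff1\<close> modulo \<^const>\<open>codiff2_image\<close>.\<close>

definition BGG_solution :: "'v::euclidean_space set \<Rightarrow> (real^6^6 \<Rightarrow> 'v \<Rightarrow> 'v) \<Rightarrow>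
    (real^4) set \<Rightarrow> (real^4 \<Rightarrow> 'v) \<Rightarrow> bool" where
  "BGG_solution V \<rho> U \<sigma> \<longleftrightarrow>
     (\<exists>s. splitting V \<rho> U \<sigma> s \<and> (\<forall>x\<in>U. tractor_nabla \<rho> s x \<in> codiff2_image V \<rho>))"

definition normal_solution :: "'v::euclidean_space set \<Rightarrow> (real^6^6 \<Rightarrow> 'v \<Rightarrow> 'v) \<Rightarrow>
    (real^4) set \<Rightarrow> (real^4 \<Rightarrow> 'v) \<Rightarrow> bool" where
  "normal_solution V \<rho> U \<sigma> \<longleftrightarrow> BGG_solution V \<rho> U \<sigma> \<and>
     (\<exists>s. splitting V \<rho> U \<sigma> s \<and> parallel_on V \<rho> U s)"

text \<open>Vector fields are sections for the adjoint representation, by means of their frame components.\<close>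

definition coframe :: "real^4 \<Rightarrow> real^4 \<Rightarrow> real^4" where
  "coframe x u = (THE c. u = (\<Sum>i\<in>UNIV. c$i *\<^sub>R frame x i))"

definition normal_conformal_Killing :: "(real^4) set \<Rightarrow> (real^4 \<Rightarrow> real^4) \<Rightarrow> bool" where
  "normal_conformal_Killing U \<xi> \<longleftrightarrow>
     normal_solution so24 lie U (\<lambda>x. so24_mat 0 0 (coframe x (\<xi> x)) 0)"

text \<open>The matrix with coordinates \<open>x\<close> in the complement and \<open>t\<close> (the fifth coordinate) in the
  subalgebra of \<open>H\<close>.\<close>

definition k_mat :: "real^4 \<Rightarrow> real \<Rightarrow> real^4^4" where
  "k_mat x t = vector
     [vector [x$3, t, 0, 0],
      vector [0, - x$3, 0, 0],
      vector [0, 0, - x$2 + x$3, 2 * x$4 + t - x$1],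
      vector [0, 0, x$1, x$2 - x$3]]"

definition K_group :: "(real^4^4) set" where
  "K_group = {vector [vector [a, b, 0, 0], vector [0, 1/a, 0, 0],
                      vector [0, 0, p, q], vector [0, 0, r, s]] | a b p q r s.
              a > 0 \<and> p * s - q * r = 1}"

definition H_elem :: "real \<Rightarrow> real^4^4" where
  "H_elem t = mexp (k_mat 0 t)"

definition c_tilde :: "real^4 \<Rightarrow> real^4^4" where
  "c_tilde x = mexp (k_mat (vector [x$1, 0, 0, 0]) 0) ** mexp (k_mat (vector [0, x$2, x$3, 0]) 0)
     ** mexp (k_mat (vector [0, 0, 0, x$4]) 0)"

text \<open>The generator of \<open>H\<close> as an element of \<^const>\<open>so24\<close>, via its adjoint action on the quotient by
  the subalgebra of \<open>H\<close>.\<close>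

definition isotropy :: "real^6^6" where
  "isotropy = so24_mat 0 0 0
     (\<chi> i j. (THE c. \<exists>t. lie (k_mat 0 1) (k_mat (axis j 1) 0) = k_mat c t) $ i)"

text \<open>Local parallel tractors as \<open>H\<close>-equivariant functions on open \<open>H\<close>-saturated subsets of \<open>K\<close>; the
  corresponding section in coordinates is the composition with \<^const>\<open>c_tilde\<close>.\<close>

definition parallel_on_K :: "'v::euclidean_space set \<Rightarrow> (real^6^6 \<Rightarrow> 'v \<Rightarrow> 'v) \<Rightarrow>
    (real^4^4) set \<Rightarrow> (real^4^4 \<Rightarrow> 'v) \<Rightarrow> bool" where
  "parallel_on_K V \<rho> W f \<longleftrightarrow> openin (top_of_set K_group) W \<and>
     (\<forall>k\<in>W. f k \<in> V \<and> (\<forall>t. k ** H_elem t \<in> W \<and>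
        f (k ** H_elem t) = lin_exp (\<lambda>v. - t *\<^sub>R \<rho> isotropy v) (f k))) \<and>
     parallel_on V \<rho> (c_tilde -` W) (f \<circ> c_tilde)"

definition Nspace :: "'v::euclidean_space set \<Rightarrow> (real^6^6 \<Rightarrow> 'v \<Rightarrow> 'v) \<Rightarrow> 'v set" where
  "Nspace V \<rho> = {f (mat 1) | f W. parallel_on_K V \<rho> W f \<and> mat 1 \<in> W}"

text \<open>\<open>\<Phi>\<close> is a representation of the Lie algebra of \<open>K\<close> on the values \<open>v\<close> at the origin such that the
  parallel tractors are \<open>exp Y \<mapsto> exp (- \<Phi> Y) v\<close>.  The last condition expresses that the
  normal solutions are obtained from them by composition with the projection, evaluated at
  \<^const>\<open>c_tilde\<close>, i.e. at a product of three exponentials.\<close>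

definition describes_normal_solutions :: "'v::euclidean_space set \<Rightarrow>
    (real^6^6 \<Rightarrow> 'v \<Rightarrow> 'v) \<Rightarrow> (real^4 \<Rightarrow> real \<Rightarrow> 'v \<Rightarrow> 'v) \<Rightarrow> bool" where
  "describes_normal_solutions V \<rho> \<Phi> \<longleftrightarrow> subspace (Nspace V \<rho>) \<and>
     (\<forall>x t. \<forall>v\<in>Nspace V \<rho>. \<Phi> x t v \<in> Nspace V \<rho>) \<and>
     (\<forall>x t. \<forall>v\<in>Nspace V \<rho>. \<forall>w\<in>Nspace V \<rho>. \<forall>c.
        \<Phi> x t (v + c *\<^sub>R w) = \<Phi> x t v + c *\<^sub>R \<Phi> x t w) \<and>
     (\<forall>x t y u. \<forall>v\<in>Nspace V \<rho>. \<forall>c.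
        \<Phi> (x + c *\<^sub>R y) (t + c * u) v = \<Phi> x t v + c *\<^sub>R \<Phi> y u v) \<and>
     (\<forall>x t y u z r. \<forall>v\<in>Nspace V \<rho>. lie (k_mat x t) (k_mat y u) = k_mat z r \<longrightarrow>
        \<Phi> z r v = \<Phi> x t (\<Phi> y u v) - \<Phi> y u (\<Phi> x t v)) \<and>
     (\<forall>W f. parallel_on_K V \<rho> W f \<and> mat 1 \<in> W \<longrightarrow>
        (\<forall>\<^sub>F (x, t) in nhds (0, 0).
           f (mexp (k_mat x t)) = lin_exp (\<lambda>v. - \<Phi> x t v) (f (mat 1)))) \<and>
     (\<forall>U \<sigma>. open U \<and> connected U \<longrightarrow>
        (normal_solution V \<rho> U \<sigma> \<longleftrightarrow> (\<exists>v\<in>Nspace V \<rho>. \<forall>x\<in>U. \<sigma> x =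
           Xproj V \<rho> (lin_exp (\<lambda>v. - \<Phi> (vector [0, 0, 0, x$4]) 0 v)
             (lin_exp (\<lambda>v. - \<Phi> (vector [0, x$2, x$3, 0]) 0 v)
               (lin_exp (\<lambda>v. - \<Phi> (vector [x$1, 0, 0, 0]) 0 v) v))))))"

end

(* In the given frame the normal Cartan connection has constant coefficients Omega i: the torsion
   part and the g_0-part of the normalization condition are linear systems with a unique solution.
   By Schwarz' theorem a parallel tractor is annihilated by the curvature, hence by the Lie algebra
   generated from it under ad (Omega i), the holonomy algebra, which is eight-dimensional.

   The exponential of a root vector of the positive part conjugates the holonomy algebra to the sum
   of n_minus and the copy of sl(2) of the middle simple root.  In an irreducible representation,
   the vectors annihilated by n_minus form the (real or complex) line of lowest weight vectors, whose
   weight is found from the highest one by the longest Weyl group element, realized as the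
   exponential of a compact element.  The copy of sl(2) acts trivially on this line precisely if
   w1 = 0.  All Omega i except Omega 3 annihilate the resulting invariant vectors, and Omega 3 acts on
   them by a scalar, so that parallel tractors depend on the third coordinate only. *)

theory Submission
  imports Defs
begin

section \<open>The Lie algebra so(2,4) in coordinates\<close>

text \<open>The complement \<open>x5 = 0\<close> of the isotropy algebra is itself a subalgebra, the
  sum of a line and sl(2), and the frame is left invariant on the corresponding group. So brackets
  of frame vectors have constant coefficients, and the local geometry reduces to linear algebra in
  so(2,4). Derivatives disappear from the normalization condition degree by degree: once a block of
  an unknown connection is known to be constant, its derivative drops out of the equations for the
  next block. Real and complex representations are treated together through an endomorphism
  \<open>J\<close>, the identity if \<open>w2 = w3\<close> and the complex structure otherwise.
  Representation theory and analysis meet in one fact: on the kernel of the holonomy algebra,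
  \<open>Omega 3\<close> acts as \<open>a + b J\<close>. The conjugating element is
  \<open>root_z2\<close>; it takes \<open>Omega 3\<close> to an element of \<open>n_minus\<close>
  plus a Cartan element, and the lowest weight evaluated on the latter gives the exponents of the
  solutions. Since \<rho> is constrained only on \<open>so24\<close> and \<open>V\<close>, it is
  replaced by a total bilinear map.\<close>

lemma exhaust_6: "(x::6) = 1 \<or> x = 2 \<or> x = 3 \<or> x = 4 \<or> x = 5 \<or> x = 6"
proof (induct x)
  case (of_int z)
  then have "z = 0 \<or> z = 1 \<or> z = 2 \<or> z = 3 \<or> z = 4 \<or> z = 5" by fastforce
  then show ?case by auto
qed

lemma forall_6: "(\<forall>i::6. P i) \<longleftrightarrow> P 1 \<and> P 2 \<and> P 3 \<and> P 4 \<and> P 5 \<and> P 6"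
  by (metis exhaust_6)

lemma UNIV_6: "UNIV = {1, 2, 3, 4, 5, 6::6}"
  using exhaust_6 by auto

lemma sum_6: "sum f (UNIV::6 set) = f 1 + f 2 + f 3 + f 4 + f 5 + f 6"
  unfolding UNIV_6 by (simp add: ac_simps)

lemma vector_6:
  "(vector [a, b, c, d, e, f] :: 'a::zero^6)$1 = a"
  "(vector [a, b, c, d, e, f] :: 'a::zero^6)$2 = b"
  "(vector [a, b, c, d, e, f] :: 'a::zero^6)$3 = c"
  "(vector [a, b, c, d, e, f] :: 'a::zero^6)$4 = d"
  "(vector [a, b, c, d, e, f] :: 'a::zero^6)$5 = e"
  "(vector [a, b, c, d, e, f] :: 'a::zero^6)$6 = f"
  by (simp_all add: vector_def)

lemma vector_4 [simp]:
  "(vector [a, b, c, d] :: 'a::zero^4)$1 = a"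
  "(vector [a, b, c, d] :: 'a::zero^4)$2 = b"
  "(vector [a, b, c, d] :: 'a::zero^4)$3 = c"
  "(vector [a, b, c, d] :: 'a::zero^4)$4 = d"
  by (simp_all add: vector_def)

lemma eq_vector_6:
  "(v :: 'a::zero^6) = vector [a, b, c, d, e, f] \<longleftrightarrow>
     v$1 = a \<and> v$2 = b \<and> v$3 = c \<and> v$4 = d \<and> v$5 = e \<and> v$6 = f"
  by (simp add: vec_eq_iff forall_6 vector_6)

lemma eq_vector_4:
  "(v :: 'a::zero^4) = vector [a, b, c, d] \<longleftrightarrow> v$1 = a \<and> v$2 = b \<and> v$3 = c \<and> v$4 = d"
  by (simp add: vec_eq_iff forall_4)

text \<open>The parameter \<open>p\<close> is a boost and \<open>s\<close> a compact rotation;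
  \<open>q1\<close>, \<open>q2\<close> raise and \<open>r1\<close>, \<open>r2\<close> lower the
  eigenvalue of the boost.\<close>

definition so_mat :: "real \<Rightarrow> real \<Rightarrow> real \<Rightarrow> real \<Rightarrow> real \<Rightarrow> real \<Rightarrow> real^4^4" where
  "so_mat p q1 q2 r1 r2 s = vector [vector [p, q1, q2, 0], vector [r1, 0, - s, - q1],
     vector [r2, s, 0, - q2], vector [0, - r1, - r2, - p]]"

lemma so_nu_iff: "A \<in> so_nu \<longleftrightarrow>
    A = so_mat (A$1$1) (A$1$2) (A$1$3) (A$2$1) (A$3$1) (A$3$2)"
  unfolding so_nu_def so_mat_def nu_def
  by (auto simp: vec_eq_iff forall_4 sum_4 matrix_matrix_mult_def transpose_def)

lemma so_mat_in_so_nu: "so_mat p q1 q2 r1 r2 s \<in> so_nu"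
  by (subst so_nu_iff) (simp add: so_mat_def)

text \<open>Fifteen linear coordinates on so(2,4), in which the bracket is the explicit bilinear
  expression of \<open>lie_smat\<close>; every bracket computation below is a rewriting followed by
  a comparison of coordinates. With respect to \<open>cartan a b r\<close>, the coordinates
  \<open>z1\<close> and \<open>z4\<close> belong to the real roots \<open>a - b\<close> and
  \<open>a + b\<close>, the pairs \<open>z2\<close>, \<open>z3\<close> and \<open>q1\<close>,
  \<open>q2\<close> to the pairs of complex conjugate roots \<open>a +- i r\<close> and
  \<open>b +- i r\<close>, and \<open>x1\<close>, ..., \<open>x4\<close>, \<open>r1\<close>,
  \<open>r2\<close> to their negatives.\<close>

definition smat :: "real \<Rightarrow> real \<Rightarrow> real \<Rightarrow> real \<Rightarrow> real \<Rightarrow> real \<Rightarrow> real \<Rightarrow> real \<Rightarrow> real \<Rightarrow>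
    real \<Rightarrow> real \<Rightarrow> real \<Rightarrow> real \<Rightarrow> real \<Rightarrow> real \<Rightarrow> real^6^6" where
  "smat a z1 z2 z3 z4 x1 x2 x3 x4 p q1 q2 r1 r2 s = vector
    [vector [a, z1, z2, z3, z4, 0],
     vector [x1, p, q1, q2, 0, - z4],
     vector [x2, r1, 0, - s, - q1, - z2],
     vector [x3, r2, s, 0, - q2, - z3],
     vector [x4, 0, - r1, - r2, - p, - z1],
     vector [0, - x4, - x2, - x3, - x1, - a]]"

abbreviation "root_z1 \<equiv> smat 0 1 0 0 0 0 0 0 0 0 0 0 0 0 0"
abbreviation "root_z2 \<equiv> smat 0 0 1 0 0 0 0 0 0 0 0 0 0 0 0"
abbreviation "root_z3 \<equiv> smat 0 0 0 1 0 0 0 0 0 0 0 0 0 0 0"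
abbreviation "root_z4 \<equiv> smat 0 0 0 0 1 0 0 0 0 0 0 0 0 0 0"
abbreviation "root_x1 \<equiv> smat 0 0 0 0 0 1 0 0 0 0 0 0 0 0 0"
abbreviation "root_x2 \<equiv> smat 0 0 0 0 0 0 1 0 0 0 0 0 0 0 0"
abbreviation "root_x3 \<equiv> smat 0 0 0 0 0 0 0 1 0 0 0 0 0 0 0"
abbreviation "root_x4 \<equiv> smat 0 0 0 0 0 0 0 0 1 0 0 0 0 0 0"
abbreviation "root_q1 \<equiv> smat 0 0 0 0 0 0 0 0 0 0 1 0 0 0 0"
abbreviation "root_q2 \<equiv> smat 0 0 0 0 0 0 0 0 0 0 0 1 0 0 0"
abbreviation "root_r1 \<equiv> smat 0 0 0 0 0 0 0 0 0 0 0 0 1 0 0"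
abbreviation "root_r2 \<equiv> smat 0 0 0 0 0 0 0 0 0 0 0 0 0 1 0"

lemma so24_mat_eq_smat:
  "so24_mat a z x (so_mat p q1 q2 r1 r2 s) =
     smat a (z$1) (z$2) (z$3) (z$4) (x$1) (x$2) (x$3) (x$4) p q1 q2 r1 r2 s"
  by (simp add: so24_mat_def smat_def so_mat_def Let_def nu_def matrix_vector_mult_def
      vector_matrix_mult_def sum_4)

lemma so24_eq: "so24 = {smat a z1 z2 z3 z4 x1 x2 x3 x4 p q1 q2 r1 r2 s |
    a z1 z2 z3 z4 x1 x2 x3 x4 p q1 q2 r1 r2 s. True}" (is "_ = ?R")
proof (intro equalityI subsetI)
  fix M assume "M \<in> so24"
  then obtain a z x A where "M = so24_mat a z x A" "A \<in> so_nu" by (auto simp: so24_def)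
  with so24_mat_eq_smat so_nu_iff show "M \<in> ?R" by (smt (verit) mem_Collect_eq)
next
  fix M assume "M \<in> ?R"
  then obtain a z1 z2 z3 z4 x1 x2 x3 x4 p q1 q2 r1 r2 s
    where M: "M = smat a z1 z2 z3 z4 x1 x2 x3 x4 p q1 q2 r1 r2 s" by blast
  have "M = so24_mat a (vector [z1, z2, z3, z4]) (vector [x1, x2, x3, x4]) (so_mat p q1 q2 r1 r2 s)"
    by (simp add: so24_mat_eq_smat M)
  then show "M \<in> so24" using so_mat_in_so_nu unfolding so24_def by blast
qed

lemma smat_in_so24 [simp]: "smat a z1 z2 z3 z4 x1 x2 x3 x4 p q1 q2 r1 r2 s \<in> so24"
  unfolding so24_eq by blast

lemma so24E:
  assumes "M \<in> so24"
  obtains a z1 z2 z3 z4 x1 x2 x3 x4 p q1 q2 r1 r2 s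
  where "M = smat a z1 z2 z3 z4 x1 x2 x3 x4 p q1 q2 r1 r2 s"
  using assms unfolding so24_eq by blast

lemma smat_eq_iff:
  "smat a z1 z2 z3 z4 x1 x2 x3 x4 p q1 q2 r1 r2 s =
   smat a' z1' z2' z3' z4' x1' x2' x3' x4' p' q1' q2' r1' r2' s' \<longleftrightarrow>
   a = a' \<and> z1 = z1' \<and> z2 = z2' \<and> z3 = z3' \<and> z4 = z4' \<and> x1 = x1' \<and> x2 = x2' \<and> x3 = x3' \<and> x4 = x4' \<and>
   p = p' \<and> q1 = q1' \<and> q2 = q2' \<and> r1 = r1' \<and> r2 = r2' \<and> s = s'"
  unfolding smat_def eq_vector_6 vector_6 by auto

lemma smat_add:
  "smat a z1 z2 z3 z4 x1 x2 x3 x4 p q1 q2 r1 r2 s +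
   smat a' z1' z2' z3' z4' x1' x2' x3' x4' p' q1' q2' r1' r2' s' =
   smat (a + a') (z1 + z1') (z2 + z2') (z3 + z3') (z4 + z4') (x1 + x1') (x2 + x2') (x3 + x3')
     (x4 + x4') (p + p') (q1 + q1') (q2 + q2') (r1 + r1') (r2 + r2') (s + s')"
  unfolding smat_def by (simp add: eq_vector_6 vector_6)

lemma smat_scale:
  "c *\<^sub>R smat a z1 z2 z3 z4 x1 x2 x3 x4 p q1 q2 r1 r2 s =
   smat (c * a) (c * z1) (c * z2) (c * z3) (c * z4) (c * x1) (c * x2) (c * x3)
     (c * x4) (c * p) (c * q1) (c * q2) (c * r1) (c * r2) (c * s)"
  unfolding smat_def by (simp add: eq_vector_6 vector_6)

lemma smat_minus:
  "- smat a z1 z2 z3 z4 x1 x2 x3 x4 p q1 q2 r1 r2 s =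
   smat (- a) (- z1) (- z2) (- z3) (- z4) (- x1) (- x2) (- x3)
     (- x4) (- p) (- q1) (- q2) (- r1) (- r2) (- s)"
  unfolding smat_def by (simp add: eq_vector_6 vector_6)

lemma smat_diff:
  "smat a z1 z2 z3 z4 x1 x2 x3 x4 p q1 q2 r1 r2 s -
   smat a' z1' z2' z3' z4' x1' x2' x3' x4' p' q1' q2' r1' r2' s' =
   smat (a - a') (z1 - z1') (z2 - z2') (z3 - z3') (z4 - z4') (x1 - x1') (x2 - x2') (x3 - x3')
     (x4 - x4') (p - p') (q1 - q1') (q2 - q2') (r1 - r1') (r2 - r2') (s - s')"
  unfolding smat_def by (simp add: eq_vector_6 vector_6)

lemma smat_0: "smat 0 0 0 0 0 0 0 0 0 0 0 0 0 0 0 = 0"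
  unfolding smat_def by (simp add: vec_eq_iff forall_6 vector_6)

lemmas smat_simps = smat_add smat_scale smat_minus smat_diff

lemma lie_smat:
  "lie (smat a z1 z2 z3 z4 x1 x2 x3 x4 p q1 q2 r1 r2 s)
       (smat a' z1' z2' z3' z4' x1' x2' x3' x4' p' q1' q2' r1' r2' s') = smat
    (z1 * x1' + z2 * x2' + z3 * x3' + z4 * x4' - x1 * z1' - x2 * z2' - x3 * z3' - x4 * z4')
    (a * z1' - p * z1' - r1 * z2' - r2 * z3' - z1 * a' + z1 * p' + z2 * r1' + z3 * r2')
    (a * z2' - q1 * z1' + r1 * z4' - s * z3' - z2 * a' + z1 * q1' - z4 * r1' + z3 * s')
    (a * z3' - q2 * z1' + r2 * z4' + s * z2' - z3 * a' + z1 * q2' - z4 * r2' - z2 * s')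
    (a * z4' + p * z4' + q1 * z2' + q2 * z3' - z4 * a' - z4 * p' - z2 * q1' - z3 * q2')
    (- a * x1' + p * x1' + q1 * x2' + q2 * x3' + x1 * a' - x1 * p' - x2 * q1' - x3 * q2')
    (- a * x2' - q1 * x4' + r1 * x1' - s * x3' + x2 * a' + x4 * q1' - x1 * r1' + x3 * s')
    (- a * x3' - q2 * x4' + r2 * x1' + s * x2' + x3 * a' + x4 * q2' - x1 * r2' - x2 * s')
    (- a * x4' - p * x4' - r1 * x2' - r2 * x3' + x4 * a' + x4 * p' + x2 * r1' + x3 * r2')
    (q1 * r1' + q2 * r2' - r1 * q1' - r2 * q2' - z1 * x1' + z4 * x4' + x1 * z1' - x4 * z4')
    (p * q1' - q1 * p' + q2 * s' - s * q2' - z2 * x1' + z4 * x2' + x1 * z2' - x2 * z4')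
    (p * q2' - q1 * s' - q2 * p' + s * q1' - z3 * x1' + z4 * x3' + x1 * z3' - x3 * z4')
    (- p * r1' + r1 * p' + r2 * s' - s * r2' - z1 * x2' + z2 * x4' + x2 * z1' - x4 * z2')
    (- p * r2' - r1 * s' + r2 * p' + s * r1' - z1 * x3' + z3 * x4' + x3 * z1' - x4 * z3')
    (- q1 * r2' + q2 * r1' - r1 * q2' + r2 * q1' + z3 * x2' - z2 * x3' + x3 * z2' - x2 * z3')
    "
  unfolding lie_def smat_def
  by (simp add: eq_vector_6 vector_6 matrix_matrix_mult_def sum_6 algebra_simps)

lemma subspace_so24: "subspace so24"
  unfolding subspace_def
  by (auto elim!: so24E simp: smat_simps smat_0[symmetric])

lemma lie_in_so24: "X \<in> so24 \<Longrightarrow> Y \<in> so24 \<Longrightarrow> lie X Y \<in> so24"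
  by (auto elim!: so24E simp: lie_smat)

lemma gradE_smat: "gradE = smat 1 0 0 0 0 0 0 0 0 0 0 0 0 0 0"
proof -
  have "0 = so_mat 0 0 0 0 0 0" by (simp add: so_mat_def vec_eq_iff forall_4)
  then show ?thesis unfolding gradE_def using so24_mat_eq_smat[of 1 0 0 0 0 0 0 0 0] by simp
qed

lemma cartan_smat: "cartan a b r = smat a 0 0 0 0 0 0 0 0 b 0 0 0 0 r"
proof -
  have "vector [vector [b,0,0,0], vector [0,0,-r,0], vector [0,r,0,0], vector [0,0,0,-b]] =
      so_mat b 0 0 0 0 r" by (simp add: so_mat_def)
  then show ?thesis unfolding cartan_def by (simp add: so24_mat_eq_smat)
qed

lemma n_plus_eq: "n_plus = {smat 0 z1 z2 z3 z4 0 0 0 0 0 q1 q2 0 0 0 | z1 z2 z3 z4 q1 q2. True}"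
    (is "_ = ?R")
proof (intro equalityI subsetI)
  fix M assume "M \<in> n_plus"
  then obtain z A where A: "M = so24_mat 0 z 0 A" "A \<in> so_nu" "A$1$1 = 0" "A$2$1 = 0"
    "A$3$1 = 0" "A$2$3 = 0" by (auto simp: n_plus_def)
  then have A': "A = so_mat 0 (A$1$2) (A$1$3) 0 0 (A$3$2)" using so_nu_iff by metis
  then have "A$2$3 = - (A$3$2)" by (metis so_mat_def vector_4)
  then have "A = so_mat 0 (A$1$2) (A$1$3) 0 0 0" using A' A(6) by simp
  then have "M = smat 0 (z$1) (z$2) (z$3) (z$4) 0 0 0 0 0 (A$1$2) (A$1$3) 0 0 0"
    by (metis (no_types) A(1) so24_mat_eq_smat zero_index)
  then show "M \<in> ?R" by blast
next
  fix M assume "M \<in> ?R"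
  then obtain z1 z2 z3 z4 q1 q2 where M: "M = smat 0 z1 z2 z3 z4 0 0 0 0 0 q1 q2 0 0 0" by blast
  have "M = so24_mat 0 (vector [z1, z2, z3, z4]) 0 (so_mat 0 q1 q2 0 0 0)"
    by (simp add: so24_mat_eq_smat M)
  moreover have "so_mat 0 q1 q2 0 0 0 $ 1 $ 1 = 0" "so_mat 0 q1 q2 0 0 0 $ 2 $ 1 = 0"
    "so_mat 0 q1 q2 0 0 0 $ 3 $ 1 = 0" "so_mat 0 q1 q2 0 0 0 $ 2 $ 3 = 0"
    by (simp_all add: so_mat_def)
  ultimately show "M \<in> n_plus" using so_mat_in_so_nu unfolding n_plus_def by blast
qed

lemma n_minus_eq: "n_minus = {smat 0 0 0 0 0 x1 x2 x3 x4 0 0 0 r1 r2 0 | x1 x2 x3 x4 r1 r2. True}"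
    (is "_ = ?R")
proof (intro equalityI subsetI)
  fix M assume "M \<in> n_minus"
  then obtain x A where A: "M = so24_mat 0 0 x A" "A \<in> so_nu" "A$1$1 = 0" "A$1$2 = 0"
    "A$1$3 = 0" "A$2$3 = 0" by (auto simp: n_minus_def)
  then have A': "A = so_mat 0 0 0 (A$2$1) (A$3$1) (A$3$2)" using so_nu_iff by metis
  then have "A$2$3 = - (A$3$2)" by (metis so_mat_def vector_4)
  then have "A = so_mat 0 0 0 (A$2$1) (A$3$1) 0" using A' A(6) by simp
  then have "M = smat 0 0 0 0 0 (x$1) (x$2) (x$3) (x$4) 0 0 0 (A$2$1) (A$3$1) 0"
    by (metis (no_types) A(1) so24_mat_eq_smat zero_index)
  then show "M \<in> ?R" by blast
next
  fix M assume "M \<in> ?R"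
  then obtain x1 x2 x3 x4 r1 r2 where M: "M = smat 0 0 0 0 0 x1 x2 x3 x4 0 0 0 r1 r2 0" by blast
  have "M = so24_mat 0 0 (vector [x1, x2, x3, x4]) (so_mat 0 0 0 r1 r2 0)"
    by (simp add: so24_mat_eq_smat M)
  moreover have "so_mat 0 0 0 r1 r2 0 $ 1 $ 1 = 0" "so_mat 0 0 0 r1 r2 0 $ 1 $ 2 = 0"
    "so_mat 0 0 0 r1 r2 0 $ 1 $ 3 = 0" "so_mat 0 0 0 r1 r2 0 $ 2 $ 3 = 0"
    by (simp_all add: so_mat_def)
  ultimately show "M \<in> n_minus" using so_mat_in_so_nu unfolding n_minus_def by blast
qed

lemma Zpos_smat:
  "Zpos 1 = root_z1"
  "Zpos 2 = root_z2"
  "Zpos 3 = root_z3"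
  "Zpos 4 = root_z4"
proof -
  have 0: "0 = so_mat 0 0 0 0 0 0" by (simp add: so_mat_def vec_eq_iff forall_4)
  show "Zpos 1 = root_z1"
    "Zpos 2 = root_z2"
    "Zpos 3 = root_z3"
    "Zpos 4 = root_z4"
    unfolding Zpos_def using so24_mat_eq_smat[of 0 "axis _ 1" 0 0 0 0 0 0 0, folded 0]
    by (simp_all add: axis_def)
qed

section \<open>Smooth maps, Schwarz' theorem, and exponentials of linear maps\<close>

text \<open>A family closed under directional derivatives reduces the induction over the order to a
  single closure check; \<open>exp_poly\<close> and \<open>exp_sec\<close> provide the families used
  below.\<close>

lemma smooth_on_class:
  assumes "\<And>f x. f \<in> S \<Longrightarrow> f differentiable (at x)"
    and "\<And>f b. f \<in> S \<Longrightarrow> (\<lambda>x. frechet_derivative f (at x) b) \<in> S"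
    and "f \<in> S"
  shows "smooth_on U f"
proof -
  have "Ck_on k U f" if "f \<in> S" for f k
    using that
  proof (induction k arbitrary: f)
    case 0
    then show ?case
      by (auto intro!: continuous_at_imp_continuous_on assms(1) differentiable_imp_continuous_within)
  next
    case (Suc k)
    then show ?case using assms(1,2) by simp
  qed
  then show ?thesis using assms(3) by (simp add: smooth_on_def)
qed

lemma smooth_on_differentiable:
  assumes "smooth_on U f" "x \<in> U"
  shows "f differentiable (at x)"
proof -
  have "Ck_on (Suc 0) U f" using assms(1) unfolding smooth_on_def by blast
  then show ?thesis using assms(2) by simp
qed

text \<open>The second difference quotient of \<open>f\<close> is, by the mean value theorem in the direction \<open>u\<close>, a
  difference quotient of the derivative; its symmetry in \<open>u\<close> and \<open>w\<close> gives Schwarz' theorem.\<close>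

lemma second_difference_quotient:
  fixes f :: "'a::real_normed_vector \<Rightarrow> real"
  assumes U: "open U" "x \<in> U"
    and f: "\<And>y. y \<in> U \<Longrightarrow> (f has_derivative f' y) (at y)"
    and h: "((\<lambda>y. f' y u) has_derivative h) (at x)"
  shows "((\<lambda>t. (f (x + t *\<^sub>R u + t *\<^sub>R w) - f (x + t *\<^sub>R u) - f (x + t *\<^sub>R w) + f x) / t\<^sup>2)
    \<longlongrightarrow> h w) (at_right 0)"
proof (rule tendstoI)
  fix e0 :: real assume e0: "e0 > 0"
  \<comment> \<open>Displacements by at most \<open>t\<close> in both directions have norm at most
    \<open>t * M\<close>, and the summand 1 keeps \<open>M\<close> positive if both vectors vanish.
    The factor 3 in \<open>e\<close> leaves room for two errors of size
    \<open>e * (t * M)\<close>.\<close>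
  define M where "M = norm u + norm w + 1"
  have M: "M > 0" unfolding M_def by (smt (verit) norm_ge_zero)
  define e where "e = e0 / (3 * M)"
  have e: "e > 0" using e0 M by (simp add: e_def)
  interpret h: bounded_linear h using h by (rule has_derivative_bounded_linear)
  obtain d1 where d1: "d1 > 0" "\<And>y. norm (y - x) < d1 \<Longrightarrow>
      \<bar>f' y u - f' x u - h (y - x)\<bar> \<le> e * norm (y - x)"
    using h e unfolding has_derivative_at_alt by (auto simp del: abs_diff_le_iff)
  obtain d2 where d2: "d2 > 0" "ball x d2 \<subseteq> U" using U openE by blast
  define d where "d = min d1 d2 / M"
  have d: "d > 0" using d1 d2 M by (simp add: d_def)
  have main: "dist ((f (x + t *\<^sub>R u + t *\<^sub>R w) - f (x + t *\<^sub>R u) - f (x + t *\<^sub>R w) + f x) / t\<^sup>2) (h w) < e0"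
    if t: "0 < t" "t < d" for t
  proof -
    have tM: "t * M < min d1 d2" using t M by (simp add: d_def field_simps)
    have small: "norm (\<xi> *\<^sub>R u + \<eta> *\<^sub>R w) \<le> t * M" if "0 \<le> \<xi>" "\<xi> \<le> t" "0 \<le> \<eta>" "\<eta> \<le> t" for \<xi> \<eta>
    proof -
      have "norm (\<xi> *\<^sub>R u + \<eta> *\<^sub>R w) \<le> \<xi> * norm u + \<eta> * norm w"
        using norm_triangle_ineq[of "\<xi> *\<^sub>R u" "\<eta> *\<^sub>R w"] that by simp
      also have "\<dots> \<le> t * norm u + t * norm w"
        using that by (intro add_mono mult_right_mono) auto
      also have "\<dots> \<le> t * M" using t by (simp add: M_def algebra_simps)
      finally show ?thesis .
    qed
    have inU: "x + (\<xi> *\<^sub>R u + \<eta> *\<^sub>R w) \<in> U" if "0 \<le> \<xi>" "\<xi> \<le> t" "0 \<le> \<eta>" "\<eta> \<le> t" for \<xi> \<eta>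
    proof -
      have "dist x (x + (\<xi> *\<^sub>R u + \<eta> *\<^sub>R w)) = norm (\<xi> *\<^sub>R u + \<eta> *\<^sub>R w)"
        by (metis add_diff_cancel_left' dist_commute dist_norm)
      then have "x + (\<xi> *\<^sub>R u + \<eta> *\<^sub>R w) \<in> ball x d2"
        using small[OF that] tM by simp
      then show ?thesis using d2 by blast
    qed
    \<comment> \<open>The increment in the direction \<open>w\<close> as a function of the parameter
      along \<open>u\<close>. The term \<open>0 *\<^sub>R w\<close> is kept so that both summands
      are instances of the same differentiability statement.\<close>
    define g where "g \<xi> = f (x + (\<xi> *\<^sub>R u + t *\<^sub>R w)) - f (x + (\<xi> *\<^sub>R u + 0 *\<^sub>R w))" for \<xi>
    define g' where "g' \<xi> = f' (x + (\<xi> *\<^sub>R u + t *\<^sub>R w)) u - f' (x + (\<xi> *\<^sub>R u + 0 *\<^sub>R w)) u" for \<xi>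
    have "(g has_real_derivative g' \<xi>) (at \<xi>)" if "0 \<le> \<xi>" "\<xi> \<le> t" for \<xi>
    proof -
      have one: "((\<lambda>\<xi>. f (x + (\<xi> *\<^sub>R u + \<eta> *\<^sub>R w))) has_real_derivative f' (x + (\<xi> *\<^sub>R u + \<eta> *\<^sub>R w)) u) (at \<xi>)"
        if "0 \<le> \<eta>" "\<eta> \<le> t" for \<eta>
      proof -
        have f1: "(f has_derivative f' (x + (\<xi> *\<^sub>R u + \<eta> *\<^sub>R w))) (at (x + (\<xi> *\<^sub>R u + \<eta> *\<^sub>R w)))"
          using f inU \<open>0 \<le> \<xi>\<close> \<open>\<xi> \<le> t\<close> that by blast
        have "((\<lambda>\<xi>. x + (\<xi> *\<^sub>R u + \<eta> *\<^sub>R w)) has_derivative (\<lambda>s. s *\<^sub>R u)) (at \<xi>)"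
          by (auto intro!: derivative_eq_intros)
        from has_derivative_compose[OF this f1]
        have "((\<lambda>\<xi>. f (x + (\<xi> *\<^sub>R u + \<eta> *\<^sub>R w))) has_derivative
            (\<lambda>s. f' (x + (\<xi> *\<^sub>R u + \<eta> *\<^sub>R w)) (s *\<^sub>R u))) (at \<xi>)" .
        moreover have "(\<lambda>s. f' (x + (\<xi> *\<^sub>R u + \<eta> *\<^sub>R w)) (s *\<^sub>R u)) =
            (*) (f' (x + (\<xi> *\<^sub>R u + \<eta> *\<^sub>R w)) u)"
          by (simp add: fun_eq_iff linear_scale[OF has_derivative_linear[OF f1]])
        ultimately show ?thesis by (simp add: has_field_derivative_def)
      qed
      show ?thesis unfolding g_def g'_def using t by (intro DERIV_diff one) auto
    qed
    then obtain \<xi> where \<xi>: "0 < \<xi>" "\<xi> < t" "g t - g 0 = (t - 0) * g' \<xi>"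
      using MVT2[of 0 t g g'] t by blast
    have a: "\<bar>f' (x + (\<xi> *\<^sub>R u + \<eta> *\<^sub>R w)) u - f' x u - h (\<xi> *\<^sub>R u + \<eta> *\<^sub>R w)\<bar> \<le> e * (t * M)"
      if "0 \<le> \<eta>" "\<eta> \<le> t" for \<eta>
    proof -
      have "norm (\<xi> *\<^sub>R u + \<eta> *\<^sub>R w) \<le> t * M" using small \<xi> that by auto
      moreover from this have "\<bar>f' (x + (\<xi> *\<^sub>R u + \<eta> *\<^sub>R w)) u - f' x u - h (\<xi> *\<^sub>R u + \<eta> *\<^sub>R w)\<bar>
          \<le> e * norm (\<xi> *\<^sub>R u + \<eta> *\<^sub>R w)"
        using d1(2)[of "x + (\<xi> *\<^sub>R u + \<eta> *\<^sub>R w)"] tM by simp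
      ultimately show ?thesis using e by (smt (verit) mult_left_mono)
    qed
    have h1: "h (\<xi> *\<^sub>R u + t *\<^sub>R w) - h (\<xi> *\<^sub>R u + 0 *\<^sub>R w) = t * h w"
      by (simp add: h.add h.scaleR)
    have "\<bar>g' \<xi> - t * h w\<bar> \<le> 2 * e * (t * M)"
      using a[of t] a[of 0] h1 t unfolding g'_def by simp
    moreover have "f (x + t *\<^sub>R u + t *\<^sub>R w) - f (x + t *\<^sub>R u) - f (x + t *\<^sub>R w) + f x = t * g' \<xi>"
      using \<xi>(3) by (simp add: g_def algebra_simps)
    moreover have "t * g' \<xi> / t\<^sup>2 - h w = (g' \<xi> - t * h w) / t"
      using t by (simp add: field_simps power2_eq_square)
    ultimately have "\<bar>(f (x + t *\<^sub>R u + t *\<^sub>R w) - f (x + t *\<^sub>R u) - f (x + t *\<^sub>R w) + f x) / t\<^sup>2 - h w\<bar>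
        \<le> 2 * e * (t * M) / t"
      using t by (simp add: pos_divide_le_eq ac_simps)
    also have "\<dots> = 2 * e0 / 3" using t M by (simp add: e_def field_simps)
    also have "\<dots> < e0" using e0 by simp
    finally show ?thesis by (simp add: dist_real_def)
  qed
  show "\<forall>\<^sub>F t in at_right 0. dist ((f (x + t *\<^sub>R u + t *\<^sub>R w) - f (x + t *\<^sub>R u) - f (x + t *\<^sub>R w) + f x) / t\<^sup>2) (h w) < e0"
    unfolding eventually_at_right_field using main d by blast
qed

lemma second_derivative_symmetric:
  fixes f :: "'a::real_normed_vector \<Rightarrow> 'b::euclidean_space"
  assumes U: "open U" "x \<in> U"
    and f: "\<And>y. y \<in> U \<Longrightarrow> (f has_derivative f' y) (at y)"
    and h: "((\<lambda>y. f' y u) has_derivative h) (at x)"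
    and k: "((\<lambda>y. f' y w) has_derivative k) (at x)"
  shows "h w = k u"
proof (rule euclidean_eqI)
  fix b :: 'b assume "b \<in> Basis"
  have f1: "((\<lambda>y. f y \<bullet> b) has_derivative (\<lambda>v. f' y v \<bullet> b)) (at y)" if "y \<in> U" for y
    using has_derivative_inner_left[OF f[OF that]] .
  have h1: "((\<lambda>y. f' y u \<bullet> b) has_derivative (\<lambda>v. h v \<bullet> b)) (at x)"
    using has_derivative_inner_left[OF h] .
  have k1: "((\<lambda>y. f' y w \<bullet> b) has_derivative (\<lambda>v. k v \<bullet> b)) (at x)"
    using has_derivative_inner_left[OF k] .
  have eq: "(\<lambda>t. (f (x + t *\<^sub>R u + t *\<^sub>R w) \<bullet> b - f (x + t *\<^sub>R u) \<bullet> b - f (x + t *\<^sub>R w) \<bullet> b + f x \<bullet> b) / t\<^sup>2)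
      = (\<lambda>t. (f (x + t *\<^sub>R w + t *\<^sub>R u) \<bullet> b - f (x + t *\<^sub>R w) \<bullet> b - f (x + t *\<^sub>R u) \<bullet> b + f x \<bullet> b) / t\<^sup>2)"
    by (simp add: algebra_simps fun_eq_iff)
  show "h w \<bullet> b = k u \<bullet> b"
    using second_difference_quotient[OF U f1 h1, of w] second_difference_quotient[OF U f1 k1, of u]
    unfolding eq using tendsto_unique trivial_limit_at_right_real by blast
qed

section \<open>Linear maps prescribed on subspaces, and exponentials of endomorphisms\<close>

lemma subspace_projection:
  fixes V :: "'v::euclidean_space set"
  assumes "subspace V"
  obtains P where "linear P" "\<And>v. P v \<in> V" "\<And>v. v \<in> V \<Longrightarrow> P v = v"
proof -
  have "linear (\<lambda>v::'v. v)" by (rule linearI) auto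
  from linear_exists_left_inverse_on[OF this assms]
  obtain g where "range g \<subseteq> V" "linear g" "\<forall>v\<in>V. g v = v" by (auto simp: inj_on_def)
  then show thesis using that[of g] by blast
qed

lemma linear_extension:
  fixes V :: "'v::euclidean_space set"
  assumes V: "subspace V" and f: "\<And>v w c. v \<in> V \<Longrightarrow> w \<in> V \<Longrightarrow> f (v + c *\<^sub>R w) = f v + c *\<^sub>R f w"
  obtains g where "linear g" "\<And>v. v \<in> V \<Longrightarrow> g v = f v" "\<And>v. g v \<in> f ` V"
proof -
  obtain P where P: "linear P" "\<And>v. P v \<in> V" "\<And>v. v \<in> V \<Longrightarrow> P v = v"
    using subspace_projection[OF V] by metis
  have f0: "f 0 = 0" using f[of 0 0 1] subspace_0[OF V] by simp
  have "linear (f \<circ> P)"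
  proof (rule linearI)
    show "(f \<circ> P) (a + b) = (f \<circ> P) a + (f \<circ> P) b" for a b
      using f[of "P a" "P b" 1] P by (simp add: linear_add)
    show "(f \<circ> P) (c *\<^sub>R a) = c *\<^sub>R (f \<circ> P) a" for a c
      using f[of 0 "P a" c] P f0 subspace_0[OF V] by (simp add: linear_scale)
  qed
  then show ?thesis using that P by auto
qed

lemma linear_funpow:
  fixes T :: "'v::real_vector \<Rightarrow> 'v"
  assumes "linear T"
  shows "linear (T ^^ n)"
proof (induction n)
  case 0
  show ?case by (rule linearI) auto
next
  case (Suc n)
  then show ?case using linear_compose[OF Suc assms] by (simp add: o_def)
qed

lemma funpow_scaleR:
  fixes T :: "'v::real_vector \<Rightarrow> 'v"
  assumes "linear T"
  shows "((\<lambda>v. t *\<^sub>R T v) ^^ n) v = t ^ n *\<^sub>R (T ^^ n) v"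
proof (induction n)
  case (Suc n)
  then show ?case using assms by (simp add: linear_scale)
qed simp

lemma norm_funpow_le:
  fixes T :: "'v::real_normed_vector \<Rightarrow> 'v"
  assumes "\<And>v. norm (T v) \<le> B * norm v" "0 \<le> B"
  shows "norm ((T ^^ n) v) \<le> B ^ n * norm v"
proof (induction n)
  case (Suc n)
  have "norm ((T ^^ Suc n) v) \<le> B * norm ((T ^^ n) v)" using assms(1) by simp
  also have "\<dots> \<le> B * (B ^ n * norm v)" using Suc assms(2) by (rule mult_left_mono)
  finally show ?case by (simp add: ac_simps)
qed simp

lemma lin_exp_sums:
  fixes T :: "'v::euclidean_space \<Rightarrow> 'v"
  assumes "linear T"
  shows "(\<lambda>n. (1 / fact n) *\<^sub>R (T ^^ n) v) sums lin_exp T v"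
proof -
  obtain B where B: "B > 0" "\<And>v. norm (T v) \<le> B * norm v"
    using linear_bounded_pos[OF assms] by blast
  have "summable (\<lambda>n. norm v * (inverse (fact n) * B ^ n))"
    by (intro summable_mult summable_exp)
  then have "summable (\<lambda>n. (1 / fact n) *\<^sub>R (T ^^ n) v)"
  proof (rule summable_comparison_test'[where N = 0])
    show "norm ((1 / fact n) *\<^sub>R (T ^^ n) v) \<le> norm v * (inverse (fact n) * B ^ n)" for n
      using norm_funpow_le[of T B n v] B by (simp add: field_simps)
  qed
  then show ?thesis unfolding lin_exp_def by (rule summable_sums)
qed

lemma lin_exp_scaled_sums:
  fixes T :: "'v::euclidean_space \<Rightarrow> 'v"
  assumes "linear T"
  shows "(\<lambda>n. (t ^ n / fact n) *\<^sub>R (T ^^ n) v) sums lin_exp (\<lambda>v. t *\<^sub>R T v) v"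
  using lin_exp_sums[OF linear_compose_scale_right[OF assms], of t v]
  by (simp add: funpow_scaleR[OF assms])

text \<open>Each component is a scalar power series in \<open>t\<close>. Differentiating it termwise
  replaces \<open>v\<close> by \<open>T v\<close> in the coefficients, and \<open>T\<close> commutes
  with its own exponential.\<close>

lemma lin_exp_has_vector_derivative:
  fixes T :: "'v::euclidean_space \<Rightarrow> 'v"
  assumes T: "linear T"
  shows "((\<lambda>t. lin_exp (\<lambda>v. t *\<^sub>R T v) v) has_vector_derivative T (lin_exp (\<lambda>v. t *\<^sub>R T v) v)) (at t)"
proof -
  have comp: "(\<lambda>n. ((T ^^ n) v \<bullet> b / fact n) * t ^ n) sums (lin_exp (\<lambda>v. t *\<^sub>R T v) v \<bullet> b)" for b t v
    using bounded_linear.sums[OF bounded_linear_inner_left lin_exp_scaled_sums[OF T, of t v], of b]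
    by (simp add: field_simps)
  have Texp: "T (lin_exp (\<lambda>v. t *\<^sub>R T v) v) = lin_exp (\<lambda>v. t *\<^sub>R T v) (T v)" for t v
  proof -
    have "(\<lambda>n. T ((t ^ n / fact n) *\<^sub>R (T ^^ n) v)) sums T (lin_exp (\<lambda>v. t *\<^sub>R T v) v)"
      using bounded_linear.sums[OF _ lin_exp_scaled_sums[OF T]] T linear_conv_bounded_linear by blast
    moreover have "(\<lambda>n. T ((t ^ n / fact n) *\<^sub>R (T ^^ n) v)) = (\<lambda>n. (t ^ n / fact n) *\<^sub>R (T ^^ n) (T v))"
      using linear_scale[OF T] by (simp add: funpow_swap1)
    ultimately show ?thesis using lin_exp_scaled_sums[OF T, of t "T v"] sums_unique2 by metis
  qed
  have "((\<lambda>t. lin_exp (\<lambda>v. t *\<^sub>R T v) v \<bullet> b) has_real_derivative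
      T (lin_exp (\<lambda>v. t *\<^sub>R T v) v) \<bullet> b) (at t)" for b
  proof -
    define c where "c n = (T ^^ n) v \<bullet> b / fact n" for n
    have "diffs c = (\<lambda>n. (T ^^ n) (T v) \<bullet> b / fact n)"
      by (rule ext) (simp add: diffs_def c_def funpow_swap1 field_simps del: of_nat_Suc)
    then have "(\<Sum>n. diffs c n * t ^ n) = T (lin_exp (\<lambda>v. t *\<^sub>R T v) v) \<bullet> b"
      using sums_unique[OF comp[of "T v" b t]] Texp by simp
    moreover have "((\<lambda>x. \<Sum>n. c n * x^n) has_field_derivative (\<Sum>n. diffs c n * t^n)) (at t)"
      by (rule termdiffs_strong_converges_everywhere) (use comp in \<open>auto simp: c_def sums_iff\<close>)
    moreover have "(\<lambda>x. \<Sum>n. c n * x^n) = (\<lambda>t. lin_exp (\<lambda>v. t *\<^sub>R T v) v \<bullet> b)"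
      using sums_unique[OF comp[of v b]] by (simp add: c_def)
    ultimately show ?thesis by simp
  qed
  then show ?thesis
    unfolding has_vector_derivative_def
    by (subst has_derivative_componentwise_within)
      (auto simp: has_field_derivative_def mult_commute_abs)
qed

text \<open>A Gronwall argument: if \<open>B\<close> bounds \<open>T\<close>, then the square of the
  norm of \<open>g\<close>, multiplied by \<open>exp (- 2 * B * t)\<close>, is nonincreasing and
  starts at 0. Negative times follow by reversing time, which replaces \<open>T\<close> by
  \<open>- T\<close>.\<close>

lemma linear_ode_zero:
  fixes T :: "'v::euclidean_space \<Rightarrow> 'v"
  assumes T: "linear T" and g: "\<And>t. (g has_vector_derivative T (g t)) (at t)" and g0: "g 0 = 0"
  shows "g t = 0"
proof -
  have pos: "g t = 0" if T: "linear T" and g: "\<And>t. (g has_vector_derivative T (g t)) (at t)"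
    and g0: "g 0 = 0" and t: "t \<ge> 0" for T :: "'v \<Rightarrow> 'v" and g t
  proof -
    obtain B where B: "B > 0" "\<And>v. norm (T v) \<le> B * norm v"
      using linear_bounded_pos[OF T] by blast
    define \<phi> where "\<phi> s = (g s \<bullet> g s) * exp (- 2 * B * s)" for s
    have "\<exists>y. (\<phi> has_real_derivative y) (at s) \<and> y \<le> 0" for s
    proof -
      have g1: "(g has_derivative (\<lambda>h. h *\<^sub>R T (g s))) (at s)"
        using g[of s] by (simp add: has_vector_derivative_def)
      have "((\<lambda>s. g s \<bullet> g s) has_derivative (\<lambda>h. g s \<bullet> (h *\<^sub>R T (g s)) + (h *\<^sub>R T (g s)) \<bullet> g s)) (at s)"
        by (rule has_derivative_inner[OF g1 g1])
      moreover have "(\<lambda>h. g s \<bullet> (h *\<^sub>R T (g s)) + (h *\<^sub>R T (g s)) \<bullet> g s) = (*) (2 * (g s \<bullet> T (g s)))"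
        by (simp add: fun_eq_iff inner_commute algebra_simps)
      ultimately have d: "((\<lambda>s. g s \<bullet> g s) has_real_derivative 2 * (g s \<bullet> T (g s))) (at s)"
        by (simp add: has_field_derivative_def)
      have "(\<phi> has_real_derivative (2 * (g s \<bullet> T (g s)) - 2 * B * (g s \<bullet> g s)) * exp (- 2 * B * s)) (at s)"
        unfolding \<phi>_def by (rule derivative_eq_intros d refl | simp add: algebra_simps)+
      moreover have "g s \<bullet> T (g s) \<le> B * (g s \<bullet> g s)"
      proof -
        have "g s \<bullet> T (g s) \<le> norm (g s) * norm (T (g s))" by (rule norm_cauchy_schwarz)
        also have "\<dots> \<le> norm (g s) * (B * norm (g s))" by (intro mult_left_mono B) auto
        finally show ?thesis by (simp add: power2_norm_eq_inner[symmetric] power2_eq_square ac_simps)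
      qed
      then have "(2 * (g s \<bullet> T (g s)) - 2 * B * (g s \<bullet> g s)) * exp (- 2 * B * s) \<le> 0"
        by (simp add: mult_le_0_iff)
      ultimately show ?thesis by blast
    qed
    then have "\<phi> t \<le> \<phi> 0" using DERIV_nonpos_imp_nonincreasing[OF t] by blast
    then have "(g t \<bullet> g t) * exp (- 2 * B * t) \<le> 0" by (simp add: \<phi>_def g0)
    then have "g t \<bullet> g t \<le> 0" by (simp add: mult_le_0_iff)
    then show ?thesis using inner_gt_zero_iff[of "g t"] by linarith
  qed
  show ?thesis
  proof (cases "t \<ge> 0")
    case True
    then show ?thesis using pos[OF T g g0] by blast
  next
    case False
    have "((\<lambda>s. g (- s)) has_vector_derivative - T (g (- s))) (at s)" for s
    proof -
      have "((\<lambda>s::real. - s) has_vector_derivative - 1) (at s)"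
        unfolding has_real_derivative_iff_has_vector_derivative[symmetric]
        by (auto intro!: derivative_eq_intros)
      from vector_diff_chain_at[OF this g[of "- s"]] show ?thesis by (simp add: o_def)
    qed
    note d = this
    have "g (- (- t)) = 0"
    proof (rule pos[of "\<lambda>v. - T v" "\<lambda>s. g (- s)"])
      show "linear (\<lambda>v. - T v)" by (rule linear_compose_neg[OF T])
      show "((\<lambda>s. g (- s)) has_vector_derivative - T (g (- s))) (at s)" for s by (rule d)
    qed (use False g0 in auto)
    then show ?thesis by simp
  qed
qed

lemma lin_exp_zero: "lin_exp (\<lambda>v. 0) w = (w :: 'v::real_normed_vector)"
proof -
  have "(\<lambda>n. (1 / fact n) *\<^sub>R ((\<lambda>v. 0 :: 'v) ^^ n) w) sums (\<Sum>n\<in>{0}. (1 / fact n) *\<^sub>R ((\<lambda>v. 0 :: 'v) ^^ n) w)"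
  proof (rule sums_finite)
    show "(1 / fact n) *\<^sub>R ((\<lambda>v. 0 :: 'v) ^^ n) w = 0" if "n \<notin> {0}" for n
    proof (cases n)
      case (Suc m)
      then have "((\<lambda>v. 0 :: 'v) ^^ n) w = (\<lambda>v. 0) (((\<lambda>v. 0 :: 'v) ^^ m) w)"
        by (simp only: funpow.simps comp_apply)
      then show ?thesis by simp
    qed (use that in simp)
  qed simp
  then show ?thesis by (simp add: lin_exp_def sums_iff)
qed

text \<open>Two solutions with the same initial value differ by a solution starting at 0.
  Conjugation, inversion and commutation of exponentials are obtained below by checking this
  differential equation, not by rearranging series.\<close>

lemma lin_exp_ode_unique:
  fixes T :: "'v::euclidean_space \<Rightarrow> 'v"
  assumes T: "linear T" and g: "\<And>t. (g has_vector_derivative T (g t)) (at t)"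
  shows "g t = lin_exp (\<lambda>v. t *\<^sub>R T v) (g 0)"
proof -
  have "g t - lin_exp (\<lambda>v. t *\<^sub>R T v) (g 0) = 0"
  proof (rule linear_ode_zero[OF T, of "\<lambda>t. g t - lin_exp (\<lambda>v. t *\<^sub>R T v) (g 0)"])
    show "((\<lambda>t. g t - lin_exp (\<lambda>v. t *\<^sub>R T v) (g 0)) has_vector_derivative
        T (g t - lin_exp (\<lambda>v. t *\<^sub>R T v) (g 0))) (at t)" for t
      using has_vector_derivative_diff[OF g lin_exp_has_vector_derivative[OF T]] linear_diff[OF T]
      by simp
  qed (simp add: lin_exp_zero)
  then show ?thesis by simp
qed

lemma lin_exp_cong:
  assumes "\<And>v. v \<in> V \<Longrightarrow> T v = T' v" "\<And>v. v \<in> V \<Longrightarrow> T' v \<in> V" "v \<in> V"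
  shows "lin_exp T v = lin_exp T' v"
proof -
  have "(T ^^ n) v = (T' ^^ n) v \<and> (T' ^^ n) v \<in> V" for n
    by (induction n) (use assms in auto)
  then show ?thesis by (simp add: lin_exp_def)
qed

lemma lin_exp_in_subspace:
  fixes T :: "'v::euclidean_space \<Rightarrow> 'v"
  assumes "linear T" "subspace W" "\<And>n. (T ^^ n) v \<in> W"
  shows "lin_exp T v \<in> W"
proof (rule closed_sequentially[OF closed_subspace[OF assms(2)]])
  show "(\<lambda>m. \<Sum>n<m. (1 / fact n) *\<^sub>R (T ^^ n) v) \<longlonglongrightarrow> lin_exp T v"
    using lin_exp_sums[OF assms(1)] by (simp add: sums_def)
  show "(\<Sum>n<m. (1 / fact n) *\<^sub>R (T ^^ n) v) \<in> W" for m
    using assms by (intro subspace_sum subspace_scale)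
qed

lemma linear_lin_exp:
  fixes T :: "'v::euclidean_space \<Rightarrow> 'v"
  assumes T: "linear T"
  shows "linear (lin_exp T)"
proof (rule linearI)
  show "lin_exp T (v + w) = lin_exp T v + lin_exp T w" for v w
    using sums_add[OF lin_exp_sums[OF T, of v] lin_exp_sums[OF T, of w]] lin_exp_sums[OF T, of "v + w"]
    by (simp add: linear_add[OF linear_funpow[OF T]] scaleR_add_right[symmetric] sums_unique2)
  show "lin_exp T (c *\<^sub>R v) = c *\<^sub>R lin_exp T v" for c v
    using bounded_linear.sums[OF bounded_linear_scaleR_right lin_exp_sums[OF T, of v], of c]
      lin_exp_sums[OF T, of "c *\<^sub>R v"]
    by (simp add: linear_scale[OF linear_funpow[OF T]] sums_unique2)
qed

lemma lin_exp_inverse: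
  fixes T :: "'v::euclidean_space \<Rightarrow> 'v"
  assumes T: "linear T"
  shows "lin_exp T (lin_exp (\<lambda>v. - T v) v) = v"
proof -
  \<comment> \<open>The exponential delayed by one unit of time runs from
    \<open>lin_exp (\<lambda>v. - T v) v\<close> at 0 to \<open>v\<close> at 1.\<close>
  define g where "g t = lin_exp (\<lambda>v. (t - 1) *\<^sub>R T v) v" for t
  have "(g has_vector_derivative T (g t)) (at t)" for t
  proof -
    have "((\<lambda>t::real. t - 1) has_vector_derivative 1) (at t)"
      unfolding has_real_derivative_iff_has_vector_derivative[symmetric]
      by (auto intro!: derivative_eq_intros)
    from vector_diff_chain_at[OF this lin_exp_has_vector_derivative[OF T, of v "t - 1"]]
    show ?thesis by (simp add: o_def g_def[abs_def])
  qed
  from lin_exp_ode_unique[OF T this, of 1] have "g 1 = lin_exp T (g 0)" by simp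
  moreover have "g 1 = v" by (simp add: g_def lin_exp_zero)
  ultimately show ?thesis by (simp add: g_def)
qed

section \<open>The normal Cartan connection\<close>

lemma smat_nth:
  fixes a z1 z2 z3 z4 x1 x2 x3 x4 p q1 q2 r1 r2 s :: real
  defines "M \<equiv> smat a z1 z2 z3 z4 x1 x2 x3 x4 p q1 q2 r1 r2 s"
  shows "M$1$1 = a" "M$1$2 = z1" "M$1$3 = z2" "M$1$4 = z3" "M$1$5 = z4"
    "M$2$1 = x1" "M$3$1 = x2" "M$4$1 = x3" "M$5$1 = x4"
    "M$2$2 = p" "M$2$3 = q1" "M$2$4 = q2" "M$3$2 = r1" "M$4$2 = r2" "M$4$3 = s"
  unfolding M_def by (simp_all add: smat_def vector_6)

lemma lie_Zpos:
  assumes "M \<in> so24"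
  shows "lie (Zpos 1) M = smat (M$2$1) (M$2$2 - M$1$1) (M$2$3) (M$2$4) 0 0 0 0 0
      (- M$2$1) 0 0 (- M$3$1) (- M$4$1) 0"
    and "lie (Zpos 2) M = smat (M$3$1) (M$3$2) (- M$1$1) (- M$4$3) (- M$2$3) 0 0 0 0
      0 (- M$2$1) 0 (M$5$1) 0 (- M$4$1)"
    and "lie (Zpos 3) M = smat (M$4$1) (M$4$2) (M$4$3) (- M$1$1) (- M$2$4) 0 0 0 0
      0 0 (- M$2$1) 0 (M$5$1) (M$3$1)"
    and "lie (Zpos 4) M = smat (M$5$1) 0 (- M$3$2) (- M$4$2) (- M$1$1 - M$2$2) 0 0 0 0
      (M$5$1) (M$3$1) (M$4$1) 0 0 0"
  using assms by (auto elim!: so24E simp: Zpos_smat lie_smat smat_nth smat_eq_iff)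

text \<open>Sorted by degree: the first seven equations involve only the first columns, i.e. the
  torsion, and the last four only the entries of degree 0. This makes a solution in two stages
  possible.\<close>

lemma codiff2_lie_zero:
  assumes "\<And>i k. \<kappa> i k \<in> so24" "codiff2 lie \<kappa> j = 0"
  shows "\<kappa> 1 j$2$1 + \<kappa> 2 j$3$1 + \<kappa> 3 j$4$1 + \<kappa> 4 j$5$1 = 0"
    "\<kappa> 4 j$5$1 = \<kappa> 1 j$2$1" "\<kappa> 4 j$3$1 = \<kappa> 2 j$2$1" "\<kappa> 4 j$4$1 = \<kappa> 3 j$2$1"
    "\<kappa> 2 j$5$1 = \<kappa> 1 j$3$1" "\<kappa> 3 j$5$1 = \<kappa> 1 j$4$1" "\<kappa> 3 j$3$1 = \<kappa> 2 j$4$1"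
    "\<kappa> 1 j$2$2 - \<kappa> 1 j$1$1 + \<kappa> 2 j$3$2 + \<kappa> 3 j$4$2 = 0"
    "\<kappa> 1 j$2$3 - \<kappa> 2 j$1$1 + \<kappa> 3 j$4$3 - \<kappa> 4 j$3$2 = 0"
    "\<kappa> 1 j$2$4 - \<kappa> 2 j$4$3 - \<kappa> 3 j$1$1 - \<kappa> 4 j$4$2 = 0"
    "\<kappa> 2 j$2$3 + \<kappa> 3 j$2$4 + \<kappa> 4 j$1$1 + \<kappa> 4 j$2$2 = 0"
  using assms(2) unfolding codiff2_def sum_4
  by (simp_all add: lie_Zpos assms(1) smat_simps smat_eq_iff smat_0[symmetric])

text \<open>With its index lowered, the torsion becomes a tensor that is skew in the last two
  arguments, while the normalization makes it symmetric in the first two. Such a tensor vanishes, as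
  in the uniqueness of the Levi-Civita connection.\<close>

lemma codiff2_torsion_zero:
  assumes "\<And>i k. \<kappa> i k \<in> so24" "\<And>i k. \<kappa> i k = - \<kappa> k i" "\<And>j. codiff2 lie \<kappa> j = 0"
  shows "\<kappa> i k$2$1 = 0 \<and> \<kappa> i k$3$1 = 0 \<and> \<kappa> i k$4$1 = 0 \<and> \<kappa> i k$5$1 = 0"
proof -
  define t where "t l i k = (if l = 1 then \<kappa> i k$2$1 else if l = 2 then \<kappa> i k$3$1 else
    if l = 3 then \<kappa> i k$4$1 else \<kappa> i k$5$1)" for i k l :: 4
  \<comment> \<open>Lowering an index with \<open>nu\<close> exchanges the first and the last
    component.\<close>
  define f :: "4 \<Rightarrow> 4" where "f l = (if l = 1 then 4 else if l = 4 then 1 else l)" for l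
  define T where "T l i k = t (f l) i k" for l i k
  have anti: "T l i k = - T l k i" for l i k
    using assms(2)[of i k] by (simp add: T_def t_def)
  have symm: "T l j i = T i j l" for i j l
  proof -
    have "T l i j = T i l j"
      using codiff2_lie_zero[OF assms(1,3), of j] exhaust_4[of i] exhaust_4[of l]
      by (auto simp: T_def t_def f_def)
    then show ?thesis using anti[of l j i] anti[of i j l] by simp
  qed
  have "T l i k = 0" for l i k
    using symm[of l i k] anti[of k i l] symm[of k l i] anti[of i l k] symm[of i k l] anti[of l k i]
    by linarith
  then have "t l i k = 0" for l
    unfolding T_def using exhaust_4[of l] by (metis f_def)
  from this[of 1] this[of 2] this[of 3] this[of 4] show ?thesis by (simp add: t_def)
qed

text \<open>The values of the connection on the frame. The first column is the dual coframe, the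
  middle block is the Levi-Civita connection, determined by the brackets of the frame through
  vanishing torsion, and the first row is then forced by the trace condition on the
  curvature.\<close>

definition Omega :: "4 \<Rightarrow> real^6^6" where
  "Omega i =
    (if i = 1 then smat 0 6 0 0 (1/2) 1 0 0 0 0 (-1) 0 2 (-2) 0
     else if i = 2 then smat 0 0 (1/2) 0 0 0 1 0 0 1 0 0 0 0 0
     else if i = 3 then smat 0 0 0 (-1/2) 0 0 0 1 0 (-2) 0 0 0 0 0
     else smat 0 (1/2) 0 0 0 0 0 0 1 0 0 0 (-1) 0 0)"

lemma Omega_simps:
  "Omega 1 = smat 0 6 0 0 (1/2) 1 0 0 0 0 (-1) 0 2 (-2) 0"
  "Omega 2 = smat 0 0 (1/2) 0 0 0 1 0 0 1 0 0 0 0 0"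
  "Omega 3 = smat 0 0 0 (-1/2) 0 0 0 1 0 (-2) 0 0 0 0 0"
  "Omega 4 = smat 0 (1/2) 0 0 0 0 0 0 1 0 0 0 (-1) 0 0"
  by (simp_all add: Omega_def)

lemma Omega_in_so24 [simp]: "Omega i \<in> so24"
  by (simp add: Omega_def)

text \<open>The structure constants of the subalgebra \<open>x5 = 0\<close> in the basis of
  coordinate directions. Pairs with \<open>i < k\<close> are listed, and the difference makes the
  table skew.\<close>

definition frame_bracket :: "4 \<Rightarrow> 4 \<Rightarrow> real^4" where
  "frame_bracket i k = (let c = (\<lambda>i k. if i = 1 \<and> k = 2 then vector [-2, 0, 0, -2]
     else if i = 1 \<and> k = 3 then vector [2, 0, 0, 2] else if i = 1 \<and> k = 4 then vector [0, 2, 0, 0]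
     else if i = 2 \<and> k = 4 then vector [0, 0, 0, -2]
     else if i = 3 \<and> k = 4 then vector [0, 0, 0, 2] else (0 :: real^4)) in c i k - c k i)"

definition frame_deriv :: "real^4 \<Rightarrow> 4 \<Rightarrow> real^4 \<Rightarrow> real^4" where
  "frame_deriv x k u = (vector
     [vector [exp (2 * x$2 - 2 * x$3) * (2 * u$2 - 2 * u$3), - 2 * u$4, 0,
        - (1/2) * (8 * x$4 * u$4 - exp (4 * x$2 - 4 * x$3) * (4 * u$2 - 4 * u$3))],
      vector [0, 0, 0, 2 * u$4],
      vector [0, 0, 0, - 2 * u$4],
      vector [0, 0, 0, 0]] :: real^4^4) $ k"

lemma has_derivative_vector_4:
  assumes "\<And>i. ((\<lambda>x. f x $ i) has_derivative (\<lambda>u. f' u $ i)) (at a)"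
  shows "((f :: _ \<Rightarrow> real^4) has_derivative f') (at a)"
  unfolding has_derivative_componentwise_within[of f]
  using assms by (auto simp: Basis_vec_def inner_axis)

lemma vec_nth_has_derivative [derivative_intros]:
  "((\<lambda>x. x $ i) has_derivative (\<lambda>u. u $ i)) F"
  by (rule bounded_linear_imp_has_derivative[OF bounded_linear_vec_nth])

lemma frame_has_derivative:
  "((\<lambda>y. frame y k) has_derivative frame_deriv x k) (at x)"
proof (rule has_derivative_vector_4)
  fix i :: 4
  show "((\<lambda>y. frame y k $ i) has_derivative (\<lambda>u. frame_deriv x k u $ i)) (at x)"
    using exhaust_4[of k] exhaust_4[of i]
    by (elim disjE; simp add: frame_def frame_deriv_def;
        (auto intro!: derivative_eq_intros simp: fun_eq_iff field_simps)?)
qed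

lemma frame_bracket:
  "frame_deriv x k (frame x i) - frame_deriv x i (frame x k) =
     (\<Sum>l\<in>UNIV. frame_bracket i k $ l *\<^sub>R frame x l)"
  using exhaust_4[of i] exhaust_4[of k]
  by (elim disjE; simp add: vec_eq_iff forall_4 sum_4 frame_def frame_deriv_def frame_bracket_def
      Let_def algebra_simps power2_eq_square exp_add[symmetric] exp_diff)

text \<open>The dual coframe in closed form, by back substitution: the components of the frame
  vectors form a triangular matrix.\<close>

definition coords :: "real^4 \<Rightarrow> real^4 \<Rightarrow> real^4" where
  "coords x u = vector
     [exp (2 * x$3 - 2 * x$2) * u$1,
      u$2 + 2 * x$4 * exp (2 * x$3 - 2 * x$2) * u$1,
      u$3,
      u$4 - 2 * x$4 * u$2 + 2 * x$4 * u$3 + (1/2 * exp (2 * x$3 - 2 * x$2)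
        - 1/2 * exp (2 * x$2 - 2 * x$3) - 2 * (x$4)\<^sup>2 * exp (2 * x$3 - 2 * x$2)) * u$1]"

lemma exp_frame:
  fixes a b :: real
  shows "exp (4 * a - 4 * b) = exp (2 * a - 2 * b) * exp (2 * a - 2 * b)"
    and "exp (2 * a - 2 * b) * exp (2 * b - 2 * a) = 1"
    and "exp (2 * b - 2 * a) * exp (2 * a - 2 * b) = 1"
  by (simp_all add: exp_add[symmetric])

lemma coords_expansion: "u = (\<Sum>i\<in>UNIV. coords x u $ i *\<^sub>R frame x i)"
proof -
  define E F where "E = exp (2 * x$2 - 2 * x$3)" and "F = exp (2 * x$3 - 2 * x$2)"
  have EF: "E * F = 1" by (simp add: E_def F_def exp_frame)
  have E4: "exp (4 * x$2 - 4 * x$3) = E * E" by (simp add: E_def exp_frame)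
  have 1: "F * u$1 * E = u$1" using EF by (simp add: ac_simps)
  have 2: "E * (E * (F * u$1)) = E * u$1" using EF by (metis 1 mult.commute)
  show ?thesis
    unfolding vec_eq_iff forall_4 sum_4 coords_def frame_def
    by (simp add: E4 E_def[symmetric] F_def[symmetric] 1)
       (use EF in \<open>simp add: field_simps power2_eq_square 2\<close>)
qed

lemma linear_coords: "linear (coords x)"
  by (rule linearI) (simp_all add: coords_def vec_eq_iff forall_4 field_simps)

lemma coords_frame: "coords x (frame x i) = axis i 1"
  using exhaust_4[of i]
  by (elim disjE; simp add: vec_eq_iff forall_4 coords_def frame_def axis_def exp_frame
      field_simps power2_eq_square)


lemma linear_axis_expansion:
  fixes f :: "real^'n \<Rightarrow> 'b::real_vector"
  assumes "linear f"
  shows "f u = (\<Sum>m\<in>UNIV. u $ m *\<^sub>R f (axis m 1))"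
proof -
  have "u = (\<Sum>m\<in>UNIV. u $ m *\<^sub>R axis m 1)"
    using basis_expansion[of u] by (simp add: scalar_mult_eq_scaleR)
  then have "f u = f (\<Sum>m\<in>UNIV. u $ m *\<^sub>R axis m 1)" by simp
  then show ?thesis using assms by (simp add: linear_sum linear_scale)
qed

text \<open>Differentiability is given only for fixed second arguments, so the product rule is
  applied to the expansion of \<open>F y\<close> in the standard basis.\<close>

lemma form_has_derivative:
  fixes \<omega> :: "real^4 \<Rightarrow> real^4 \<Rightarrow> 'b::real_normed_vector"
  assumes lin: "\<And>x. linear (\<omega> x)" and diff: "\<And>u x. (\<lambda>y. \<omega> y u) differentiable (at x)"
    and F: "(F has_derivative F') (at x)"
  shows "((\<lambda>y. \<omega> y (F y)) has_derivative
    (\<lambda>u. \<omega> x (F' u) + frechet_derivative (\<lambda>y. \<omega> y (F x)) (at x) u)) (at x)"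
proof -
  define D where "D w = frechet_derivative (\<lambda>y. \<omega> y w) (at x)" for w
  have D: "((\<lambda>y. \<omega> y w) has_derivative D w) (at x)" for w
    unfolding D_def using diff frechet_derivative_works by blast
  have 1: "((\<lambda>y. \<omega> y (G y)) has_derivative
      (\<lambda>u. \<Sum>m\<in>UNIV. G x $ m *\<^sub>R D (axis m 1) u + G' u $ m *\<^sub>R \<omega> x (axis m 1))) (at x)"
    if "(G has_derivative G') (at x)" for G G'
  proof -
    have "((\<lambda>y. \<Sum>m\<in>UNIV. G y $ m *\<^sub>R \<omega> y (axis m 1)) has_derivative
      (\<lambda>u. \<Sum>m\<in>UNIV. G x $ m *\<^sub>R D (axis m 1) u + G' u $ m *\<^sub>R \<omega> x (axis m 1))) (at x)"
      by (intro has_derivative_sum has_derivative_scaleR D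
          bounded_linear.has_derivative[OF bounded_linear_vec_nth that])
    moreover have "(\<lambda>y. \<omega> y (G y)) = (\<lambda>y. \<Sum>m\<in>UNIV. G y $ m *\<^sub>R \<omega> y (axis m 1))"
      using linear_axis_expansion[OF lin] by (rule ext)
    ultimately show ?thesis by simp
  qed
  have "D (F x) u = (\<Sum>m\<in>UNIV. F x $ m *\<^sub>R D (axis m 1) u)" for u
    using has_derivative_unique[OF D[of "F x"] 1[OF has_derivative_const]] by (simp add: fun_eq_iff)
  moreover have "\<omega> x (F' u) = (\<Sum>m\<in>UNIV. F' u $ m *\<^sub>R \<omega> x (axis m 1))" for u
    using linear_axis_expansion[OF lin] .
  ultimately show ?thesis
    using 1[OF F] by (simp add: D_def[symmetric] sum.distrib add.commute)
qed

text \<open>Cartan's formula for the exterior derivative. In \<open>curv\<close> the arguments are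
  extended by constant vector fields, which commute; extending them by the frame instead brings in
  the bracket term.\<close>

lemma curv_frame:
  fixes \<omega> :: "real^4 \<Rightarrow> real^4 \<Rightarrow> real^6^6"
  assumes lin: "\<And>x. linear (\<omega> x)" and diff: "\<And>u x. (\<lambda>y. \<omega> y u) differentiable (at x)"
    and D: "\<And>k. ((\<lambda>y. \<omega> y (frame y k)) has_derivative D k) (at x)"
  shows "curv \<omega> x (frame x i) (frame x k) = D k (frame x i) - D i (frame x k)
    - (\<Sum>l\<in>UNIV. frame_bracket i k $ l *\<^sub>R \<omega> x (frame x l))
    + lie (\<omega> x (frame x i)) (\<omega> x (frame x k))"
proof -
  have 1: "frechet_derivative (\<lambda>y. \<omega> y (frame x k)) (at x) u = D k u - \<omega> x (frame_deriv x k u)" for k u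
    using has_derivative_unique[OF D[of k] form_has_derivative[OF lin diff frame_has_derivative]]
    by (simp add: fun_eq_iff)
  have "(\<Sum>l\<in>UNIV. frame_bracket i k $ l *\<^sub>R \<omega> x (frame x l)) =
      \<omega> x (frame_deriv x k (frame x i)) - \<omega> x (frame_deriv x i (frame x k))"
    unfolding linear_diff[OF lin, symmetric] frame_bracket
    by (simp add: linear_sum[OF lin] linear_scale[OF lin])
  then show ?thesis unfolding curv_def 1 by simp
qed

text \<open>What \<open>curv_frame\<close> leaves when the form takes constant values on the frame:
  the derivative terms vanish.\<close>

definition curv_const :: "4 \<Rightarrow> 4 \<Rightarrow> real^6^6" where
  "curv_const i k = lie (Omega i) (Omega k) - (\<Sum>l\<in>UNIV. frame_bracket i k $ l *\<^sub>R Omega l)"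

lemma curv_const_antisym: "curv_const i k = - curv_const k i"
  by (simp add: curv_const_def lie_def frame_bracket_def Let_def sum_negf[symmetric] algebra_simps
      sum_subtractf)

lemma curv_const_values:
  "curv_const 1 2 = smat 0 18 0 0 0 0 0 0 0 0 0 0 (-2) (-6) 0"
  "curv_const 1 3 = smat 0 (-26) 0 0 0 0 0 0 0 0 0 0 (-6) 2 0"
  "curv_const 1 4 = 0" "curv_const 2 3 = 0" "curv_const 2 4 = 0" "curv_const 3 4 = 0"
  "curv_const i i = 0"
  by (simp_all add: curv_const_def Omega_simps frame_bracket_def Let_def sum_4 lie_smat smat_simps
      smat_0[symmetric] smat_eq_iff) (simp add: lie_def smat_0)

lemma codiff2_curv_const: "codiff2 lie curv_const j = 0"
proof -
  have "curv_const 2 1 = - curv_const 1 2" "curv_const 3 1 = - curv_const 1 3"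
    "curv_const 4 1 = - curv_const 1 4" "curv_const 3 2 = - curv_const 2 3"
    "curv_const 4 2 = - curv_const 2 4" "curv_const 4 3 = - curv_const 3 4"
    by (rule curv_const_antisym)+
  then show ?thesis
    using exhaust_4[of j] unfolding codiff2_def sum_4
    by (elim disjE; simp add: curv_const_values Zpos_smat smat_simps lie_smat smat_0[symmetric])
qed

definition cform :: "real^4 \<Rightarrow> real^4 \<Rightarrow> real^6^6" where
  "cform x u = (\<Sum>i\<in>UNIV. coords x u $ i *\<^sub>R Omega i)"

lemma linear_cform: "linear (cform x)"
  unfolding cform_def
  by (rule linearI)
    (simp_all add: linear_add[OF linear_coords] linear_scale[OF linear_coords] scaleR_add_left
      sum.distrib scaleR_sum_right)

lemma cform_frame: "cform x (frame x i) = Omega i"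
proof -
  have "cform x (frame x i) = (\<Sum>l\<in>UNIV. if l = i then Omega l else 0)"
    unfolding cform_def coords_frame by (intro sum.cong) (auto simp: axis_def)
  then show ?thesis by simp
qed

lemma met_frame: "met x (frame x i) (frame x j) = nu $ i $ j"
proof -
  define E F where "E = exp (2 * x$2 - 2 * x$3)" and "F = exp (2 * x$3 - 2 * x$2)"
  have EF: "E * F = 1" by (simp add: E_def F_def exp_frame)
  have EF': "E * (F * c) = c" "F * (E * c) = c" "F * E = 1" "E * (E * (F * F)) = 1" for c
  proof -
    show 1: "E * (F * c) = c" for c using EF by (simp add: mult.assoc[symmetric])
    show "F * (E * c) = c" "F * E = 1" using EF by (simp_all add: mult.assoc[symmetric] mult.commute)
    show "E * (E * (F * F)) = 1" by (simp only: 1 EF)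
  qed
  have E4: "exp (4 * x$2 - 4 * x$3) = E * E" "exp (4 * x$3 - 4 * x$2) = F * F"
    by (simp_all add: E_def F_def exp_frame)
  show ?thesis
    using exhaust_4[of i] exhaust_4[of j]
    by (elim disjE; simp add: met_def frame_def nu_def E4 E_def[symmetric] F_def[symmetric];
        simp add: EF EF' algebra_simps power2_eq_square)
qed

text \<open>Monomials in the fourth coordinate times exponentials in the difference of the third and
  second one: these are the coefficients of the dual coframe, and their sums are closed under
  differentiation.\<close>

inductive_set exp_poly :: "(real^4 \<Rightarrow> 'b::real_normed_vector) set" where
  monom: "(\<lambda>x. (x$4 ^ m * exp (c * (2 * x$3 - 2 * x$2))) *\<^sub>R C) \<in> exp_poly"
| plus: "f \<in> exp_poly \<Longrightarrow> g \<in> exp_poly \<Longrightarrow> (\<lambda>x. f x + g x) \<in> exp_poly"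

lemma exp_poly_has_derivative:
  fixes f :: "real^4 \<Rightarrow> 'b::real_normed_vector"
  assumes "f \<in> exp_poly"
  shows "\<exists>f'. (\<forall>x. (f has_derivative f' x) (at x)) \<and> (\<forall>b. (\<lambda>x. f' x b) \<in> exp_poly)"
  using assms
proof induction
  case (monom m c C)
  \<comment> \<open>For \<open>m = 0\<close> the truncated exponent \<open>m - 1\<close> is harmless
    because of the factor \<open>real m\<close>.\<close>
  let ?f' = "\<lambda>x b. (x$4 ^ (m - 1) * exp (c * (2 * x$3 - 2 * x$2))) *\<^sub>R ((real m * b$4) *\<^sub>R C)
    + (x$4 ^ m * exp (c * (2 * x$3 - 2 * x$2))) *\<^sub>R ((c * (2 * b$3 - 2 * b$2)) *\<^sub>R C)"
  have "((\<lambda>x. (x$4 ^ m * exp (c * (2 * x$3 - 2 * x$2))) *\<^sub>R C) has_derivative ?f' x) (at x)"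
    for x :: "real^4"
  proof -
    have "((\<lambda>x. x$4 ^ m * exp (c * (2 * x$3 - 2 * x$2))) has_derivative
      (\<lambda>b. x$4 ^ (m - 1) * exp (c * (2 * x$3 - 2 * x$2)) * (real m * b$4)
        + x$4 ^ m * exp (c * (2 * x$3 - 2 * x$2)) * (c * (2 * b$3 - 2 * b$2)))) (at x)"
      by (auto intro!: derivative_eq_intros simp: algebra_simps fun_eq_iff)
    from has_derivative_scaleR_left[OF this, of C] show ?thesis
      by (simp add: scaleR_add_left)
  qed
  moreover have "(\<lambda>x. ?f' x b) \<in> exp_poly" for b :: "real^4"
    by (intro exp_poly.intros)
  ultimately show ?case by (intro exI[of _ ?f']) simp
next
  case (plus f g)
  then obtain f' g' where *: "\<And>x. (f has_derivative f' x) (at x)" "\<And>b. (\<lambda>x. f' x b) \<in> exp_poly"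
    "\<And>x. (g has_derivative g' x) (at x)" "\<And>b. (\<lambda>x. g' x b) \<in> exp_poly" by blast
  have "((\<lambda>x. f x + g x) has_derivative (\<lambda>b. f' x b + g' x b)) (at x)" for x
    by (intro has_derivative_add *)
  moreover have "(\<lambda>x. f' x b + g' x b) \<in> exp_poly" for b by (intro exp_poly.plus *)
  ultimately show ?case by (intro exI[of _ "\<lambda>x b. f' x b + g' x b"]) auto
qed

lemma exp_poly_smooth:
  fixes f :: "real^4 \<Rightarrow> 'b::real_normed_vector"
  assumes "f \<in> exp_poly"
  shows "smooth_on U f"
proof (rule smooth_on_class[OF _ _ assms])
  fix f :: "real^4 \<Rightarrow> 'b" and b x :: "real^4"
  assume "f \<in> exp_poly"
  then obtain f' where f': "\<And>x. (f has_derivative f' x) (at x)" "\<And>b. (\<lambda>x. f' x b) \<in> exp_poly"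
    using exp_poly_has_derivative by blast
  show "f differentiable (at x)" using f'(1) differentiable_def by blast
  have "(\<lambda>x. frechet_derivative f (at x) b) = (\<lambda>x. f' x b)"
    using frechet_derivative_at[OF f'(1)] by simp
  then show "(\<lambda>x. frechet_derivative f (at x) b) \<in> exp_poly" using f'(2) by simp
qed

lemma cform_smooth: "smooth_on U (\<lambda>x. cform x u)"
proof (rule exp_poly_smooth)
  let ?f = "\<lambda>m c C x. (x$4 ^ m * exp (c * (2 * x$3 - 2 * x$2))) *\<^sub>R C :: real^6^6"
  have "(\<lambda>x. cform x u) = (\<lambda>x. ?f 0 1 (u$1 *\<^sub>R Omega 1) x +
      (?f 0 0 (u$2 *\<^sub>R Omega 2) x + (?f 1 1 ((2 * u$1) *\<^sub>R Omega 2) x +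
      (?f 0 0 (u$3 *\<^sub>R Omega 3) x + (?f 0 0 (u$4 *\<^sub>R Omega 4) x +
      (?f 1 0 ((2 * u$3 - 2 * u$2) *\<^sub>R Omega 4) x + (?f 0 1 ((u$1 / 2) *\<^sub>R Omega 4) x +
      (?f 0 (-1) ((- u$1 / 2) *\<^sub>R Omega 4) x + ?f 2 1 ((- 2 * u$1) *\<^sub>R Omega 4) x))))))))"
    by (simp add: fun_eq_iff cform_def sum_4 coords_def algebra_simps)
  then show "(\<lambda>x. cform x u) \<in> exp_poly" by (simp only:) (intro exp_poly.intros)
qed

lemma curv_cform: "curv cform x (frame x i) (frame x k) = curv_const i k"
proof -
  have "((\<lambda>y. cform y (frame y k)) has_derivative (\<lambda>u. 0)) (at x)" for k
    unfolding cform_frame by simp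
  from curv_frame[OF linear_cform _ this] show ?thesis
    using smooth_on_differentiable[OF cform_smooth UNIV_I] by (simp add: cform_frame curv_const_def)
qed

lemma cform_normal: "normal_cartan_connection met frame cform"
  unfolding normal_cartan_connection_def
proof (intro conjI allI)
  fix x u :: "real^4" and i j :: 4
  show "met x (frame x i) (frame x j) = nu $ i $ j" by (rule met_frame)
  show "linear (cform x)" by (rule linear_cform)
  show "smooth_on UNIV (\<lambda>x. cform x u)" by (rule cform_smooth)
  show "\<exists>z A. A \<in> so_nu \<and> cform x (frame x i) = so24_mat 0 z (axis i 1) A"
  proof -
    have "Omega 1 = so24_mat 0 (vector [6, 0, 0, 1/2]) (axis 1 1) (so_mat 0 (-1) 0 2 (-2) 0)"
      "Omega 2 = so24_mat 0 (vector [0, 1/2, 0, 0]) (axis 2 1) (so_mat 1 0 0 0 0 0)"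
      "Omega 3 = so24_mat 0 (vector [0, 0, -1/2, 0]) (axis 3 1) (so_mat (-2) 0 0 0 0 0)"
      "Omega 4 = so24_mat 0 (vector [1/2, 0, 0, 0]) (axis 4 1) (so_mat 0 0 0 (-1) 0 0)"
      by (simp_all add: so24_mat_eq_smat Omega_simps axis_def)
    then show ?thesis
      using exhaust_4[of i] so_mat_in_so_nu unfolding cform_frame by metis
  qed
  show "codiff2 lie (\<lambda>i k. curv cform x (frame x i) (frame x k)) j = 0"
    using codiff2_curv_const[of j] by (simp add: codiff2_def curv_cform)
qed


text \<open>A projection onto \<open>S\<close> fixes \<open>f - c\<close>, hence also its
  derivative. This is what removes the unknown derivatives from the normalization equations.\<close>

lemma has_derivative_in_subspace:
  fixes f :: "'a::real_normed_vector \<Rightarrow> 'b::euclidean_space"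
  assumes f: "(f has_derivative f') (at x)" and S: "subspace S" and "\<And>y. f y - c \<in> S"
  shows "f' u \<in> S"
proof -
  obtain P where P: "linear P" "\<And>v. P v \<in> S" "\<And>v. v \<in> S \<Longrightarrow> P v = v"
    using subspace_projection[OF S] by metis
  have d: "((\<lambda>y. f y - c) has_derivative f') (at x)"
    using has_derivative_diff[OF f has_derivative_const[of c]] by simp
  have "bounded_linear P" using P(1) by (simp add: linear_conv_bounded_linear)
  from bounded_linear.has_derivative[OF this d]
  have "((\<lambda>y. P (f y - c)) has_derivative (\<lambda>u. P (f' u))) (at x)" .
  moreover have "(\<lambda>y. P (f y - c)) = (\<lambda>y. f y - c)" using assms(3) P(3) by simp
  ultimately have "(\<lambda>u. P (f' u)) = f'" using has_derivative_unique d by metis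
  then show ?thesis using P(2) by metis
qed

lemma cartan_connection_form:
  assumes "\<exists>z A. A \<in> so_nu \<and> M = so24_mat 0 z (axis k 1) A"
  shows "\<exists>z1 z2 z3 z4 p q1 q2 r1 r2 s. M = smat 0 z1 z2 z3 z4 (axis k 1$1) (axis k 1$2) (axis k 1$3)
    (axis k 1$4) p q1 q2 r1 r2 s"
  using assms so_nu_iff so24_mat_eq_smat by metis

text \<open>In each degree, the condition only contains derivatives of entries already known to be
  constant. So it is an algebraic system at every point, although the connection is not assumed to
  have constant coefficients.\<close>

lemma normal_cartan_connection_unique:
  assumes "normal_cartan_connection met frame \<omega>"
  shows "\<omega> = cform"
proof -
  have lin: "linear (\<omega> x)" for x using assms by (simp add: normal_cartan_connection_def)
  have diff: "(\<lambda>y. \<omega> y u) differentiable (at x)" for u x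
    using assms smooth_on_differentiable[of UNIV "\<lambda>y. \<omega> y u" x]
    by (simp add: normal_cartan_connection_def)
  define W where "W y k = \<omega> y (frame y k)" for y k
  define D where "D x k = (\<lambda>u. \<omega> x (frame_deriv x k u) +
    frechet_derivative (\<lambda>y. \<omega> y (frame x k)) (at x) u)" for x k
  have D: "((\<lambda>y. W y k) has_derivative D x k) (at x)" for x k
    unfolding W_def D_def by (rule form_has_derivative[OF lin diff frame_has_derivative])
  have W: "\<exists>z1 z2 z3 z4 p q1 q2 r1 r2 s. W x k = smat 0 z1 z2 z3 z4 (axis k 1$1) (axis k 1$2)
      (axis k 1$3) (axis k 1$4) p q1 q2 r1 r2 s" for x k
    unfolding W_def using assms by (intro cartan_connection_form) (auto simp: normal_cartan_connection_def)
  define \<kappa> where "\<kappa> x i k = curv \<omega> x (frame x i) (frame x k)" for x i k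
  have \<kappa>: "\<kappa> x i k = D x k (frame x i) - D x i (frame x k)
      - (\<Sum>l\<in>UNIV. frame_bracket i k $ l *\<^sub>R W x l) + lie (W x i) (W x k)" for x i k
    unfolding \<kappa>_def W_def by (rule curv_frame[OF lin diff D[unfolded W_def]])
  \<comment> \<open>The first column and the top left entry are prescribed constants, so that
    derivatives lie in this subspace and cannot contribute to the torsion.\<close>
  define S1 where "S1 = {smat 0 z1 z2 z3 z4 0 0 0 0 p q1 q2 r1 r2 s | z1 z2 z3 z4 p q1 q2 r1 r2 s. True}"
  have "subspace S1"
    unfolding subspace_def S1_def by (force simp: smat_simps smat_0[symmetric])
  moreover have "W y k - smat 0 0 0 0 0 (axis k 1$1) (axis k 1$2) (axis k 1$3) (axis k 1$4) 0 0 0 0 0 0 \<in> S1"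
    for y k using W[of y k] unfolding S1_def by (clarsimp simp: smat_simps) blast
  ultimately have DS1: "D x k u \<in> S1" for x k u
    using has_derivative_in_subspace[OF D] by blast
  have "M$1$1 = 0 \<and> M$2$1 = 0 \<and> M$3$1 = 0 \<and> M$4$1 = 0 \<and> M$5$1 = 0" if "M \<in> S1" for M
    using that unfolding S1_def by (auto simp: smat_nth)
  note D1 = this[OF DS1]
  have "S1 \<subseteq> so24" unfolding S1_def by auto
  then have Dso: "D x k u \<in> so24" for x k u using DS1 by blast
  have Wso: "W x k \<in> so24" for x k using W[of x k] by auto
  have \<kappa>so: "\<kappa> x i k \<in> so24" for x i k
    unfolding \<kappa> by (intro subspace_add[OF subspace_so24] subspace_diff[OF subspace_so24]
        subspace_sum[OF subspace_so24] subspace_scale[OF subspace_so24] lie_in_so24 Dso Wso)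
  have anti: "\<kappa> x i k = - \<kappa> x k i" for x i k
    unfolding \<kappa>_def curv_def lie_def by simp
  have cod: "codiff2 lie (\<kappa> x) j = 0" for x j
    using assms unfolding normal_cartan_connection_def \<kappa>_def by (simp add: codiff2_def)
  have br: "frame_bracket 1 2 = vector [-2, 0, 0, -2]" "frame_bracket 1 3 = vector [2, 0, 0, 2]"
    "frame_bracket 1 4 = vector [0, 2, 0, 0]" "frame_bracket 2 3 = 0"
    "frame_bracket 2 4 = vector [0, 0, 0, -2]" "frame_bracket 3 4 = vector [0, 0, 0, 2]"
    "frame_bracket 2 1 = vector [2, 0, 0, 2]" "frame_bracket 3 1 = vector [-2, 0, 0, -2]"
    "frame_bracket 4 1 = vector [0, -2, 0, 0]" "frame_bracket 3 2 = 0"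
    "frame_bracket 4 2 = vector [0, 0, 0, 2]" "frame_bracket 4 3 = vector [0, 0, 0, -2]"
    "frame_bracket i i = 0" for i
    by (simp_all add: frame_bracket_def Let_def vec_eq_iff forall_4)
  have A: "\<exists>z1 z2 z3 z4. W x 1 = smat 0 z1 z2 z3 z4 1 0 0 0 0 (-1) 0 2 (-2) 0"
    "\<exists>z1 z2 z3 z4. W x 2 = smat 0 z1 z2 z3 z4 0 1 0 0 1 0 0 0 0 0"
    "\<exists>z1 z2 z3 z4. W x 3 = smat 0 z1 z2 z3 z4 0 0 1 0 (-2) 0 0 0 0 0"
    "\<exists>z1 z2 z3 z4. W x 4 = smat 0 z1 z2 z3 z4 0 0 0 1 0 0 0 (-1) 0 0" for x
  proof -
    obtain a1 a2 a3 a4 p1 q11 q21 r11 r21 s1 where 1: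
      "W x 1 = smat 0 a1 a2 a3 a4 1 0 0 0 p1 q11 q21 r11 r21 s1"
      using W[of x 1] by (auto simp: axis_def)
    obtain b1 b2 b3 b4 p2 q12 q22 r12 r22 s2 where 2:
      "W x 2 = smat 0 b1 b2 b3 b4 0 1 0 0 p2 q12 q22 r12 r22 s2"
      using W[of x 2] by (auto simp: axis_def)
    obtain c1 c2 c3 c4 p3 q13 q23 r13 r23 s3 where 3:
      "W x 3 = smat 0 c1 c2 c3 c4 0 0 1 0 p3 q13 q23 r13 r23 s3"
      using W[of x 3] by (auto simp: axis_def)
    obtain d1 d2 d3 d4 p4 q14 q24 r14 r24 s4 where 4:
      "W x 4 = smat 0 d1 d2 d3 d4 0 0 0 1 p4 q14 q24 r14 r24 s4"
      using W[of x 4] by (auto simp: axis_def)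
    note t = codiff2_torsion_zero[of "\<kappa> x", OF \<kappa>so anti cod]
    note W' = 1 2 3 4
    \<comment> \<open>The torsion on six pairs of frame vectors, with four components each, gives 24
      linear equations for the 24 entries of the four middle blocks.\<close>
    have e: "p1 = 0 \<and> q11 = -1 \<and> q21 = 0 \<and> r11 = 2 \<and> r21 = -2 \<and> s1 = 0 \<and>
      p2 = 1 \<and> q12 = 0 \<and> q22 = 0 \<and> r12 = 0 \<and> r22 = 0 \<and> s2 = 0 \<and>
      p3 = -2 \<and> q13 = 0 \<and> q23 = 0 \<and> r13 = 0 \<and> r23 = 0 \<and> s3 = 0 \<and>
      p4 = 0 \<and> q14 = 0 \<and> q24 = 0 \<and> r14 = -1 \<and> r24 = 0 \<and> s4 = 0"
      using t[of 1 2] t[of 1 3] t[of 1 4] t[of 2 3] t[of 2 4] t[of 3 4]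
      by (simp add: \<kappa> sum_4 br W' lie_smat smat_simps smat_nth D1)
    then show "\<exists>z1 z2 z3 z4. W x 1 = smat 0 z1 z2 z3 z4 1 0 0 0 0 (-1) 0 2 (-2) 0"
      "\<exists>z1 z2 z3 z4. W x 2 = smat 0 z1 z2 z3 z4 0 1 0 0 1 0 0 0 0 0"
      "\<exists>z1 z2 z3 z4. W x 3 = smat 0 z1 z2 z3 z4 0 0 1 0 (-2) 0 0 0 0 0"
      "\<exists>z1 z2 z3 z4. W x 4 = smat 0 z1 z2 z3 z4 0 0 0 1 0 0 0 (-1) 0 0"
      using 1 2 3 4 by auto
  qed
  \<comment> \<open>With the middle blocks constant, only the first rows can vary, and their
    derivatives do not meet the degree 0 part of the curvature.\<close>
  define S2 where "S2 = {smat 0 z1 z2 z3 z4 0 0 0 0 0 0 0 0 0 0 | z1 z2 z3 z4. True}"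
  have "subspace S2"
    unfolding subspace_def S2_def by (force simp: smat_simps smat_0[symmetric])
  moreover have "W y k - Omega k \<in> S2" for y k
    using exhaust_4[of k] A[of y] by (elim disjE; force simp: smat_simps S2_def Omega_simps)
  ultimately have DS2: "D x k u \<in> S2" for x k u
    using has_derivative_in_subspace[OF D] by blast
  have "M$1$1 = 0 \<and> M$2$2 = 0 \<and> M$2$3 = 0 \<and> M$2$4 = 0 \<and> M$3$2 = 0 \<and> M$4$2 = 0 \<and> M$4$3 = 0"
    if "M \<in> S2" for M
    using that unfolding S2_def by (auto simp: smat_nth)
  note D2 = this[OF DS2]
  have "W x k = Omega k" for x k
  proof -
    obtain a1 a2 a3 a4 where 1: "W x 1 = smat 0 a1 a2 a3 a4 1 0 0 0 0 (-1) 0 2 (-2) 0"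
      using A(1)[of x] by blast
    obtain b1 b2 b3 b4 where 2: "W x 2 = smat 0 b1 b2 b3 b4 0 1 0 0 1 0 0 0 0 0"
      using A(2)[of x] by blast
    obtain c1 c2 c3 c4 where 3: "W x 3 = smat 0 c1 c2 c3 c4 0 0 1 0 (-2) 0 0 0 0 0"
      using A(3)[of x] by blast
    obtain d1 d2 d3 d4 where 4: "W x 4 = smat 0 d1 d2 d3 d4 0 0 0 1 0 0 0 (-1) 0 0"
      using A(4)[of x] by blast
    note c = codiff2_lie_zero(8-11)[of "\<kappa> x", OF \<kappa>so cod]
    \<comment> \<open>Four trace conditions for each of the four arguments: sixteen linear equations
      for the sixteen entries of the first rows.\<close>
    have "a1 = 6 \<and> a2 = 0 \<and> a3 = 0 \<and> a4 = 1/2 \<and> b1 = 0 \<and> b2 = 1/2 \<and> b3 = 0 \<and> b4 = 0 \<and>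
      c1 = 0 \<and> c2 = 0 \<and> c3 = -1/2 \<and> c4 = 0 \<and> d1 = 1/2 \<and> d2 = 0 \<and> d3 = 0 \<and> d4 = 0"
      using c[of 1] c[of 2] c[of 3] c[of 4]
      by (simp add: \<kappa> sum_4 br 1 2 3 4 lie_smat smat_simps smat_nth D2)
    then show ?thesis
      using exhaust_4[of k] 1 2 3 4 by (elim disjE) (simp_all add: Omega_simps smat_eq_iff)
  qed
  then have W': "\<omega> x (frame x k) = Omega k" for x k by (simp add: W_def)
  have "\<omega> x u = cform x u" for x u
  proof -
    have "\<omega> x u = \<omega> x (\<Sum>i\<in>UNIV. coords x u $ i *\<^sub>R frame x i)"
      using coords_expansion[of u x] by simp
    then show ?thesis
      by (simp add: linear_sum[OF lin] linear_scale[OF lin] W' cform_def)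
  qed
  then show ?thesis by blast
qed

lemma cartan_form_eq: "cartan_form = cform"
  unfolding cartan_form_def
  using cform_normal normal_cartan_connection_unique by (rule the_equality)

section \<open>Holonomy and parallel tractors\<close>

lemma lie_repD:
  assumes "lie_rep V \<rho>"
  shows "subspace V" "X \<in> so24 \<Longrightarrow> v \<in> V \<Longrightarrow> \<rho> X v \<in> V"
    "X \<in> so24 \<Longrightarrow> v \<in> V \<Longrightarrow> w \<in> V \<Longrightarrow> \<rho> X (v + c *\<^sub>R w) = \<rho> X v + c *\<^sub>R \<rho> X w"
    "X \<in> so24 \<Longrightarrow> Y \<in> so24 \<Longrightarrow> v \<in> V \<Longrightarrow> \<rho> (X + c *\<^sub>R Y) v = \<rho> X v + c *\<^sub>R \<rho> Y v"
    "X \<in> so24 \<Longrightarrow> Y \<in> so24 \<Longrightarrow> v \<in> V \<Longrightarrow> \<rho> (lie X Y) v = \<rho> X (\<rho> Y v) - \<rho> Y (\<rho> X v)"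
  using assms unfolding lie_rep_def by blast+

text \<open>The action is replaced by a globally defined bilinear map, so that the calculus of bounded
  bilinear maps applies.\<close>

lemma lie_rep_extension:
  assumes rep: "lie_rep V \<rho>"
  obtains R where "bounded_bilinear R" "\<And>X v. R X v \<in> V"
    "\<And>X v. X \<in> so24 \<Longrightarrow> v \<in> V \<Longrightarrow> R X v = \<rho> X v"
proof -
  note rep = lie_repD[OF rep]
  obtain P where P: "linear P" "\<And>X. P X \<in> so24" "\<And>X. X \<in> so24 \<Longrightarrow> P X = X"
    using subspace_projection[OF subspace_so24] by metis
  obtain Q where Q: "linear Q" "\<And>v. Q v \<in> V" "\<And>v. v \<in> V \<Longrightarrow> Q v = v"
    using subspace_projection[OF rep(1)] by metis
  have z: "\<rho> X 0 = 0" if "X \<in> so24" for X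
    using rep(3)[OF that, of 0 0 1] subspace_0[OF rep(1)] by simp
  have z': "\<rho> 0 v = 0" if "v \<in> V" for v
    using rep(4)[of 0 0 v 1] subspace_0[OF subspace_so24] that by simp
  let ?R = "\<lambda>X v. \<rho> (P X) (Q v)"
  have "bilinear ?R"
    unfolding bilinear_def
  proof (intro conjI allI)
    show "linear (?R X)" for X
    proof (rule linearI)
      show "?R X (v + w) = ?R X v + ?R X w" for v w
        using rep(3)[OF P(2), of "Q v" "Q w" X 1] Q by (simp add: linear_add)
      show "?R X (c *\<^sub>R v) = c *\<^sub>R ?R X v" for c v
        using rep(3)[OF P(2), of 0 "Q v" X c] Q z[OF P(2)] subspace_0[OF rep(1)]
        by (simp add: linear_scale)
    qed
    show "linear (\<lambda>X. ?R X v)" for v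
    proof (rule linearI)
      show "?R (X + Y) v = ?R X v + ?R Y v" for X Y
        using rep(4)[OF P(2) P(2), of "Q v" X 1 Y] Q P by (simp add: linear_add)
      show "?R (c *\<^sub>R X) v = c *\<^sub>R ?R X v" for c X
        using rep(4)[OF _ P(2), of 0 "Q v" c X] Q P z' subspace_0[OF subspace_so24]
        by (simp add: linear_scale)
    qed
  qed
  then have "bounded_bilinear ?R" by (simp add: bilinear_conv_bounded_bilinear)
  moreover have "?R X v \<in> V" for X v using P Q rep(2) by blast
  moreover have "?R X v = \<rho> X v" if "X \<in> so24" "v \<in> V" for X v using that P Q by simp
  ultimately show thesis by (rule that)
qed

text \<open>Up to linear combinations, these are the images under \<open>exp (ad root_z2)\<close> of
  six basis vectors of \<open>n_minus\<close>, of \<open>root_z1\<close> and of the coroot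
  \<open>cartan 1 (-1) 0\<close>. The negative root vector of the middle simple root,
  \<open>root_x1\<close>, already belongs to \<open>n_minus\<close>, which explains the dimension
  eight.\<close>

definition hol :: "(real^6^6) set" where
  "hol = {root_z1, root_r1,
     root_r2, root_x4,
     smat 1 0 0 0 0 0 2 0 0 1 0 0 0 0 0, smat 0 0 1 0 0 0 2 0 0 2 0 0 0 0 0,
     smat 0 0 0 1 0 0 0 2 0 0 0 0 0 0 (-2), smat 0 0 0 0 1 2 0 0 0 0 (-2) 0 0 0 0}"

text \<open>The Lie algebra spanned by \<^const>\<open>hol\<close> is generated by the curvature under the
  constant operators \<open>ad (Omega i)\<close>, i.e. it is the holonomy algebra.\<close>

lemma hol_generated:
  assumes A: "subspace A" and "A \<subseteq> so24" and k: "curv_const 1 2 \<in> A" "curv_const 1 3 \<in> A"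
    and ad: "\<And>i X. X \<in> A \<Longrightarrow> lie (Omega i) X \<in> A"
  shows "hol \<subseteq> A"
proof -
  note sub = subspace_add[OF A] subspace_diff[OF A] subspace_scale[OF A]
  note c = curv_const_values(1,2) lie_smat smat_simps Omega_simps smat_eq_iff
  \<comment> \<open>Adding the bracket with \<open>Omega 2\<close> cancels the component along
    \<open>root_r2\<close> in both curvatures. In the combination with coefficients 3 and -1, the
    components along \<open>root_z1\<close> and \<open>root_x4\<close> cancel as well, and 80 times
    \<open>root_r1\<close> remains.\<close>
  have "(1/80) *\<^sub>R (3 *\<^sub>R (curv_const 1 2 + lie (Omega 2) (curv_const 1 2)) -
      (curv_const 1 3 + lie (Omega 2) (curv_const 1 3))) \<in> A"
    by (intro sub k ad)
  then have r1: "root_r1 \<in> A" by (simp add: c)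
  have "(- 1/10) *\<^sub>R ((1/6) *\<^sub>R (curv_const 1 2 + 2 *\<^sub>R root_r1) + (1/2) *\<^sub>R (curv_const 1 3 + 6 *\<^sub>R root_r1)) \<in> A"
    by (intro sub k ad r1)
  then have z1: "root_z1 \<in> A" by (simp add: c)
  have "(1/2) *\<^sub>R (curv_const 1 3 + 6 *\<^sub>R root_r1 + 26 *\<^sub>R root_z1) \<in> A" by (intro sub k ad r1 z1)
  then have r2: "root_r2 \<in> A" by (simp add: c)
  have "(1/2) *\<^sub>R (18 *\<^sub>R root_r1 - root_z1 - (curv_const 1 2 + lie (Omega 2) (curv_const 1 2))) \<in> A"
    by (intro sub k ad r1 z1)
  then have x4: "root_x4 \<in> A" by (simp add: c)
  have "2 *\<^sub>R lie (Omega 1) root_x4 \<in> A" by (intro sub ad x4)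
  then have h5: "smat 1 0 0 0 0 0 2 0 0 1 0 0 0 0 0 \<in> A" by (simp add: c)
  have "(- 2) *\<^sub>R lie (Omega 1) root_r1 \<in> A" by (intro sub ad r1)
  then have h6: "smat 0 0 1 0 0 0 2 0 0 2 0 0 0 0 0 \<in> A" by (simp add: c)
  have "(- 2) *\<^sub>R lie (Omega 1) root_r2 \<in> A" by (intro sub ad r2)
  then have h7: "smat 0 0 0 1 0 0 0 2 0 0 0 0 0 0 (-2) \<in> A" by (simp add: c)
  \<comment> \<open>Two brackets with \<open>Omega 1\<close> produce the last element up to the four
    root vectors found before.\<close>
  have "(- 1/20) *\<^sub>R (lie (Omega 1) (lie (Omega 1) (curv_const 1 2)) - 196 *\<^sub>R root_z1 - 8 *\<^sub>R root_x4
      - 40 *\<^sub>R root_r1 + 64 *\<^sub>R root_r2) \<in> A"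
    by (intro sub ad k z1 x4 r1 r2)
  then have h8: "smat 0 0 0 0 1 2 0 0 0 0 (-2) 0 0 0 0 \<in> A" by (simp add: c)
  show ?thesis unfolding hol_def using z1 r1 r2 x4 h5 h6 h7 h8 by simp
qed

text \<open>The elements that annihilate \<open>s\<close> form a subspace. Equality of mixed second
  derivatives puts the curvature into it, and differentiating the equation \<open>R Y s = 0\<close>
  along the frame shows that it is stable under brackets with every \<open>Omega i\<close>.\<close>

lemma parallel_imp_hol_kernel:
  assumes rep: "lie_rep V \<rho>" and U: "open U" and s: "parallel_on V \<rho> U s"
    and x: "x \<in> U" and X: "X \<in> hol"
  shows "\<rho> X (s x) = 0"
proof -
  obtain R where bb: "bounded_bilinear R" and RV: "\<And>X v. R X v \<in> V"
    and R: "\<And>X v. X \<in> so24 \<Longrightarrow> v \<in> V \<Longrightarrow> R X v = \<rho> X v"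
    using lie_rep_extension[OF rep] by metis
  interpret R: bounded_bilinear R by (rule bb)
  have sV: "s y \<in> V" if "y \<in> U" for y using s that by (simp add: parallel_on_def tractor_on_def)
  have Rlie: "R (lie X Y) v = R X (R Y v) - R Y (R X v)" if "X \<in> so24" "Y \<in> so24" "v \<in> V" for X Y v
    using that RV lie_repD(2,5)[OF rep] by (simp add: R lie_in_so24)
  have Ds: "(s has_derivative (\<lambda>u. - R (cform y u) (s y))) (at y)" if y: "y \<in> U" for y
  proof -
    have "s differentiable (at y)"
      using s y smooth_on_differentiable by (auto simp: parallel_on_def tractor_on_def)
    then have d: "(s has_derivative frechet_derivative s (at y)) (at y)"
      using frechet_derivative_works by blast
    have l: "linear (frechet_derivative s (at y))" using d by (rule has_derivative_linear)
    have fr: "frechet_derivative s (at y) (frame y i) = - R (Omega i) (s y)" for i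
    proof -
      have "frechet_derivative s (at y) (frame y i) + \<rho> (Omega i) (s y) = 0"
        using s y by (simp add: parallel_on_def tractor_nabla_def cartan_form_eq cform_frame)
      then show ?thesis by (simp add: R sV y eq_neg_iff_add_eq_0)
    qed
    have "frechet_derivative s (at y) u = - R (cform y u) (s y)" for u
    proof -
      have "frechet_derivative s (at y) u = frechet_derivative s (at y) (\<Sum>i\<in>UNIV. coords y u $ i *\<^sub>R frame y i)"
        using coords_expansion[of u y] by simp
      also have "\<dots> = (\<Sum>i\<in>UNIV. coords y u $ i *\<^sub>R (- R (Omega i) (s y)))"
        by (simp add: linear_sum[OF l] linear_scale[OF l] fr)
      also have "\<dots> = - R (cform y u) (s y)"
        by (simp add: cform_def R.sum_left R.scaleR_left sum_negf)
      finally show ?thesis .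
    qed
    then show ?thesis using d by presburger
  qed
  \<comment> \<open>Annihilation is required at all points of \<open>U\<close>, since the condition
    is going to be differentiated.\<close>
  define A where "A = {X \<in> so24. \<forall>y\<in>U. R X (s y) = 0}"
  have "subspace A"
    unfolding A_def subspace_def
    using subspace_add[OF subspace_so24] subspace_scale[OF subspace_so24] subspace_0[OF subspace_so24]
    by (auto simp: R.add_left R.scaleR_left R.zero_left)
  moreover have "A \<subseteq> so24" by (auto simp: A_def)
  moreover have "curv_const i k \<in> A" for i k
  proof -
    have "R (curv_const i k) (s y) = 0" if y: "y \<in> U" for y
    proof -
      define dc where "dc u = frechet_derivative (\<lambda>z. cform z u) (at y)" for u
      have dc: "((\<lambda>z. cform z u) has_derivative dc u) (at y)" for u
        unfolding dc_def using smooth_on_differentiable[OF cform_smooth UNIV_I] frechet_derivative_works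
        by blast
      \<comment> \<open>The first derivative is expressed through \<open>s\<close> itself, so the
        product rule provides the second derivative needed for Schwarz' theorem.\<close>
      have "((\<lambda>z. - R (cform z u) (s z)) has_derivative
          (\<lambda>w. - (R (cform y u) (- R (cform y w) (s y)) + R (dc u w) (s y)))) (at y)" for u
        by (intro has_derivative_minus R.FDERIV dc Ds y)
      note D2 = this
      have "R (cform y (frame y i)) (- R (cform y (frame y k)) (s y)) + R (dc (frame y i) (frame y k)) (s y)
        = R (cform y (frame y k)) (- R (cform y (frame y i)) (s y)) + R (dc (frame y k) (frame y i)) (s y)"
        by (rule neg_equal_iff_equal[THEN iffD1,
            OF second_derivative_symmetric[OF U y Ds D2 D2, of "frame y i" "frame y k"]])
      moreover have "R (lie (cform y (frame y i)) (cform y (frame y k))) (s y) =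
          R (cform y (frame y i)) (R (cform y (frame y k)) (s y))
          - R (cform y (frame y k)) (R (cform y (frame y i)) (s y))"
        by (intro Rlie sV y) (simp_all add: cform_frame)
      ultimately have "R (curv cform y (frame y i) (frame y k)) (s y) = 0"
        by (simp only: curv_def dc_def[symmetric] R.add_left R.diff_left R.minus_right)
          (simp add: algebra_simps)
      then show ?thesis by (simp add: curv_cform)
    qed
    moreover have "curv_const i k \<in> so24"
      unfolding curv_const_def
      by (intro subspace_diff[OF subspace_so24] subspace_sum[OF subspace_so24]
          subspace_scale[OF subspace_so24] lie_in_so24 Omega_in_so24)
    ultimately show ?thesis by (simp add: A_def)
  qed
  moreover have "lie (Omega i) Y \<in> A" if Y: "Y \<in> A" for i Y
  proof -
    have Yso: "Y \<in> so24" using Y by (simp add: A_def)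
    have "R (lie (Omega i) Y) (s y) = 0" if y: "y \<in> U" for y
    proof -
      have "((\<lambda>z. R Y (s z)) has_derivative (\<lambda>u. R Y (- R (cform y u) (s y)))) (at y)"
        by (rule bounded_linear.has_derivative[OF R.bounded_linear_right Ds[OF y]])
      moreover have "((\<lambda>z. R Y (s z)) has_derivative (\<lambda>u. 0)) (at y)"
        by (rule has_derivative_transform_within_open[OF has_derivative_const[of 0] U y])
          (use Y in \<open>auto simp: A_def\<close>)
      ultimately have "(\<lambda>u. R Y (- R (cform y u) (s y))) = (\<lambda>u. 0)" by (rule has_derivative_unique)
      from fun_cong[OF this, of "frame y i"] have "R Y (R (Omega i) (s y)) = 0"
        by (simp add: cform_frame R.minus_right)
      moreover have "R Y (s y) = 0" using Y y by (simp add: A_def)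
      ultimately show ?thesis using Rlie[OF Omega_in_so24 Yso sV[OF y]] by (simp add: R.zero_right)
    qed
    then show ?thesis using Yso by (simp add: A_def lie_in_so24)
  qed
  ultimately have "hol \<subseteq> A" using hol_generated by metis
  then have "R X (s x) = 0" "X \<in> so24" using X x by (auto simp: A_def)
  then show ?thesis using R sV[OF x] by simp
qed


definition hol_kernel :: "'v::euclidean_space set \<Rightarrow> (real^6^6 \<Rightarrow> 'v \<Rightarrow> 'v) \<Rightarrow> 'v set" where
  "hol_kernel V \<rho> = {v \<in> V. \<forall>X\<in>hol. \<rho> X v = 0}"

lemma lie_rep_kernel_subspace:
  assumes rep: "lie_rep V \<rho>" and v: "v \<in> V"
  shows "subspace {X \<in> so24. \<rho> X v = 0}"
proof -
  obtain R where bb: "bounded_bilinear R"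
    and R: "\<And>X v. X \<in> so24 \<Longrightarrow> v \<in> V \<Longrightarrow> R X v = \<rho> X v"
    using lie_rep_extension[OF rep] by metis
  interpret R: bounded_bilinear R by (rule bb)
  have "{X \<in> so24. \<rho> X v = 0} = {X \<in> so24. R X v = 0}" using R v by auto
  then show ?thesis
    unfolding subspace_def
    using subspace_add[OF subspace_so24] subspace_scale[OF subspace_so24] subspace_0[OF subspace_so24]
    by (auto simp: R.add_left R.scaleR_left R.zero_left)
qed

lemma subspace_hol_kernel:
  assumes rep: "lie_rep V \<rho>"
  shows "subspace (hol_kernel V \<rho>)"
proof -
  obtain R where bb: "bounded_bilinear R"
    and R: "\<And>X v. X \<in> so24 \<Longrightarrow> v \<in> V \<Longrightarrow> R X v = \<rho> X v"
    using lie_rep_extension[OF rep] by metis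
  interpret R: bounded_bilinear R by (rule bb)
  have "hol \<subseteq> so24" by (auto simp: hol_def)
  then have "R X v = \<rho> X v" if "X \<in> hol" "v \<in> V" for X v using R that by blast
  then have "hol_kernel V \<rho> = {v \<in> V. \<forall>X\<in>hol. R X v = 0}" by (auto simp: hol_kernel_def)
  then show ?thesis
    using lie_repD(1)[OF rep] unfolding subspace_def
    by (auto simp: R.add_right R.scaleR_right R.zero_right)
qed

text \<open>These three coefficients lie in the span of \<open>hol\<close>. \<open>Omega 3\<close>
  does not, which is why parallel sections can still vary with the third coordinate.\<close>

lemma hol_kernel_Omega:
  assumes rep: "lie_rep V \<rho>" and v: "v \<in> hol_kernel V \<rho>"
  shows "\<rho> (Omega 1) v = 0" "\<rho> (Omega 2) v = 0" "\<rho> (Omega 4) v = 0"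
proof -
  let ?K = "{X \<in> so24. \<rho> X v = 0}"
  have K: "subspace ?K" using lie_rep_kernel_subspace[OF rep] v by (simp add: hol_kernel_def)
  note sub = subspace_add[OF K] subspace_diff[OF K] subspace_scale[OF K]
  have k: "root_z1 \<in> ?K" "root_r1 \<in> ?K"
    "root_r2 \<in> ?K" "root_x4 \<in> ?K"
    "smat 0 0 1 0 0 0 2 0 0 2 0 0 0 0 0 \<in> ?K" "smat 0 0 0 0 1 2 0 0 0 0 (-2) 0 0 0 0 \<in> ?K"
    using v by (auto simp: hol_kernel_def hol_def)
  have "(1/2) *\<^sub>R smat 0 0 0 0 1 2 0 0 0 0 (-2) 0 0 0 0 + 2 *\<^sub>R root_r1
      - 2 *\<^sub>R root_r2 + 6 *\<^sub>R root_z1 \<in> ?K"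
    by (intro sub k)
  then show "\<rho> (Omega 1) v = 0" by (simp add: smat_simps Omega_simps)
  have "(1/2) *\<^sub>R smat 0 0 1 0 0 0 2 0 0 2 0 0 0 0 0 \<in> ?K"
    by (intro sub k)
  then show "\<rho> (Omega 2) v = 0" by (simp add: smat_simps Omega_simps)
  have "root_x4 - root_r1
      + (1/2) *\<^sub>R root_z1 \<in> ?K"
    by (intro sub k)
  then show "\<rho> (Omega 4) v = 0" by (simp add: smat_simps Omega_simps)
qed

lemma Ck_on_cong:
  assumes "open U" "\<And>x. x \<in> U \<Longrightarrow> f x = g x"
  shows "Ck_on k U f \<longleftrightarrow> Ck_on k U g"
  using assms(2)
proof (induction k arbitrary: f g)
  case 0
  then show ?case by (auto intro!: continuous_on_cong)
next
  case (Suc k)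
  have d: "(f has_derivative f') (at x) \<longleftrightarrow> (g has_derivative f') (at x)" if "x \<in> U" for x f'
    using has_derivative_transform_within_open[OF _ assms(1) that] Suc.prems by metis
  have "frechet_derivative f (at x) = frechet_derivative g (at x)" if "x \<in> U" for x
    unfolding frechet_derivative_def using d[OF that] by simp
  then have "Ck_on k U (\<lambda>x. frechet_derivative f (at x) b) \<longleftrightarrow> Ck_on k U (\<lambda>x. frechet_derivative g (at x) b)" for b
    by (intro Suc.IH) auto
  then show ?case using d by (simp add: differentiable_def)
qed

text \<open>For \<open>w = J v\<close> with a complex structure \<open>J\<close>, this is the
  exponential of \<open>- x$3 * (a + b J)\<close> applied to \<open>v\<close>. Keeping
  \<open>w\<close> independent of \<open>v\<close> makes the family closed under differentiation
  without reference to \<open>J\<close>.\<close>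

definition exp_sec :: "real \<Rightarrow> real \<Rightarrow> 'v::real_vector \<Rightarrow> 'v \<Rightarrow> real^4 \<Rightarrow> 'v" where
  "exp_sec a b v w x = exp (- a * x$3) *\<^sub>R (cos (b * x$3) *\<^sub>R v - sin (b * x$3) *\<^sub>R w)"

lemma exp_sec_has_derivative:
  "((exp_sec a b v w :: real^4 \<Rightarrow> 'v::real_normed_vector) has_derivative
     (\<lambda>u. exp_sec a b (- (u$3) *\<^sub>R (a *\<^sub>R v + b *\<^sub>R w)) (- (u$3) *\<^sub>R (a *\<^sub>R w - b *\<^sub>R v)) x)) (at x)"
proof -
  have 1: "((\<lambda>x::real^4. exp (- a * x$3) * cos (b * x$3)) has_derivative
      (\<lambda>u. u$3 * (- a * (exp (- a * x$3) * cos (b * x$3)) - b * (exp (- a * x$3) * sin (b * x$3))))) (at x)"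
    by (auto intro!: derivative_eq_intros simp: algebra_simps fun_eq_iff)
  have 2: "((\<lambda>x::real^4. exp (- a * x$3) * sin (b * x$3)) has_derivative
      (\<lambda>u. u$3 * (- a * (exp (- a * x$3) * sin (b * x$3)) + b * (exp (- a * x$3) * cos (b * x$3))))) (at x)"
    by (auto intro!: derivative_eq_intros simp: algebra_simps fun_eq_iff)
  have "((\<lambda>x. (exp (- a * x$3) * cos (b * x$3)) *\<^sub>R v - (exp (- a * x$3) * sin (b * x$3)) *\<^sub>R w)
    has_derivative (\<lambda>u. (u$3 * (- a * (exp (- a * x$3) * cos (b * x$3)) - b * (exp (- a * x$3) * sin (b * x$3)))) *\<^sub>R v
     - (u$3 * (- a * (exp (- a * x$3) * sin (b * x$3)) + b * (exp (- a * x$3) * cos (b * x$3)))) *\<^sub>R w)) (at x)"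
    by (intro has_derivative_diff has_derivative_scaleR_left 1 2)
  then show ?thesis
    unfolding exp_sec_def[abs_def] by (simp add: algebra_simps)
qed

lemma exp_sec_smooth: "smooth_on U (exp_sec a b v w :: real^4 \<Rightarrow> 'v::real_normed_vector)"
proof (rule smooth_on_class[where S = "{exp_sec a b v w | v w. True}"])
  fix f :: "real^4 \<Rightarrow> 'v" and x u :: "real^4"
  assume "f \<in> {exp_sec a b v w | v w. True}"
  then obtain v w where f: "f = exp_sec a b v w" by blast
  show "f differentiable (at x)"
    unfolding f using exp_sec_has_derivative differentiable_def by blast
  have "(\<lambda>x. frechet_derivative f (at x) u) =
      exp_sec a b (- (u$3) *\<^sub>R (a *\<^sub>R v + b *\<^sub>R w)) (- (u$3) *\<^sub>R (a *\<^sub>R w - b *\<^sub>R v))"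
    unfolding f frechet_derivative_at[OF exp_sec_has_derivative, symmetric] by simp
  then show "(\<lambda>x. frechet_derivative f (at x) u) \<in> {exp_sec a b v w | v w. True}" by blast
qed blast

section \<open>The homogeneous space\<close>

definition blk :: "real \<Rightarrow> real \<Rightarrow> real \<Rightarrow> real \<Rightarrow> real \<Rightarrow> real \<Rightarrow> real \<Rightarrow> real \<Rightarrow> real^4^4" where
  "blk a b c d p q r s = vector [vector [a, b, 0, 0], vector [c, d, 0, 0],
     vector [0, 0, p, q], vector [0, 0, r, s]]"

lemma blk_mult:
  "blk a b c d p q r s ** blk a' b' c' d' p' q' r' s' =
   blk (a * a' + b * c') (a * b' + b * d') (c * a' + d * c') (c * b' + d * d')
     (p * p' + q * r') (p * q' + q * s') (r * p' + s * r') (r * q' + s * s')"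
  by (simp add: blk_def vec_eq_iff forall_4 matrix_matrix_mult_def sum_4)

lemma blk_add: "blk a b c d p q r s + blk a' b' c' d' p' q' r' s' =
    blk (a + a') (b + b') (c + c') (d + d') (p + p') (q + q') (r + r') (s + s')"
  by (simp add: blk_def vec_eq_iff forall_4)

lemma blk_scale: "k *\<^sub>R blk a b c d p q r s =
    blk (k * a) (k * b) (k * c) (k * d) (k * p) (k * q) (k * r) (k * s)"
  by (simp add: blk_def vec_eq_iff forall_4)

lemma blk_eq_iff: "blk a b c d p q r s = blk a' b' c' d' p' q' r' s' \<longleftrightarrow>
    a = a' \<and> b = b' \<and> c = c' \<and> d = d' \<and> p = p' \<and> q = q' \<and> r = r' \<and> s = s'"
  by (auto simp: blk_def vec_eq_iff forall_4)

lemma mat_1_blk: "mat 1 = blk 1 0 0 1 1 0 0 1"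
  by (simp add: blk_def vec_eq_iff forall_4 mat_def)

lemma k_mat_blk: "k_mat x t = blk (x$3) t 0 (- x$3) (- x$2 + x$3) (2 * x$4 + t - x$1) (x$1) (x$2 - x$3)"
  by (simp add: k_mat_def blk_def)

lemma K_group_blk: "K_group = {blk a b 0 (1/a) p q r s | a b p q r s. a > 0 \<and> p * s - q * r = 1}"
  by (simp add: K_group_def blk_def)

text \<open>The even and the odd part of the exponential series, as functions of the square \<open>d\<close> of the
  argument.\<close>

definition cosq :: "real \<Rightarrow> real" where
  "cosq d = (if 0 \<le> d then cosh (sqrt d) else cos (sqrt (- d)))"

definition sinq :: "real \<Rightarrow> real" where
  "sinq d = (if d = 0 then 1 else if 0 < d then sinh (sqrt d) / sqrt d else sin (sqrt (- d)) / sqrt (- d))"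

lemma cosq_square: "cosq (e\<^sup>2) = cosh e" "cosq (- e\<^sup>2) = cos e"
proof -
  show "cosq (e\<^sup>2) = cosh e" by (simp add: cosq_def)
  show "cosq (- e\<^sup>2) = cos e" by (cases "e = 0") (auto simp: cosq_def)
qed

lemma sinq_square: "sinq (e\<^sup>2) * e = sinh e" "sinq (- e\<^sup>2) * e = sin e"
  by (auto simp: sinq_def abs_if)

lemma cosq_sums: "(\<lambda>n. if even n then d ^ (n div 2) / fact n else 0) sums cosq d"
proof (cases "d \<ge> 0")
  case True
  define e where "e = sqrt d"
  have e: "d = e\<^sup>2" using True by (simp add: e_def)
  have "(if even n then e ^ n /\<^sub>R fact n else 0) = (if even n then d ^ (n div 2) / fact n else 0)" for n
    unfolding e by (auto simp: power_mult divide_inverse elim!: evenE)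
  then show ?thesis using cosh_converges[of e] cosq_square(1)[of e] e by simp
next
  case False
  define e where "e = sqrt (- d)"
  have e: "d = - e\<^sup>2" using False by (simp add: e_def)
  have "cos_coeff n *\<^sub>R e ^ n = (if even n then d ^ (n div 2) / fact n else 0)" for n
    unfolding e by (auto simp: cos_coeff_def power_mult power_minus[of "e\<^sup>2"] elim!: evenE)
  then show ?thesis using cos_converges[of e] cosq_square(2)[of e] e by simp
qed

lemma sinq_sums: "(\<lambda>n. if even n then 0 else d ^ (n div 2) / fact n) sums sinq d"
proof (cases d "0::real" rule: linorder_cases)
  case greater
  define e where "e = sqrt d"
  have e: "d = e\<^sup>2" "e \<noteq> 0" using greater by (auto simp: e_def)
  have "(1/e) * (if even n then 0 else e ^ n /\<^sub>R fact n) = (if even n then 0 else d ^ (n div 2) / fact n)" for n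
    unfolding e(1) using e(2) by (auto simp: power_mult divide_inverse elim!: oddE)
  moreover have "sinq d = (1/e) * sinh e"
    unfolding sinq_square(1)[of e, symmetric] using e by simp
  ultimately show ?thesis using sums_mult[OF sinh_converges[of e], of "1/e"] by (simp only:)
next
  case less
  define e where "e = sqrt (- d)"
  have e: "d = - e\<^sup>2" "e \<noteq> 0" using less by (auto simp: e_def)
  have "(1/e) * (sin_coeff n *\<^sub>R e ^ n) = (if even n then 0 else d ^ (n div 2) / fact n)" for n
    unfolding e(1) using e(2)
    by (auto simp: sin_coeff_def power_mult power_minus[of "e\<^sup>2"] elim!: oddE)
  moreover have "sinq d = (1/e) * sin e"
    unfolding sinq_square(2)[of e, symmetric] using e by simp
  ultimately show ?thesis using sums_mult[OF sin_converges[of e], of "1/e"] by (simp only:)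
next
  case equal
  have "(\<lambda>n. if even n then 0 else d ^ (n div 2) / fact n) sums
      (\<Sum>n\<in>{1}. if even n then 0 else d ^ (n div 2) / fact n)"
    by (rule sums_finite) (auto simp: equal elim!: oddE)
  then show ?thesis by (simp add: sinq_def equal)
qed

lemma cosq_sinq: "(cosq d)\<^sup>2 - d * (sinq d)\<^sup>2 = 1"
proof (cases "d \<ge> 0")
  case True
  define e where "e = sqrt d"
  have e: "d = e\<^sup>2" using True by (simp add: e_def)
  have "(cosq d)\<^sup>2 - (sinq d * e)\<^sup>2 = 1"
    using cosq_square(1)[of e] sinq_square(1)[of e] e cosh_square_eq[of e] by simp
  then show ?thesis
    by (simp add: e power_mult_distrib mult.commute)
next
  case False
  define e where "e = sqrt (- d)"
  have e: "d = - e\<^sup>2" using False by (simp add: e_def)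
  have "(cosq d)\<^sup>2 + (sinq d * e)\<^sup>2 = 1"
    using cosq_square(2)[of e] sinq_square(2)[of e] e sin_cos_squared_add2[of e] by simp
  then show ?thesis by (simp add: e power_mult_distrib mult.commute)
qed

lemma sinq_bounded:
  assumes "\<bar>d\<bar> \<le> 1"
  shows "\<bar>sinq d\<bar> \<le> exp 1"
proof -
  have s: "(\<lambda>n. 1 / fact n :: real) sums exp 1"
    using exp_converges[of "1::real"] by (simp add: field_simps)
  have "norm (suminf (\<lambda>n. if even n then 0 else d ^ (n div 2) / fact n)) \<le> suminf (\<lambda>n. 1 / fact n :: real)"
  proof (rule norm_suminf_le)
    show "norm (if even n then 0 else d ^ (n div 2) / fact n) \<le> 1 / fact n" for n
      using power_le_one[OF abs_ge_zero assms] by (auto simp: power_abs divide_right_mono)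
  qed (use s in \<open>auto simp: sums_iff\<close>)
  then show ?thesis using s sinq_sums[of d] by (simp add: sums_iff)
qed

text \<open>Near 0 the even part is expressed through the odd part, which is bounded by
  \<open>sinq_bounded\<close>. Limits at 0 then follow without discussing the cases of the two
  definitions.\<close>

lemma cosq_eq_sqrt:
  assumes "\<bar>d\<bar> \<le> 1"
  shows "cosq d = sqrt (1 + d * (sinq d)\<^sup>2)"
proof -
  have "cosq d \<ge> 0"
  proof (cases "d \<ge> 0")
    case False
    then have "sqrt (- d) \<le> 1" using assms by simp
    then have "sqrt (- d) \<le> pi / 2" using pi_gt3 by linarith
    then have "cos (sqrt (- d)) \<ge> 0" using False by (intro cos_ge_zero) (auto intro: order_trans[of _ 0])
    then show ?thesis using False by (simp add: cosq_def)
  qed (simp add: cosq_def)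
  moreover have "1 + d * (sinq d)\<^sup>2 = (cosq d)\<^sup>2" using cosq_sinq[of d] by simp
  ultimately show ?thesis by simp
qed

text \<open>Both diagonal blocks are traceless, hence square to the scalars \<open>x\<^sup>2\<close>
  and \<open>d\<close>, the negatives of their determinants. This splits the exponential series into
  an even and an odd part.\<close>

lemma mexp_blk:
  fixes x t p q r :: real
  defines "d \<equiv> p\<^sup>2 + q * r"
  shows "mexp (blk x t 0 (- x) p q r (- p)) =
    blk (cosq (x\<^sup>2) + sinq (x\<^sup>2) * x) (sinq (x\<^sup>2) * t) 0 (cosq (x\<^sup>2) - sinq (x\<^sup>2) * x)
      (cosq d + sinq d * p) (sinq d * q) (sinq d * r) (cosq d - sinq d * p)"
proof -
  let ?A = "blk x t 0 (- x) p q r (- p)"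
  let ?c = "\<lambda>d n. if even n then d ^ (n div 2) / fact n else 0 :: real"
  let ?s = "\<lambda>d n. if even n then 0 else d ^ (n div 2) / fact n :: real"
  have pow: "((**) ?A ^^ n) (mat 1) = (if even n
      then blk ((x\<^sup>2) ^ (n div 2)) 0 0 ((x\<^sup>2) ^ (n div 2)) (d ^ (n div 2)) 0 0 (d ^ (n div 2))
      else blk ((x\<^sup>2) ^ (n div 2) * x) ((x\<^sup>2) ^ (n div 2) * t) 0 (- ((x\<^sup>2) ^ (n div 2) * x))
        (d ^ (n div 2) * p) (d ^ (n div 2) * q) (d ^ (n div 2) * r) (- (d ^ (n div 2) * p)))" for n
  proof (induction n)
    case 0
    show ?case by (simp add: mat_1_blk)
  next
    case (Suc n)
    have "((**) ?A ^^ Suc n) (mat 1) = ?A ** ((**) ?A ^^ n) (mat 1)" by simp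
    then show ?case
      unfolding Suc.IH
      by (cases "even n") (auto simp: blk_mult blk_eq_iff d_def power2_eq_square algebra_simps elim!: oddE)
  qed
  have "(1 / fact n) *\<^sub>R ((**) ?A ^^ n) (mat 1) =
      ?c (x\<^sup>2) n *\<^sub>R blk 1 0 0 1 0 0 0 0 + ?s (x\<^sup>2) n *\<^sub>R blk x t 0 (- x) 0 0 0 0
      + ?c d n *\<^sub>R blk 0 0 0 0 1 0 0 1 + ?s d n *\<^sub>R blk 0 0 0 0 p q r (- p)" for n
    unfolding pow by (simp add: blk_scale blk_add)
  moreover have "(\<lambda>n. ?c (x\<^sup>2) n *\<^sub>R blk 1 0 0 1 0 0 0 0 + ?s (x\<^sup>2) n *\<^sub>R blk x t 0 (- x) 0 0 0 0
      + ?c d n *\<^sub>R blk 0 0 0 0 1 0 0 1 + ?s d n *\<^sub>R blk 0 0 0 0 p q r (- p)) sums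
      (cosq (x\<^sup>2) *\<^sub>R blk 1 0 0 1 0 0 0 0 + sinq (x\<^sup>2) *\<^sub>R blk x t 0 (- x) 0 0 0 0
      + cosq d *\<^sub>R blk 0 0 0 0 1 0 0 1 + sinq d *\<^sub>R blk 0 0 0 0 p q r (- p))"
    by (intro sums_add sums_scaleR_left cosq_sums sinq_sums)
  ultimately show ?thesis
    unfolding mexp_def by (simp add: sums_iff blk_scale blk_add)
qed

lemma H_elem_blk: "H_elem t = blk 1 t 0 1 1 t 0 1"
  using mexp_blk[of 0 t 0 t 0] by (simp add: H_elem_def k_mat_blk cosq_def sinq_def)

lemma c_tilde_blk:
  "c_tilde x = blk (exp (x$3)) 0 0 (exp (- x$3))
     (exp (x$3 - x$2) * cos (x$1)) (exp (x$3 - x$2) * cos (x$1) * (2 * x$4) - exp (x$2 - x$3) * sin (x$1))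
     (exp (x$3 - x$2) * sin (x$1)) (exp (x$3 - x$2) * sin (x$1) * (2 * x$4) + exp (x$2 - x$3) * cos (x$1))"
proof -
  have 1: "mexp (k_mat (vector [x$1, 0, 0, 0]) 0) = blk 1 0 0 1 (cos (x$1)) (- sin (x$1)) (sin (x$1)) (cos (x$1))"
    using mexp_blk[of 0 0 0 "- x$1" "x$1"] cosq_square(2)[of "x$1"] sinq_square(2)[of "x$1"]
    by (simp add: k_mat_blk power2_eq_square cosq_square(1)[of 0, simplified])
  have 2: "mexp (k_mat (vector [0, x$2, x$3, 0]) 0) =
      blk (exp (x$3)) 0 0 (exp (- x$3)) (exp (x$3 - x$2)) 0 0 (exp (x$2 - x$3))"
    using mexp_blk[of "x$3" 0 "x$3 - x$2" 0 0]
    by (simp add: k_mat_blk cosq_square sinq_square cosh_plus_sinh cosh_minus_sinh)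
  have 3: "mexp (k_mat (vector [0, 0, 0, x$4]) 0) = blk 1 0 0 1 1 (2 * x$4) 0 1"
    using mexp_blk[of 0 0 0 "2 * x$4" 0] by (simp add: k_mat_blk cosq_def sinq_def)
  show ?thesis unfolding c_tilde_def 1 2 3 by (simp add: blk_mult blk_eq_iff algebra_simps)
qed

lemma c_tilde_0: "c_tilde 0 = mat 1"
  by (simp add: c_tilde_blk mat_1_blk)

lemma c_tilde_in_K_group: "c_tilde x \<in> K_group"
proof -
  define n where "n = exp (x$3 - x$2)"
  have n: "exp (x$2 - x$3) = 1 / n" "n > 0" by (simp_all add: n_def exp_diff)
  have "n * c * (n * s * w + 1 / n * c) - (n * c * w - 1 / n * s) * (n * s) = c\<^sup>2 + s\<^sup>2" for c s w
    using n(2) by (simp add: field_simps power2_eq_square)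
  from this[of "cos (x$1)" "sin (x$1)" "2 * x$4"]
  show ?thesis
    unfolding c_tilde_blk K_group_blk n_def[symmetric] n(1)
    by (intro CollectI exI conjI) (auto simp: exp_minus inverse_eq_divide)
qed

lemma continuous_on_vector_4:
  assumes "\<And>i. continuous_on S (\<lambda>x. f x $ i)"
  shows "continuous_on S (f :: _ \<Rightarrow> 'b::real_normed_vector^4)"
  using continuous_on_vec_lambda[of S "\<lambda>i x. f x $ i"] assms by simp

lemma c_tilde_continuous: "continuous_on S c_tilde"
proof (intro continuous_on_vector_4)
  fix i j :: 4
  show "continuous_on S (\<lambda>x. c_tilde x $ i $ j)"
    using exhaust_4[of i] exhaust_4[of j]
    by (elim disjE; simp add: c_tilde_blk blk_def; (intro continuous_intros)?)
qed

lemma open_c_tilde_vimage: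
  assumes "openin (top_of_set K_group) W"
  shows "open (c_tilde -` W)"
proof -
  obtain T where T: "open T" "W = K_group \<inter> T" using assms by (auto simp: openin_open)
  have "c_tilde -` W = c_tilde -` T" using T c_tilde_in_K_group by auto
  then show ?thesis using T(1) c_tilde_continuous[of UNIV] by (simp add: open_vimage)
qed

text \<open>Iwasawa decomposition: the rotation angle is determined by the first column of the lower
  block.\<close>

lemma c_tilde_H_elem_decomposition:
  fixes b p q r u y3 :: real
  assumes p: "p > 0" and det: "p * u - q * r = 1"
  defines "s \<equiv> b / exp y3"
  defines "y \<equiv> vector [arctan (r / p), y3 - ln (sqrt (p\<^sup>2 + r\<^sup>2)), y3,
      (p * (q - s * p) + r * (u - s * r)) / (2 * (p\<^sup>2 + r\<^sup>2))] :: real^4"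
  shows "blk (exp y3) b 0 (exp (- y3)) p q r u = c_tilde y ** H_elem s"
proof -
  \<comment> \<open>\<open>H_elem s\<close> acts on both blocks, and \<open>s\<close> is determined
    by the upper one. After removing it, the first column of the lower block is \<open>n\<close>
    times a unit vector, and twice the fourth coordinate is the inner product of the two columns
    divided by the square of \<open>n\<close>.\<close>
  define n where "n = sqrt (p\<^sup>2 + r\<^sup>2)"
  have pr: "p\<^sup>2 + r\<^sup>2 > 0" using p by (simp add: add_pos_nonneg)
  then have n: "n > 0" "n\<^sup>2 = p\<^sup>2 + r\<^sup>2" by (simp_all add: n_def)
  have "sqrt (1 + (r / p)\<^sup>2) = n / p"
  proof -
    have "1 + (r / p)\<^sup>2 = (n / p)\<^sup>2" using p n by (simp add: power_divide field_simps)
    then show ?thesis using n p by simp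
  qed
  then have cs: "cos (arctan (r / p)) = p / n" "sin (arctan (r / p)) = r / n"
    using p by (simp_all add: cos_arctan sin_arctan)
  have e: "exp (y3 - (y3 - ln n)) = n" "exp (y3 - ln n - y3) = 1 / n"
    using n by (simp_all add: exp_minus inverse_eq_divide)
  have y4: "2 * ((p * (q - s * p) + r * (u - s * r)) / (2 * (p\<^sup>2 + r\<^sup>2))) =
      (p * (q - s * p) + r * (u - s * r)) / n\<^sup>2"
  proof -
    have "2 * (X / (2 * Y)) = X / Y" for X Y :: real by simp
    then show ?thesis by (simp only: n(2))
  qed
  have qs: "p * ((p * (q - s * p) + r * (u - s * r)) / n\<^sup>2) - r / n\<^sup>2 = q - s * p"
    "r * ((p * (q - s * p) + r * (u - s * r)) / n\<^sup>2) + p / n\<^sup>2 = u - s * r"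
  proof -
    have "p * (p * (q - s * p) + r * (u - s * r)) - r = (q - s * p) * n\<^sup>2"
      unfolding n(2) using det by algebra
    moreover have "p * (X / m) - r / m = (p * X - r) / m" for X m by (simp add: diff_divide_distrib)
    ultimately show "p * ((p * (q - s * p) + r * (u - s * r)) / n\<^sup>2) - r / n\<^sup>2 = q - s * p"
      using n(1) by simp
    have "r * (p * (q - s * p) + r * (u - s * r)) + p = (u - s * r) * n\<^sup>2"
      unfolding n(2) using det by algebra
    moreover have "r * (X / m) + p / m = (r * X + p) / m" for X m by (simp add: add_divide_distrib)
    ultimately show "r * ((p * (q - s * p) + r * (u - s * r)) / n\<^sup>2) + p / n\<^sup>2 = u - s * r"
      using n(1) by simp
  qed
  have "c_tilde y = blk (exp y3) 0 0 (exp (- y3)) p (q - s * p) r (u - s * r)"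
    unfolding c_tilde_blk y_def vector_4 n_def[symmetric] e cs y4
    using qs n(1) by (simp add: blk_eq_iff power2_eq_square)
  then show ?thesis
    by (simp add: H_elem_blk blk_mult blk_eq_iff s_def exp_minus field_simps)
qed


text \<open>All that the construction of parallel sections requires from the representation.
  \<open>J\<close> is a complex structure where \<open>b\<close> is nonzero; for
  \<open>b = 0\<close> it may be the identity, as for real representations, or zero, as for the
  direct treatment of the adjoint representation.\<close>

locale holonomy_character =
  fixes V :: "'v::euclidean_space set" and \<rho> :: "real^6^6 \<Rightarrow> 'v \<Rightarrow> 'v"
    and J :: "'v \<Rightarrow> 'v" and a b :: real
  assumes rep: "lie_rep V \<rho>" and J: "linear J"
    and J_kernel: "v \<in> hol_kernel V \<rho> \<Longrightarrow> J v \<in> hol_kernel V \<rho>"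
    and J_square: "b \<noteq> 0 \<Longrightarrow> v \<in> hol_kernel V \<rho> \<Longrightarrow> J (J v) = - v"
    and Omega_3: "v \<in> hol_kernel V \<rho> \<Longrightarrow> \<rho> (Omega 3) v = a *\<^sub>R v + b *\<^sub>R J v"
begin

abbreviation "N \<equiv> hol_kernel V \<rho>"

lemma N_subspace: "subspace N" by (rule subspace_hol_kernel[OF rep])

lemma N_V: "v \<in> N \<Longrightarrow> v \<in> V" by (simp add: hol_kernel_def)

lemma exp_sec_N: "v \<in> N \<Longrightarrow> exp_sec a b v (J v) x \<in> N"
  unfolding exp_sec_def
  by (intro subspace_diff[OF N_subspace] subspace_scale[OF N_subspace]) (simp_all add: J_kernel)

lemma bJJ: "v \<in> N \<Longrightarrow> b *\<^sub>R J (J v) = - b *\<^sub>R v"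
  by (cases "b = 0") (simp_all add: J_square)

lemma exp_sec_J_has_derivative:
  assumes v: "v \<in> N"
  shows "(exp_sec a b v (J v) has_derivative
    (\<lambda>u. - (u$3) *\<^sub>R (a *\<^sub>R exp_sec a b v (J v) x + b *\<^sub>R J (exp_sec a b v (J v) x)))) (at x)"
proof -
  let ?s = "exp_sec a b v (J v) x"
  have "b *\<^sub>R J ?s = exp (- a * x$3) *\<^sub>R (cos (b * x$3) *\<^sub>R (b *\<^sub>R J v) + sin (b * x$3) *\<^sub>R (b *\<^sub>R v))"
    using J_square[OF _ v]
    by (cases "b = 0") (simp_all add: exp_sec_def linear_scale[OF J] linear_diff[OF J] algebra_simps)
  then have "exp_sec a b (- (u$3) *\<^sub>R (a *\<^sub>R v + b *\<^sub>R J v)) (- (u$3) *\<^sub>R (a *\<^sub>R J v - b *\<^sub>R v)) x =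
      - (u$3) *\<^sub>R (a *\<^sub>R ?s + b *\<^sub>R J ?s)" for u :: "real^4"
    by (simp add: exp_sec_def algebra_simps)
  then show ?thesis using exp_sec_has_derivative[of a b v "J v" x] by simp
qed

lemma parallel_exp_sec:
  assumes v: "v \<in> N"
  shows "parallel_on V \<rho> U (exp_sec a b v (J v))"
proof -
  have "tractor_nabla \<rho> (exp_sec a b v (J v)) x i = 0" for x i
  proof -
    let ?s = "exp_sec a b v (J v) x"
    have "frechet_derivative (exp_sec a b v (J v)) (at x) u = - (u$3) *\<^sub>R (a *\<^sub>R ?s + b *\<^sub>R J ?s)" for u
      unfolding frechet_derivative_at[OF exp_sec_J_has_derivative[OF v], symmetric] ..
    moreover have "\<rho> (Omega i) ?s = (frame x i$3) *\<^sub>R (a *\<^sub>R ?s + b *\<^sub>R J ?s)"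
      using exhaust_4[of i] hol_kernel_Omega[OF rep exp_sec_N[OF v]] Omega_3[OF exp_sec_N[OF v]]
      by (elim disjE) (simp_all add: frame_def)
    ultimately show ?thesis
      by (simp add: tractor_nabla_def cartan_form_eq cform_frame)
  qed
  then show ?thesis
    using exp_sec_smooth exp_sec_N[OF v] N_V by (simp add: parallel_on_def tractor_on_def)
qed

lemma parallel_on_cong:
  assumes U: "open U" and eq: "\<And>x. x \<in> U \<Longrightarrow> s x = s' x"
  shows "parallel_on V \<rho> U s \<longleftrightarrow> parallel_on V \<rho> U s'"
proof -
  have "(s has_derivative f') (at x) \<longleftrightarrow> (s' has_derivative f') (at x)" if "x \<in> U" for x f'
    using has_derivative_transform_within_open[OF _ U that] eq by metis
  then have "frechet_derivative s (at x) = frechet_derivative s' (at x)" if "x \<in> U" for x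
    unfolding frechet_derivative_def using that by simp
  then show ?thesis
    using Ck_on_cong[OF U eq] eq
    by (auto simp: parallel_on_def tractor_on_def smooth_on_def tractor_nabla_def)
qed

lemma parallel_in_N:
  assumes "open U" "parallel_on V \<rho> U s" "x \<in> U"
  shows "s x \<in> N"
  using parallel_imp_hol_kernel[OF rep assms] assms
  by (simp add: hol_kernel_def parallel_on_def tractor_on_def)

text \<open>The section \<open>t\<close> is \<open>s\<close> multiplied by the inverse of the
  expected exponential. Its derivative vanishes, so it is constant on the connected set
  \<open>U\<close>, and undoing the multiplication recovers \<open>s\<close>.\<close>

lemma parallel_iff:
  assumes U: "open U" "connected U"
  shows "parallel_on V \<rho> U s \<longleftrightarrow> (\<exists>v\<in>N. \<forall>x\<in>U. s x = exp_sec a b v (J v) x)"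
proof
  assume "\<exists>v\<in>N. \<forall>x\<in>U. s x = exp_sec a b v (J v) x"
  then show "parallel_on V \<rho> U s" using parallel_on_cong[OF U(1)] parallel_exp_sec by metis
next
  assume s: "parallel_on V \<rho> U s"
  have sN: "s x \<in> N" if "x \<in> U" for x using parallel_in_N[OF U(1) s that] .
  define t where "t x = (exp (a * x$3) * cos (b * x$3)) *\<^sub>R s x + (exp (a * x$3) * sin (b * x$3)) *\<^sub>R J (s x)"
    for x
  have "(t has_derivative (\<lambda>u. 0)) (at x)" if x: "x \<in> U" for x
  proof -
    have "s differentiable (at x)"
      using s x smooth_on_differentiable by (auto simp: parallel_on_def tractor_on_def)
    then have d: "(s has_derivative frechet_derivative s (at x)) (at x)"
      using frechet_derivative_works by blast
    have l: "linear (frechet_derivative s (at x))" using d by (rule has_derivative_linear)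
    have fr: "frechet_derivative s (at x) (frame x i) = - \<rho> (Omega i) (s x)" for i
      using s x by (simp add: parallel_on_def tractor_nabla_def cartan_form_eq cform_frame
          eq_neg_iff_add_eq_0)
    have "frechet_derivative s (at x) u = - (u$3) *\<^sub>R (a *\<^sub>R s x + b *\<^sub>R J (s x))" for u
    proof -
      have "frechet_derivative s (at x) u = frechet_derivative s (at x) (\<Sum>i\<in>UNIV. coords x u $ i *\<^sub>R frame x i)"
        using coords_expansion[of u x] by simp
      also have "\<dots> = (\<Sum>i\<in>UNIV. coords x u $ i *\<^sub>R (- \<rho> (Omega i) (s x)))"
        by (simp add: linear_sum[OF l] linear_scale[OF l] fr)
      finally show ?thesis
        using hol_kernel_Omega[OF rep sN[OF x]] Omega_3[OF sN[OF x]] by (simp add: sum_4 coords_def)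
    qed
    then have ds: "(s has_derivative (\<lambda>u. - (u$3) *\<^sub>R (a *\<^sub>R s x + b *\<^sub>R J (s x)))) (at x)"
      using d by presburger
    have "bounded_linear J" using J by (simp add: linear_conv_bounded_linear)
    from bounded_linear.has_derivative[OF this ds]
    have dJ: "((\<lambda>x. J (s x)) has_derivative (\<lambda>u. - (u$3) *\<^sub>R (a *\<^sub>R J (s x) - b *\<^sub>R s x))) (at x)"
      using bJJ[OF sN[OF x]] by (simp add: linear_scale[OF J] linear_add[OF J] linear_neg[OF J])
    have 1: "((\<lambda>x::real^4. exp (a * x$3) * cos (b * x$3)) has_derivative
        (\<lambda>u. u$3 * (a * (exp (a * x$3) * cos (b * x$3)) - b * (exp (a * x$3) * sin (b * x$3))))) (at x)"
      by (auto intro!: derivative_eq_intros simp: algebra_simps fun_eq_iff)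
    have 2: "((\<lambda>x::real^4. exp (a * x$3) * sin (b * x$3)) has_derivative
        (\<lambda>u. u$3 * (a * (exp (a * x$3) * sin (b * x$3)) + b * (exp (a * x$3) * cos (b * x$3))))) (at x)"
      by (auto intro!: derivative_eq_intros simp: algebra_simps fun_eq_iff)
    have "(t has_derivative (\<lambda>u. ((exp (a * x$3) * cos (b * x$3)) *\<^sub>R (- (u$3) *\<^sub>R (a *\<^sub>R s x + b *\<^sub>R J (s x)))
        + (u$3 * (a * (exp (a * x$3) * cos (b * x$3)) - b * (exp (a * x$3) * sin (b * x$3)))) *\<^sub>R s x)
       + ((exp (a * x$3) * sin (b * x$3)) *\<^sub>R (- (u$3) *\<^sub>R (a *\<^sub>R J (s x) - b *\<^sub>R s x))
        + (u$3 * (a * (exp (a * x$3) * sin (b * x$3)) + b * (exp (a * x$3) * cos (b * x$3)))) *\<^sub>R J (s x)))) (at x)"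
      unfolding t_def by (intro has_derivative_add has_derivative_scaleR 1 2 ds dJ)
    then show ?thesis by (simp add: algebra_simps)
  qed
  note dt = this
  show "\<exists>v\<in>N. \<forall>x\<in>U. s x = exp_sec a b v (J v) x"
  proof (cases "U = {}")
    case True
    then show ?thesis using subspace_0[OF N_subspace] by auto
  next
    case False
    then obtain x0 where x0: "x0 \<in> U" by blast
    have "s x = exp_sec a b (t x0) (J (t x0)) x" if x: "x \<in> U" for x
    proof -
      have "t x = t x0"
        using has_derivative_zero_unique_connected[OF U dt x x0] .
      moreover have "exp_sec a b (t x) (J (t x)) x = s x"
      proof -
        let ?c = "cos (b * x$3)" and ?s = "sin (b * x$3)"
        have J_t: "J (t x) = exp (a * x$3) *\<^sub>R (?c *\<^sub>R J (s x) - ?s *\<^sub>R s x)"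
          using J_square[OF _ sN[OF x]]
          by (cases "b = 0") (simp_all add: t_def linear_add[OF J] linear_scale[OF J] algebra_simps)
        have e: "exp (- a * x$3) * exp (a * x$3) = 1" by (simp add: exp_add[symmetric])
        have "exp_sec a b (t x) (J (t x)) x =
            (exp (- a * x$3) * exp (a * x$3)) *\<^sub>R ((?c\<^sup>2 + ?s\<^sup>2) *\<^sub>R s x)"
        proof -
          have "P *\<^sub>R (c *\<^sub>R ((Q * c) *\<^sub>R u + (Q * d) *\<^sub>R w) - d *\<^sub>R (Q *\<^sub>R (c *\<^sub>R w - d *\<^sub>R u))) =
              (P * Q) *\<^sub>R ((c\<^sup>2 + d\<^sup>2) *\<^sub>R u)" for P Q c d and u w :: 'v
            by (simp add: algebra_simps power2_eq_square)
          then show ?thesis unfolding exp_sec_def J_t unfolding t_def .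
        qed
        then show ?thesis unfolding e by simp
      qed
      ultimately show ?thesis by simp
    qed
    moreover have "t x0 \<in> N"
      unfolding t_def using sN[OF x0]
      by (intro subspace_add[OF N_subspace] subspace_scale[OF N_subspace] J_kernel)
    ultimately show ?thesis by blast
  qed
qed

end

section \<open>Lowest weight vectors and the holonomy algebra\<close>

text \<open>A product of factors \<open>T - d\<close> with all \<open>d\<close> different from
  \<open>c\<close> kills an element of the span, but multiplies a \<open>c\<close>-eigenvector by a
  nonzero number. \<open>P ds\<close> is this product, and the commutation of its factors allows the
  list to grow along the span induction.\<close>

lemma eigenspaces_independent:
  fixes T :: "'v::real_vector \<Rightarrow> 'v"
  assumes T: "linear T" and u: "T u = c *\<^sub>R u" "u \<in> span {v. \<exists>d. d \<noteq> c \<and> T v = d *\<^sub>R v}"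
  shows "u = 0"
proof -
  define P where "P ds v = foldr (\<lambda>d v. T v - d *\<^sub>R v) ds v" for ds v
  have P_lin: "linear (P ds)" for ds
  proof (induction ds)
    case Nil
    show ?case by (rule linearI) (simp_all add: P_def)
  next
    case (Cons d ds)
    have "P (d # ds) = (\<lambda>v. T (P ds v) - d *\<^sub>R P ds v)" by (simp add: P_def fun_eq_iff)
    then show ?case
      using Cons by (auto intro!: linearI
          simp: linear_add[OF T] linear_scale[OF T] linear_add linear_scale algebra_simps)
  qed
  have P_T: "P ds (T v) = T (P ds v)" for ds v
    by (induction ds) (simp_all add: P_def linear_diff[OF T] linear_scale[OF T])
  have P_app: "P (ds @ es) v = P ds (P es v)" for ds es v by (simp add: P_def)
  have P_comm: "P (ds @ es) v = P (es @ ds) v" for ds es v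
  proof (induction ds arbitrary: v)
    case (Cons d ds)
    have "P ((d # ds) @ es) v = T (P (ds @ es) v) - d *\<^sub>R P (ds @ es) v" by (simp add: P_def)
    also have "\<dots> = P (es @ ds) (T v - d *\<^sub>R v)"
      unfolding Cons by (simp add: P_T linear_diff[OF P_lin] linear_scale[OF P_lin])
    also have "\<dots> = P es (P (d # ds) v)"
      unfolding P_app by (simp add: P_T linear_diff[OF P_lin] linear_scale[OF P_lin] P_def[of "_ # _"] P_def[symmetric])
    finally show ?case by (simp add: P_app)
  qed simp
  have P_eig: "P ds v = (\<Prod>d\<leftarrow>ds. e - d) *\<^sub>R v" if "T v = e *\<^sub>R v" for ds v e
    using that by (induction ds) (simp_all add: P_def linear_scale[OF T] algebra_simps)
  have "\<exists>ds. c \<notin> set ds \<and> P ds u = 0"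
    using u(2)
  proof (induction rule: span_induct_alt)
    case base
    show ?case by (intro exI[of _ "[]"]) (simp add: P_def)
  next
    case (step k x y)
    then obtain d ds where d: "d \<noteq> c" "T x = d *\<^sub>R x" and ds: "c \<notin> set ds" "P ds y = 0" by blast
    have "P ([d] @ ds) (k *\<^sub>R x + y) = k *\<^sub>R P (ds @ [d]) x + P [d] (P ds y)"
      by (simp only: linear_add[OF P_lin] linear_scale[OF P_lin] P_comm[of "[d]" ds x] P_app[of "[d]" ds y])
    also have "\<dots> = 0" using P_eig[OF d(2), of "ds @ [d]"] ds linear_0[OF P_lin] by simp
    finally show ?case using d ds by (intro exI[of _ "[d] @ ds"]) simp
  qed
  then obtain ds where ds: "c \<notin> set ds" "P ds u = 0" by blast
  have "(\<Prod>d\<leftarrow>ds. c - d) \<noteq> 0" using ds(1) by (auto simp: prod_list_zero_iff)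
  then show ?thesis using P_eig[OF u(1), of ds] ds(2) by simp
qed

text \<open>Eigenvectors chosen for distinct eigenvalues are independent. Finiteness is needed for
  the minimum in \<open>lowest_E\<close> to be meaningful.\<close>

lemma finite_eigenvalues:
  fixes T :: "'v::euclidean_space \<Rightarrow> 'v"
  assumes T: "linear T"
  shows "finite {c. \<exists>v. v \<noteq> 0 \<and> T v = c *\<^sub>R v}" (is "finite ?C")
proof -
  define f where "f c = (SOME v. v \<noteq> 0 \<and> T v = c *\<^sub>R v)" for c
  have f: "f c \<noteq> 0 \<and> T (f c) = c *\<^sub>R f c" if "c \<in> ?C" for c
    unfolding f_def by (rule someI_ex) (use that in blast)
  have inj: "inj_on f ?C"
  proof (rule inj_onI)
    fix c d assume c: "c \<in> ?C" and d: "d \<in> ?C" and eq: "f c = f d"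
    have "c *\<^sub>R f c = d *\<^sub>R f c" using f[OF c] f[OF d] eq by metis
    then show "c = d" using f[OF c] by (metis scaleR_right_imp_eq)
  qed
  have "independent (f ` ?C)"
    unfolding dependent_def
  proof (safe)
    fix c v assume c: "v \<noteq> 0" "T v = c *\<^sub>R v" and s: "f c \<in> span (f ` ?C - {f c})"
    then have cC: "c \<in> ?C" by blast
    have "f ` ?C - {f c} \<subseteq> {v. \<exists>d. d \<noteq> c \<and> T v = d *\<^sub>R v}"
    proof
      fix w assume "w \<in> f ` ?C - {f c}"
      then obtain d where d: "d \<in> ?C" "w = f d" "d \<noteq> c" by fast
      then have "T w = d *\<^sub>R w" using f[OF d(1)] by simp
      then show "w \<in> {v. \<exists>d. d \<noteq> c \<and> T v = d *\<^sub>R v}" using d(3) by fast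
    qed
    from span_mono[OF this] s have "f c \<in> span {v. \<exists>d. d \<noteq> c \<and> T v = d *\<^sub>R v}" by fast
    from eigenspaces_independent[OF T _ this] f[OF cC] show False by metis
  qed
  then have "finite (f ` ?C)" by (rule independent_imp_finite)
  then show ?thesis using finite_imageD inj by blast
qed

lemma lin_exp_minus_in_subspace:
  fixes T :: "'v::euclidean_space \<Rightarrow> 'v"
  assumes "linear T" "subspace W" "\<And>n. (T ^^ Suc n) v \<in> W"
  shows "lin_exp T v - v \<in> W"
proof (rule closed_sequentially[OF closed_subspace[OF assms(2)]])
  have "(\<lambda>n. (1 / fact (Suc n)) *\<^sub>R (T ^^ Suc n) v) sums (lin_exp T v - v)"
    using lin_exp_sums[OF assms(1), of v] sums_Suc_iff[of "\<lambda>n. (1 / fact n) *\<^sub>R (T ^^ n) v"] by simp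
  then show "(\<lambda>m. \<Sum>n<m. (1 / fact (Suc n)) *\<^sub>R (T ^^ Suc n) v) \<longlonglongrightarrow> lin_exp T v - v"
    by (simp add: sums_def)
  show "(\<Sum>n<m. (1 / fact (Suc n)) *\<^sub>R (T ^^ Suc n) v) \<in> W" for m
    using assms by (intro subspace_sum subspace_scale)
qed

lemma lie_right:
  "lie B (X + Y) = lie B X + lie B Y" "lie B (c *\<^sub>R X) = c *\<^sub>R lie B X"
  by (simp_all add: lie_def vec_eq_iff matrix_matrix_mult_def sum.distrib sum_distrib_left algebra_simps)

lemma has_vector_derivative_scaleR_const:
  "(f has_real_derivative f') (at t) \<Longrightarrow> ((\<lambda>t. f t *\<^sub>R v) has_vector_derivative f' *\<^sub>R v) (at t)"
  by (rule bounded_linear.has_vector_derivative[OF bounded_linear_scaleR_left])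
    (simp add: has_real_derivative_iff_has_vector_derivative)

definition raising :: "(real^6^6) set" where
  "raising = {root_z1, root_z2,
     root_z3, root_z4,
     root_q1, root_q2}"

lemma raising_so24: "raising \<subseteq> so24" by (auto simp: raising_def)

lemma n_minus_so24: "n_minus \<subseteq> so24" by (auto simp: n_minus_eq)

lemma n_plus_so24: "n_plus \<subseteq> so24" by (auto simp: n_plus_eq)

lemma cartan_so24 [simp]: "cartan a b r \<in> so24" by (simp add: cartan_smat)

text \<open>The element \<open>cartan 2 1 0\<close> takes the value 1 on all simple roots and
  measures heights, so that raising operators increase its eigenvalue strictly; that of
  \<open>gradE\<close> increases only weakly.\<close>

lemma lie_grading_raising:
  assumes "X \<in> raising"
  shows "\<exists>d\<ge>1. lie (cartan 2 1 0) X = d *\<^sub>R X" "\<exists>d\<ge>0. lie gradE X = d *\<^sub>R X"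
proof -
  have "lie (cartan 2 1 0) X = 1 *\<^sub>R X \<or> lie (cartan 2 1 0) X = 2 *\<^sub>R X \<or> lie (cartan 2 1 0) X = 3 *\<^sub>R X"
    using assms unfolding raising_def by (auto simp: cartan_smat lie_smat smat_scale)
  then show "\<exists>d\<ge>1. lie (cartan 2 1 0) X = d *\<^sub>R X"
    by (metis (no_types) one_le_numeral order_refl)
  have "lie gradE X = 0 *\<^sub>R X \<or> lie gradE X = 1 *\<^sub>R X"
    using assms unfolding raising_def by (auto simp: gradE_smat lie_smat smat_scale smat_0[symmetric])
  then show "\<exists>d\<ge>0. lie gradE X = d *\<^sub>R X"
    by (metis (no_types) zero_le_one order_refl)
qed

text \<open>A common form of the real and the complex case. Where \<open>J\<close> is the identity,
  stability under \<open>J\<close> is automatic, the weight is real on the real Cartan subalgebra,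
  and the span of \<open>l\<close> and \<open>J l\<close> is a real line; otherwise it is a complex
  line.\<close>

locale highest_weight_rep =
  fixes V :: "'v::euclidean_space set" and \<rho> :: "real^6^6 \<Rightarrow> 'v \<Rightarrow> 'v"
    and J :: "'v \<Rightarrow> 'v" and w1 w2 w3 :: nat
  assumes rep: "lie_rep V \<rho>" and J: "linear J" and J_V: "v \<in> V \<Longrightarrow> J v \<in> V"
    and J_comm: "X \<in> so24 \<Longrightarrow> v \<in> V \<Longrightarrow> \<rho> X (J v) = J (\<rho> X v)"
    and J_square: "v \<in> V \<Longrightarrow> (if w2 = w3 then J v = v else J (J v) = - v)"
    and irreducible: "invariant_subspace V \<rho> W \<Longrightarrow> J ` W \<subseteq> W \<Longrightarrow> W = {0} \<or> W = V"
    and highest: "\<exists>v\<in>V. v \<noteq> 0 \<and> (\<forall>X\<in>n_plus. \<rho> X v = 0) \<and> (\<forall>a b r. \<rho> (cartan a b r) v =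
      (real w1 * a + (real w2 + real w3) * (a + b) / 2) *\<^sub>R v + ((real w2 - real w3) * r / 2) *\<^sub>R J v)"
begin

lemma V_subspace: "subspace V" using lie_repD[OF rep] by blast

definition act :: "real^6^6 \<Rightarrow> 'v \<Rightarrow> 'v" where
  "act = (SOME R. bounded_bilinear R \<and> (\<forall>X v. R X v \<in> V) \<and> (\<forall>X\<in>so24. \<forall>v\<in>V. R X v = \<rho> X v))"

lemma act_props: "bounded_bilinear act \<and> (\<forall>X v. act X v \<in> V) \<and> (\<forall>X\<in>so24. \<forall>v\<in>V. act X v = \<rho> X v)"
proof -
  obtain R where "bounded_bilinear R" "\<And>X v. R X v \<in> V"
    "\<And>X v. X \<in> so24 \<Longrightarrow> v \<in> V \<Longrightarrow> R X v = \<rho> X v"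
    using lie_rep_extension[OF rep] by metis
  then have "\<exists>R. bounded_bilinear R \<and> (\<forall>X v. R X v \<in> V) \<and> (\<forall>X\<in>so24. \<forall>v\<in>V. R X v = \<rho> X v)"
    by blast
  then show ?thesis unfolding act_def by (rule someI_ex)
qed

lemma act_V [simp]: "act X v \<in> V" and act_eq: "X \<in> so24 \<Longrightarrow> v \<in> V \<Longrightarrow> act X v = \<rho> X v"
  using act_props by auto

sublocale act: bounded_bilinear act using act_props by blast

lemma act_linear: "linear (act X)"
  by (rule linearI) (simp_all add: act.add_right act.scaleR_right)

lemma act_lie:
  "X \<in> so24 \<Longrightarrow> Y \<in> so24 \<Longrightarrow> v \<in> V \<Longrightarrow> act (lie X Y) v = act X (act Y v) - act Y (act X v)"
  using lie_repD(2,5)[OF rep] by (simp add: act_eq lie_in_so24)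

lemma act_J: "X \<in> so24 \<Longrightarrow> v \<in> V \<Longrightarrow> act X (J v) = J (act X v)"
  by (simp add: act_eq J_V J_comm)

lemma exp_act_V: "v \<in> V \<Longrightarrow> lin_exp (\<lambda>v. t *\<^sub>R act B v) v \<in> V"
proof (rule lin_exp_in_subspace[OF linear_compose_scale_right[OF act_linear] V_subspace])
  show "((\<lambda>v. t *\<^sub>R act B v) ^^ n) v \<in> V" if "v \<in> V" for n
    using that by (cases n) (auto intro: subspace_scale[OF V_subspace])
qed

text \<open>Both sides solve the linear differential equation with coefficient \<open>act B\<close>.\<close>

lemma exp_act_conjugation:
  assumes B: "B \<in> so24" and v: "v \<in> V" and X: "\<And>t. X t \<in> so24"
    and dX: "\<And>t. (X has_vector_derivative lie B (X t)) (at t)"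
  shows "lin_exp (\<lambda>v. t *\<^sub>R act B v) (act (X 0) v) = act (X t) (lin_exp (\<lambda>v. t *\<^sub>R act B v) v)"
proof -
  let ?E = "\<lambda>t. lin_exp (\<lambda>v. t *\<^sub>R act B v) v"
  have "((\<lambda>t. act (X t) (?E t)) has_vector_derivative act B (act (X t) (?E t))) (at t)" for t
  proof -
    have "((\<lambda>t. act (X t) (?E t)) has_vector_derivative
        (act (X t) (act B (?E t)) + act (lie B (X t)) (?E t))) (at t)"
      by (rule act.has_vector_derivative[OF dX lin_exp_has_vector_derivative[OF act_linear]])
    then show ?thesis by (simp add: act_lie[OF B X exp_act_V[OF v]])
  qed
  from lin_exp_ode_unique[OF act_linear this, of t] show ?thesis by (simp add: lin_exp_zero)
qed

text \<open>The cubic relation gives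
  \<open>exp (t ad B) = 1 + sin t ad B + (1 - cos t) (ad B)^2\<close>, and at \<open>t = pi\<close>
  the linear term vanishes.\<close>

lemma exp_act_rotation:
  assumes B: "B \<in> so24" and v: "v \<in> V" and X: "X \<in> so24"
    and cube: "lie B (lie B (lie B X)) = - lie B X"
  shows "lin_exp (\<lambda>v. pi *\<^sub>R act B v) (act X v) =
    act (X + 2 *\<^sub>R lie B (lie B X)) (lin_exp (\<lambda>v. pi *\<^sub>R act B v) v)"
proof -
  define Y where "Y t = X + sin t *\<^sub>R lie B X + (1 - cos t) *\<^sub>R lie B (lie B X)" for t
  have "Y t \<in> so24" for t
    unfolding Y_def by (intro subspace_add[OF subspace_so24] subspace_scale[OF subspace_so24] lie_in_so24 B X)
  moreover have "(Y has_vector_derivative lie B (Y t)) (at t)" for t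
  proof -
    have "(Y has_vector_derivative (0 + cos t *\<^sub>R lie B X + sin t *\<^sub>R lie B (lie B X))) (at t)"
      unfolding Y_def[abs_def]
      by (intro has_vector_derivative_add has_vector_derivative_const has_vector_derivative_scaleR_const)
        (auto intro!: derivative_eq_intros)
    moreover have "lie B (Y t) = cos t *\<^sub>R lie B X + sin t *\<^sub>R lie B (lie B X)"
      unfolding Y_def lie_right cube by (simp add: algebra_simps)
    ultimately show ?thesis by simp
  qed
  ultimately show ?thesis using exp_act_conjugation[OF B v, of Y pi] by (simp add: Y_def)
qed

text \<open>The series for \<open>exp (ad B)\<close> stops after the quadratic term.\<close>

lemma exp_act_nilpotent:
  assumes B: "B \<in> so24" and v: "v \<in> V" and X: "X \<in> so24" and cube: "lie B (lie B (lie B X)) = 0"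
  shows "lin_exp (act B) (act X v) = act (X + lie B X + (1/2) *\<^sub>R lie B (lie B X)) (lin_exp (act B) v)"
proof -
  define Y where "Y t = X + t *\<^sub>R lie B X + (t\<^sup>2 / 2) *\<^sub>R lie B (lie B X)" for t
  have "Y t \<in> so24" for t
    unfolding Y_def by (intro subspace_add[OF subspace_so24] subspace_scale[OF subspace_so24] lie_in_so24 B X)
  moreover have "(Y has_vector_derivative lie B (Y t)) (at t)" for t
  proof -
    have "(Y has_vector_derivative (0 + 1 *\<^sub>R lie B X + t *\<^sub>R lie B (lie B X))) (at t)"
      unfolding Y_def[abs_def]
      by (intro has_vector_derivative_add has_vector_derivative_const has_vector_derivative_scaleR_const)
        (auto intro!: derivative_eq_intros)
    then show ?thesis by (simp add: Y_def lie_right cube)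
  qed
  ultimately show ?thesis using exp_act_conjugation[OF B v, of Y 1] by (simp add: Y_def)
qed

lemma exp_act_J:
  assumes B: "B \<in> so24" and v: "v \<in> V"
  shows "lin_exp (\<lambda>v. t *\<^sub>R act B v) (J v) = J (lin_exp (\<lambda>v. t *\<^sub>R act B v) v)"
proof -
  let ?E = "\<lambda>t. lin_exp (\<lambda>v. t *\<^sub>R act B v) v"
  have bJ: "bounded_linear J" using J by (simp add: linear_conv_bounded_linear)
  have "((\<lambda>t. J (?E t)) has_vector_derivative act B (J (?E t))) (at t)" for t
    unfolding act_J[OF B exp_act_V[OF v]]
    by (rule bounded_linear.has_vector_derivative[OF bJ lin_exp_has_vector_derivative[OF act_linear]])
  from lin_exp_ode_unique[OF act_linear this, of t] show ?thesis by (simp add: lin_exp_zero)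
qed

definition lowest :: "'v \<Rightarrow> bool" where
  "lowest l \<longleftrightarrow> l \<in> V \<and> (\<forall>X\<in>n_minus. act X l = 0)"

text \<open>The longest element of the Weyl group of type D3 changes the signs of \<open>a\<close>
  and \<open>b\<close> but fixes the compact coordinate \<open>r\<close>. Hence the last summand has
  the same sign as for the highest weight.\<close>

definition weight_vector :: "'v \<Rightarrow> bool" where
  "weight_vector l \<longleftrightarrow> (\<forall>a b r. act (cartan a b r) l =
     - (real w1 * a + (real w2 + real w3) * (a + b) / 2) *\<^sub>R l + ((real w2 - real w3) * r / 2) *\<^sub>R J l)"

text \<open>The exponential of this element of a maximal compact subalgebra represents the longest
  element of the Weyl group, exchanging highest and lowest weight vectors.\<close>

definition weyl :: "real^6^6" where
  "weyl = smat 0 (- 1/2) 0 0 (1/2) (1/2) 0 0 (- 1/2) 0 0 0 0 0 0"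

text \<open>The result is the Cartan involution, the negative of the transpose. The entries 1/2 of
  \<open>weyl\<close> normalize the eigenvalues of \<open>ad weyl\<close> to 0 and plus or minus the
  imaginary unit, which is the cubic relation.\<close>

lemma weyl_reflection:
  "X = smat a z1 z2 z3 z4 x1 x2 x3 x4 p q1 q2 r1 r2 s \<Longrightarrow>
    X + 2 *\<^sub>R lie weyl (lie weyl X) =
    smat (- a) (- x1) (- x2) (- x3) (- x4) (- z1) (- z2) (- z3) (- z4) (- p) (- r1) (- r2) (- q1) (- q2) s"
  "lie weyl (lie weyl (lie weyl (smat a z1 z2 z3 z4 x1 x2 x3 x4 p q1 q2 r1 r2 s))) =
    - lie weyl (smat a z1 z2 z3 z4 x1 x2 x3 x4 p q1 q2 r1 r2 s)"
  by (simp_all add: weyl_def lie_smat smat_simps smat_eq_iff field_simps)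

lemma lowest_weight_vector_exists: "\<exists>l. l \<noteq> 0 \<and> lowest l \<and> weight_vector l"
proof -
  obtain v where v: "v \<in> V" "v \<noteq> 0" "\<And>X. X \<in> n_plus \<Longrightarrow> \<rho> X v = 0"
    "\<And>a b r. \<rho> (cartan a b r) v =
      (real w1 * a + (real w2 + real w3) * (a + b) / 2) *\<^sub>R v + ((real w2 - real w3) * r / 2) *\<^sub>R J v"
    using highest by blast
  define T where "T = lin_exp (\<lambda>v. pi *\<^sub>R act weyl v)"
  have wso: "weyl \<in> so24" by (simp add: weyl_def)
  have Tlin: "linear T" unfolding T_def
    by (intro linear_lin_exp linear_compose_scale_right act_linear)
  have conj: "T (act (smat a z1 z2 z3 z4 x1 x2 x3 x4 p q1 q2 r1 r2 s) v) =
      act (smat (- a) (- x1) (- x2) (- x3) (- x4) (- z1) (- z2) (- z3) (- z4) (- p) (- r1) (- r2) (- q1) (- q2) s) (T v)"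
    for a z1 z2 z3 z4 x1 x2 x3 x4 p q1 q2 r1 r2 s
    using exp_act_rotation[OF wso v(1) smat_in_so24 weyl_reflection(2)]
    unfolding T_def weyl_reflection(1)[OF refl] .
  have "T v \<noteq> 0"
  proof
    assume "T v = 0"
    have "lin_exp (\<lambda>v. - (pi *\<^sub>R act weyl v)) (lin_exp (\<lambda>v. - (- (pi *\<^sub>R act weyl v))) v) = v"
      by (rule lin_exp_inverse) (intro linear_compose_neg linear_compose_scale_right act_linear)
    then have "v = lin_exp (\<lambda>v. - (pi *\<^sub>R act weyl v)) 0"
      using \<open>T v = 0\<close> by (simp add: T_def)
    then have "v = 0"
      using linear_0[OF linear_lin_exp[OF linear_compose_neg[OF linear_compose_scale_right[OF act_linear]]]]
      by metis
    then show False using v(2) by simp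
  qed
  moreover have "lowest (T v)"
  proof -
    have "act X (T v) = 0" if X: "X \<in> n_minus" for X
    proof -
      obtain x1 x2 x3 x4 r1 r2 where X: "X = smat 0 0 0 0 0 x1 x2 x3 x4 0 0 0 r1 r2 0"
        using X by (auto simp: n_minus_eq)
      define Y where "Y = smat 0 (- x1) (- x2) (- x3) (- x4) 0 0 0 0 0 (- r1) (- r2) 0 0 0"
      have "Y \<in> n_plus" unfolding Y_def n_plus_eq by blast
      then have "act Y v = 0" using v n_plus_so24 by (simp add: act_eq subset_iff)
      then show ?thesis
        using conj[of 0 "- x1" "- x2" "- x3" "- x4" 0 0 0 0 0 "- r1" "- r2" 0 0 0] linear_0[OF Tlin]
        by (simp add: X Y_def)
    qed
    then show ?thesis using exp_act_V[OF v(1)] by (simp add: lowest_def T_def)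
  qed
  moreover have "weight_vector (T v)"
  proof -
    have "act (cartan a b r) (T v) = T (act (cartan (- a) (- b) r) v)" for a b r
      using conj[of "- a" 0 0 0 0 0 0 0 0 "- b" 0 0 0 0 r] by (simp add: cartan_smat)
    moreover have "T (J v) = J (T v)" unfolding T_def by (rule exp_act_J[OF wso v(1)])
    ultimately show ?thesis
      using v(1,4) by (simp add: weight_vector_def act_eq linear_add[OF Tlin] linear_scale[OF Tlin])
        (simp add: field_simps)
  qed
  ultimately show ?thesis by blast
qed

section \<open>Generation of the representation from vectors annihilated by
  \<open>n_minus\<close>\<close>

inductive_set words :: "'v set \<Rightarrow> 'v set" for L where
  base: "l \<in> L \<Longrightarrow> l \<in> words L"
| step: "w \<in> words L \<Longrightarrow> X \<in> raising \<Longrightarrow> act X w \<in> words L"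

lemma words_V: "L \<subseteq> V \<Longrightarrow> w \<in> words L \<Longrightarrow> w \<in> V"
  by (erule words.cases) auto

lemma linear_image_span_subset:
  assumes "linear f" "f ` S \<subseteq> span T"
  shows "f ` span S \<subseteq> span T"
  using assms linear_span_image[of f S] span_minimal[OF assms(2) subspace_span] by simp

text \<open>The span is a nonzero subrepresentation stable under \<open>J\<close>, hence everything.
  An arbitrary element is moved past the raising operators by commutators until it reaches
  \<open>L\<close>, where \<open>n_minus\<close> acts by 0 and the Cartan subalgebra preserves
  \<open>L\<close>; the induction therefore quantifies over all of \<open>so24\<close>.\<close>

lemma words_generate:
  assumes L: "subspace L" "L \<subseteq> V" "J ` L \<subseteq> L" "l \<in> L" "l \<noteq> 0"
    and low: "\<And>l. l \<in> L \<Longrightarrow> lowest l" and cart: "\<And>a b r l. l \<in> L \<Longrightarrow> act (cartan a b r) l \<in> L"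
  shows "span (words L) = V"
proof -
  note sub = subspace_add[OF subspace_span] subspace_scale[OF subspace_span]
  have wV: "w \<in> V" if "w \<in> words L" for w using words_V[OF L(2) that] .
  have up: "act X w \<in> span (words L)" if X: "X \<in> raising" and w: "w \<in> span (words L)" for X w
  proof -
    have "act X ` words L \<subseteq> span (words L)" using X words.step span_base by blast
    from linear_image_span_subset[OF act_linear this] w show ?thesis by blast
  qed
  have so: "act X w \<in> span (words L)" if "w \<in> words L" "X \<in> so24" for X w
    using that
  proof (induction w arbitrary: X)
    case (base l)
    obtain a z1 z2 z3 z4 x1 x2 x3 x4 p q1 q2 r1 r2 s
      where X: "X = smat a z1 z2 z3 z4 x1 x2 x3 x4 p q1 q2 r1 r2 s"
      using base(2) by (rule so24E)
    let ?Y = "smat 0 0 0 0 0 x1 x2 x3 x4 0 0 0 r1 r2 0"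
    have split: "X = ?Y + (cartan a p s + (z1 *\<^sub>R root_z1
      + (z2 *\<^sub>R root_z2 + (z3 *\<^sub>R root_z3
      + (z4 *\<^sub>R root_z4 + (q1 *\<^sub>R root_q1
      + q2 *\<^sub>R root_q2))))))"
      by (simp add: X cartan_smat smat_simps)
    have "?Y \<in> n_minus" unfolding n_minus_eq by blast
    then have Y: "act ?Y l = 0" using low[OF base(1)] by (simp add: lowest_def)
    have l: "l \<in> span (words L)" using base(1) words.base span_base by blast
    have c: "act (cartan a p s) l \<in> span (words L)"
      using cart[OF base(1)] words.base span_base by blast
    show ?case
      unfolding split act.add_left act.scaleR_left Y add_0_left
      by (intro sub c up l) (simp_all add: raising_def)
  next
    case (step w Y)
    have "Y \<in> so24" using step(2) raising_so24 by blast
    then have "act X (act Y w) = act Y (act X w) + act (lie X Y) w"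
      using act_lie[OF step(4) _ wV[OF step(1)]] by simp
    then show ?case
      using up[OF step(2) step.IH[OF step(4)]] step.IH[OF lie_in_so24[OF step(4) \<open>Y \<in> so24\<close>]] sub
      by simp
  qed
  have WV: "span (words L) \<subseteq> V" using span_minimal[OF _ V_subspace] wV by blast
  have "invariant_subspace V \<rho> (span (words L))"
    unfolding invariant_subspace_def
  proof (intro conjI ballI image_subsetI)
    fix X w assume X: "X \<in> so24" and w: "w \<in> span (words L)"
    have "act X ` words L \<subseteq> span (words L)" using so X by blast
    from linear_image_span_subset[OF act_linear this] w have "act X w \<in> span (words L)" by blast
    then show "\<rho> X w \<in> span (words L)" using X w WV act_eq by auto
  qed (use WV in auto)
  moreover have "J ` span (words L) \<subseteq> span (words L)"
  proof (rule linear_image_span_subset[OF J])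
    have "J w \<in> words L" if "w \<in> words L" for w
      using that
    proof induction
      case (base l)
      then show ?case using L(3) words.base by blast
    next
      case (step w X)
      have "J (act X w) = act X (J w)" using act_J wV step(1,2) raising_so24 by (metis subsetD)
      then show ?case using words.step step by simp
    qed
    then show "J ` words L \<subseteq> span (words L)" using span_base by blast
  qed
  moreover have "span (words L) \<noteq> {0}" using L(4,5) words.base span_base by blast
  ultimately show ?thesis using irreducible by blast
qed

definition eig :: "real^6^6 \<Rightarrow> real \<Rightarrow> 'v set" where
  "eig D c = {v \<in> V. act D v = c *\<^sub>R v}"

lemma subspace_eig: "subspace (eig D c)"
  using V_subspace unfolding eig_def subspace_def
  by (auto simp: act.add_right act.scaleR_right act.zero_right scaleR_add_right)

lemma eig_independent:
  assumes "u \<in> eig D c" "u \<in> span (\<Union>d\<in>{d. d \<noteq> c}. eig D d)"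
  shows "u = 0"
proof (rule eigenspaces_independent[OF act_linear])
  show "act D u = c *\<^sub>R u" using assms(1) by (simp add: eig_def)
  have "(\<Union>d\<in>{d. d \<noteq> c}. eig D d) \<subseteq> {v. \<exists>d. d \<noteq> c \<and> act D v = d *\<^sub>R v}" by (auto simp: eig_def)
  then show "u \<in> span {v. \<exists>d. d \<noteq> c \<and> act D v = d *\<^sub>R v}" using assms(2) span_mono by blast
qed

lemma eig_raise:
  assumes "D \<in> so24" "X \<in> so24" "lie D X = d *\<^sub>R X" "v \<in> eig D c"
  shows "act X v \<in> eig D (c + d)"
  using act_lie[OF assms(1,2), of v] assms(3,4)
  by (simp add: eig_def act.scaleR_left act.scaleR_right algebra_simps)

definition above :: "real \<Rightarrow> 'v set" where
  "above c = span (\<Union>d\<in>{c<..}. eig (cartan 2 1 0) d)"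

lemma above_raise:
  assumes X: "X \<in> raising" and v: "v \<in> above c \<or> v \<in> eig (cartan 2 1 0) c"
  shows "act X v \<in> above c"
proof -
  obtain d where d: "d \<ge> 1" "lie (cartan 2 1 0) X = d *\<^sub>R X"
    using lie_grading_raising(1)[OF X] by blast
  have Xso: "X \<in> so24" using X raising_so24 by blast
  have 1: "act X v \<in> above c" if "v \<in> eig (cartan 2 1 0) e" "e \<ge> c" for v e
  proof -
    have "act X v \<in> eig (cartan 2 1 0) (e + d)" using eig_raise[OF cartan_so24 Xso d(2) that(1)] .
    moreover have "e + d \<in> {c<..}" using d(1) that(2) by simp
    ultimately show ?thesis unfolding above_def by (intro span_base) blast
  qed
  have "act X ` (\<Union>d\<in>{c<..}. eig (cartan 2 1 0) d) \<subseteq> above c" using 1 by fastforce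
  from linear_image_span_subset[OF act_linear this[unfolded above_def]]
  have "act X ` above c \<subseteq> above c" unfolding above_def .
  then show ?thesis using v 1 by auto
qed

lemma lowest_subspace: "subspace {l. lowest l}"
  using V_subspace unfolding lowest_def subspace_def
  by (auto simp: act.add_right act.scaleR_right act.zero_right)

lemma lowest_J: "lowest l \<Longrightarrow> lowest (J l)"
  using n_minus_so24 linear_0[OF J] by (auto simp: lowest_def J_V act_J subset_iff)

lemma weight_vector_subspace: "subspace {l. weight_vector l}"
  unfolding subspace_def weight_vector_def
  by (auto simp: act.add_right act.scaleR_right act.zero_right linear_0[OF J] linear_add[OF J]
      linear_scale[OF J] scaleR_add_right scaleR_diff_right mult.commute)

lemma weight_vector_J: "l \<in> V \<Longrightarrow> weight_vector l \<Longrightarrow> weight_vector (J l)"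
  unfolding weight_vector_def
  by (auto simp: act_J linear_add[OF J] linear_scale[OF J])

lemma JJ_span: "l \<in> V \<Longrightarrow> J (J l) \<in> span {l, J l}"
  using J_square[of l] by (auto split: if_splits simp: span_base span_neg)

lemma span_line:
  assumes "lowest l" "weight_vector l"
  shows "span {l, J l} \<subseteq> {l. lowest l} \<inter> {l. weight_vector l}" "J ` span {l, J l} \<subseteq> span {l, J l}"
proof -
  have "l \<in> V" using assms(1) by (simp add: lowest_def)
  then show "span {l, J l} \<subseteq> {l. lowest l} \<inter> {l. weight_vector l}"
    using assms lowest_J weight_vector_J
    by (intro span_minimal subspace_inter lowest_subspace weight_vector_subspace) auto
  show "J ` span {l, J l} \<subseteq> span {l, J l}"
    by (rule linear_image_span_subset[OF J]) (use JJ_span[OF \<open>l \<in> V\<close>] in \<open>auto simp: span_base\<close>)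
qed

lemma line_generates:
  assumes l: "l \<noteq> 0" "lowest l" "weight_vector l"
  shows "span (words (span {l, J l})) = V"
proof (rule words_generate[where l = l])
  note L = span_line[OF l(2,3)]
  show "span {l, J l} \<subseteq> V" using L(1) by (auto simp: lowest_def)
  show "J ` span {l, J l} \<subseteq> span {l, J l}" by (rule L(2))
  show "act (cartan a b r) k \<in> span {l, J l}" if k: "k \<in> span {l, J l}" for a b r k
  proof -
    have "weight_vector k" "J k \<in> span {l, J l}" using L k by auto
    then show ?thesis using k unfolding weight_vector_def
      by (auto intro!: span_add span_scale)
  qed
qed (use l span_line(1)[OF l(2,3)] in \<open>auto simp: span_base\<close>)

abbreviation "lowest_G \<equiv> - (real w1 * 2 + (real w2 + real w3) * 3 / 2)"

lemma weight_vector_eig: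
  assumes "lowest l" "weight_vector l"
  shows "l \<in> eig (cartan 2 1 0) lowest_G"
  using assms(2)[unfolded weight_vector_def, rule_format, of 2 1 0] assms(1)
  by (simp add: lowest_def eig_def)

text \<open>Lowest vectors of strictly greater height would generate a subrepresentation that stays
  above the lowest height and misses \<open>l\<close>, so they vanish. As \<open>V\<close> is the
  sum of the line and of the part above it, the component of \<open>k\<close> in the latter is such
  a vector.\<close>

lemma lowest_in_line:
  assumes l: "l \<noteq> 0" "lowest l" "weight_vector l" and k: "lowest k"
  shows "k \<in> span {l, J l}"
proof -
  let ?L = "span {l, J l}" and ?g = lowest_G and ?G = "cartan 2 1 0"
  have Lg: "?L \<subseteq> eig ?G ?g" using span_line(1)[OF l(2,3)] weight_vector_eig by blast
  have l_not_above: "l \<notin> above ?g"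
  proof
    assume "l \<in> above ?g"
    moreover have "above ?g \<subseteq> span (\<Union>d\<in>{d. d \<noteq> ?g}. eig ?G d)"
      unfolding above_def by (intro span_mono UN_mono) auto
    ultimately show False using eig_independent weight_vector_eig[OF l(2,3)] l(1) by blast
  qed
  define U where "U = {u. lowest u} \<inter> above ?g"
  have "U = {0}"
  proof (rule ccontr)
    assume ne: "U \<noteq> {0}"
    have subU: "subspace U"
      unfolding U_def above_def by (intro subspace_inter lowest_subspace subspace_span)
    then obtain u where u: "u \<in> U" "u \<noteq> 0" using ne subspace_0 by blast
    have UV: "U \<subseteq> V" by (auto simp: U_def lowest_def)
    have "span (words U) = V"
    proof (rule words_generate[OF subU UV _ u])
      show "lowest k" if "k \<in> U" for k using that by (simp add: U_def)
      have "J ` (\<Union>d\<in>{?g<..}. eig ?G d) \<subseteq> (\<Union>d\<in>{?g<..}. eig ?G d)"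
        using J_V by (auto simp: eig_def act_J linear_scale[OF J])
      then have "J ` above ?g \<subseteq> above ?g"
        unfolding above_def by (intro linear_image_span_subset[OF J] subset_trans[OF _ span_superset])
      then show "J ` U \<subseteq> U" using lowest_J by (auto simp: U_def)
      \<comment> \<open>Elements of \<open>U\<close> are not known to be weight vectors. The
        generating set is therefore the whole of \<open>U\<close>, which the Cartan subalgebra
        preserves because it commutes with \<open>cartan 2 1 0\<close> and normalizes
        \<open>n_minus\<close>.\<close>
      show "act (cartan a b r) k \<in> U" if k: "k \<in> U" for a b r k
      proof -
        let ?C = "cartan a b r"
        have kV: "k \<in> V" using k UV by blast
        have "lie ?G ?C = 0 *\<^sub>R ?C" by (simp add: cartan_smat lie_smat smat_0)
        from eig_raise[OF cartan_so24 cartan_so24 this]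
        have "act ?C ` (\<Union>d\<in>{?g<..}. eig ?G d) \<subseteq> (\<Union>d\<in>{?g<..}. eig ?G d)" by auto
        then have "act ?C ` above ?g \<subseteq> above ?g"
          unfolding above_def by (intro linear_image_span_subset[OF act_linear] subset_trans[OF _ span_superset])
        moreover have "act Y (act ?C k) = 0" if Y: "Y \<in> n_minus" for Y
        proof -
          have "lie Y ?C \<in> n_minus" using Y by (auto simp: n_minus_eq cartan_smat lie_smat smat_eq_iff)
          moreover have "act Y (act ?C k) = act ?C (act Y k) + act (lie Y ?C) k"
            using act_lie[of Y ?C k] Y n_minus_so24 kV by auto
          ultimately show ?thesis using k Y by (simp add: U_def lowest_def act.zero_right)
        qed
        ultimately show ?thesis using k by (auto simp: U_def lowest_def)
      qed
    qed
    moreover have "words U \<subseteq> above ?g"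
    proof
      fix w assume "w \<in> words U"
      then show "w \<in> above ?g" by induction (auto simp: U_def above_raise)
    qed
    then have "span (words U) \<subseteq> above ?g"
      unfolding above_def by (rule span_minimal) (rule subspace_span)
    ultimately show False using l_not_above l(2) by (auto simp: lowest_def)
  qed
  define M where "M = {c + u | c u. c \<in> ?L \<and> u \<in> above ?g}"
  have "subspace M" unfolding M_def above_def by (rule subspace_sums) (rule subspace_span)+
  moreover have "words ?L \<subseteq> M"
  proof
    fix w assume "w \<in> words ?L"
    then have "w \<in> ?L \<or> w \<in> above ?g"
      by induction (use Lg in \<open>auto simp: above_raise\<close>)
    moreover have "0 \<in> ?L" "0 \<in> above ?g" by (auto simp: above_def span_zero)
    ultimately show "w \<in> M" unfolding M_def by force
  qed
  ultimately have "V \<subseteq> M" using span_minimal line_generates[OF l] by blast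
  then obtain c u where cu: "k = c + u" "c \<in> ?L" "u \<in> above ?g"
    using k by (auto simp: M_def lowest_def)
  have "lowest c" using span_line(1)[OF l(2,3)] cu(2) by blast
  then have "lowest u" using subspace_diff[OF lowest_subspace, of k c] k cu(1) by simp
  then have "u = 0" using \<open>U = {0}\<close> cu(3) by (auto simp: U_def)
  then show ?thesis using cu by simp
qed

section \<open>The lowest eigenspace of the grading element\<close>

abbreviation "lowest_grade \<equiv> - (real w1 + (real w2 + real w3) / 2)"

lemma gradE_so24 [simp]: "gradE \<in> so24" by (simp add: gradE_smat)

lemma E_eigenspace_eq: "E_eigenspace V \<rho> c = eig gradE c"
  unfolding E_eigenspace_def eig_def using act_eq[OF gradE_so24] by auto

lemma weight_vector_grade:
  assumes "lowest l" "weight_vector l"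
  shows "l \<in> eig gradE lowest_grade"
  using assms(2)[unfolded weight_vector_def, rule_format, of 1 0 0] assms(1)
  by (simp add: lowest_def eig_def cartan_smat gradE_smat)

text \<open>A lowest weight vector has eigenvalue \<open>lowest_grade\<close>, no raising operator
  decreases it, and the resulting words span \<open>V\<close>.\<close>

lemma V_graded: "V \<subseteq> span (\<Union>c\<in>{lowest_grade..}. eig gradE c)"
proof -
  obtain l where l: "l \<noteq> 0" "lowest l" "weight_vector l" using lowest_weight_vector_exists by blast
  have "words (span {l, J l}) \<subseteq> (\<Union>c\<in>{lowest_grade..}. eig gradE c)"
  proof
    fix w assume "w \<in> words (span {l, J l})"
    then show "w \<in> (\<Union>c\<in>{lowest_grade..}. eig gradE c)"
    proof induction
      case (base k)
      then have "k \<in> eig gradE lowest_grade"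
        using span_line(1)[OF l(2,3)] weight_vector_grade by blast
      then show ?case by fast
    next
      case (step w X)
      then obtain c where c: "c \<ge> lowest_grade" "w \<in> eig gradE c" by auto
      obtain d where d: "d \<ge> 0" "lie gradE X = d *\<^sub>R X"
        using lie_grading_raising(2)[OF step(2)] by blast
      have "X \<in> so24" using step(2) raising_so24 by blast
      from eig_raise[OF gradE_so24 this d(2) c(2)] have "act X w \<in> eig gradE (c + d)" .
      moreover have "c + d \<in> {lowest_grade..}" using c(1) d(1) by simp
      ultimately show ?case by blast
    qed
  qed
  from span_mono[OF this] show ?thesis using line_generates[OF l] by simp
qed

lemma lowest_E_eq: "lowest_E V \<rho> = lowest_grade"
  unfolding lowest_E_def E_eigenspace_eq
proof (rule Min_eqI)
  have nz: "\<exists>v\<in>eig gradE c. v \<noteq> 0" if "eig gradE c \<noteq> {0}" for c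
    using that subspace_0[OF subspace_eig] by blast
  then have "{c. eig gradE c \<noteq> {0}} \<subseteq> {c. \<exists>v. v \<noteq> 0 \<and> act gradE v = c *\<^sub>R v}"
    unfolding eig_def by blast
  then show "finite {c. eig gradE c \<noteq> {0}}"
    using finite_eigenvalues[OF act_linear] by (rule finite_subset)
  show "lowest_grade \<le> c" if c: "c \<in> {c. eig gradE c \<noteq> {0}}" for c
  proof (rule ccontr)
    assume "\<not> lowest_grade \<le> c"
    then have "span (\<Union>c\<in>{lowest_grade..}. eig gradE c) \<subseteq> span (\<Union>d\<in>{d. d \<noteq> c}. eig gradE d)"
      by (intro span_mono UN_mono) auto
    then have V: "V \<subseteq> span (\<Union>d\<in>{d. d \<noteq> c}. eig gradE d)" using V_graded by blast
    obtain v where v: "v \<in> eig gradE c" "v \<noteq> 0" using nz c by blast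
    then have "v \<in> V" by (simp add: eig_def)
    then show False using eig_independent[OF v(1)] V v(2) by blast
  qed
  obtain l where l: "l \<noteq> 0" "lowest l" "weight_vector l" using lowest_weight_vector_exists by blast
  then show "lowest_grade \<in> {c. eig gradE c \<noteq> {0}}" using weight_vector_grade by blast
qed

lemma Xspace_eq: "Xspace V \<rho> = eig gradE lowest_grade"
  unfolding Xspace_def lowest_E_eq E_eigenspace_eq ..

lemma Xproj_eqI:
  assumes u: "u \<in> eig gradE lowest_grade" and v: "v - u \<in> span (\<Union>d\<in>{d. d \<noteq> lowest_grade}. eig gradE d)"
  shows "Xproj V \<rho> v = u"
  unfolding Xproj_def Xspace_eq E_eigenspace_eq lowest_E_eq
proof (rule the_equality)
  fix u' assume u': "u' \<in> eig gradE lowest_grade \<and>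
    v - u' \<in> span (\<Union>d\<in>{d. d \<noteq> lowest_grade}. eig gradE d)"
  have "(v - u) - (v - u') \<in> span (\<Union>d\<in>{d. d \<noteq> lowest_grade}. eig gradE d)"
    using u' v by (blast intro: span_diff)
  moreover have "u' - u \<in> eig gradE lowest_grade"
    using u u' by (blast intro: subspace_diff[OF subspace_eig])
  ultimately have "u' - u = 0" by (intro eig_independent) simp_all
  then show "u' = u" by simp
qed (use assms in simp)

text \<open>The holonomy algebra is conjugate, by the exponential of \<open>root_z2\<close>, to the subalgebra spanned
  by \<open>n_minus\<close> and the three-dimensional simple algebra of the middle simple root; the latter
  is contained in the annihilator of a lowest weight vector precisely if \<open>w1 = 0\<close>.\<close>

definition lift :: "'v \<Rightarrow> 'v" where "lift = lin_exp (act root_z2)"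

lemma lift_linear: "linear lift"
  unfolding lift_def by (rule linear_lin_exp[OF act_linear])

lemma lift_V: "v \<in> V \<Longrightarrow> lift v \<in> V"
  using exp_act_V[of v 1 root_z2] by (simp add: lift_def)

lemma lift_J: "v \<in> V \<Longrightarrow> lift (J v) = J (lift v)"
  using exp_act_J[of root_z2 v 1] by (simp add: lift_def)

lemma lift_eq_0_iff: "lift v = 0 \<longleftrightarrow> v = 0"
proof
  assume "lift v = 0"
  have "lin_exp (\<lambda>v. - act root_z2 v) (lin_exp (\<lambda>v. - (- act root_z2 v)) v) = v"
    by (rule lin_exp_inverse) (intro linear_compose_neg act_linear)
  then have "v = lin_exp (\<lambda>v. - act root_z2 v) 0" using \<open>lift v = 0\<close> by (simp add: lift_def)
  then show "v = 0" using linear_0[OF linear_lin_exp[OF linear_compose_neg[OF act_linear]]] by metis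
qed (simp add: linear_0[OF lift_linear])

lemma lift_surj:
  assumes "v \<in> V"
  obtains k where "k \<in> V" "lift k = v"
proof
  have "lin_exp (\<lambda>v. (- 1) *\<^sub>R act root_z2 v) v \<in> V" using exp_act_V[OF assms] .
  then show "lin_exp (\<lambda>v. - act root_z2 v) v \<in> V" by simp
  show "lift (lin_exp (\<lambda>v. - act root_z2 v) v) = v"
    unfolding lift_def by (rule lin_exp_inverse[OF act_linear])
qed

lemma lift_conjugation:
  assumes "k \<in> V"
  shows "act (smat a z1 z2 z3 z4 x1 x2 x3 x4 p q1 q2 r1 r2 s + lie root_z2 (smat a z1 z2 z3 z4 x1 x2 x3 x4 p q1 q2 r1 r2 s)
      + (1/2) *\<^sub>R lie root_z2 (lie root_z2 (smat a z1 z2 z3 z4 x1 x2 x3 x4 p q1 q2 r1 r2 s))) (lift k) =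
    lift (act (smat a z1 z2 z3 z4 x1 x2 x3 x4 p q1 q2 r1 r2 s) k)"
  unfolding lift_def
  by (rule exp_act_nilpotent[symmetric, OF _ assms]) (simp_all add: lie_smat smat_0[symmetric])

text \<open>The matrices on the right are those on the left transformed by
  \<open>exp (- ad root_z2)\<close>.\<close>

lemma hol_lift:
  assumes "k \<in> V"
  shows "act root_z1 (lift k) = lift (act root_z1 k)"
    "act root_r1 (lift k) = lift (act (smat 0 (-1) 0 0 0 0 0 0 0 0 0 0 1 0 0) k)"
    "act root_r2 (lift k) = lift (act root_r2 k)"
    "act root_x4 (lift k) = lift (act (smat 0 (1/2) 0 0 0 0 0 0 1 0 0 0 (-1) 0 0) k)"
    "act (smat 1 0 0 0 0 0 2 0 0 1 0 0 0 0 0) (lift k) = lift (act (smat (-1) 0 0 0 0 0 2 0 0 1 0 0 0 0 0) k)"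
    "act (smat 0 0 1 0 0 0 2 0 0 2 0 0 0 0 0) (lift k) = lift (act (smat (-2) 0 0 0 0 0 2 0 0 2 0 0 0 0 0) k)"
    "act (smat 0 0 0 1 0 0 0 2 0 0 0 0 0 0 (-2)) (lift k) = lift (act (smat 0 0 0 0 0 0 0 2 0 0 0 0 0 0 0) k)"
    "act (smat 0 0 0 0 1 2 0 0 0 0 (-2) 0 0 0 0) (lift k) = lift (act (smat 0 0 0 0 0 2 0 0 0 0 0 0 0 0 0) k)"
    "act (Omega 3) (lift k) = lift (act (smat 0 0 0 0 0 0 0 1 0 (-2) 0 0 0 0 1) k)"
  unfolding lift_conjugation[OF assms, symmetric] by (simp_all add: lie_smat smat_simps Omega_simps)

lemma act_kernel_subspace: "subspace {X. act X k = 0}"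
  unfolding subspace_def by (auto simp: act.add_left act.scaleR_left act.zero_left)

text \<open>The transformed generators span the sum of \<open>n_minus\<close> and the lines through
  \<open>root_z1\<close> and \<open>cartan 1 (-1) 0\<close>, the latter being the coroot of the
  middle simple root. Annihilation is linear in the algebra element, so only a change of basis is
  involved.\<close>

lemma lift_in_hol_kernel_iff:
  assumes k: "k \<in> V"
  shows "lift k \<in> hol_kernel V \<rho> \<longleftrightarrow>
    lowest k \<and> act root_z1 k = 0 \<and> act (cartan 1 (-1) 0) k = 0"
proof -
  let ?K = "{X. act X k = 0}"
  note sub = subspace_add[OF act_kernel_subspace] subspace_diff[OF act_kernel_subspace]
    subspace_scale[OF act_kernel_subspace]
  have hol: "hol \<subseteq> so24" by (auto simp: hol_def)
  have "lift k \<in> hol_kernel V \<rho> \<longleftrightarrow> (\<forall>X\<in>hol. act X (lift k) = 0)"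
    using hol lift_V[OF k] unfolding hol_kernel_def by (auto simp: act_eq subset_iff)
  also have "\<dots> \<longleftrightarrow> root_z1 \<in> ?K \<and> smat 0 (-1) 0 0 0 0 0 0 0 0 0 0 1 0 0 \<in> ?K \<and>
    root_r2 \<in> ?K \<and> smat 0 (1/2) 0 0 0 0 0 0 1 0 0 0 (-1) 0 0 \<in> ?K \<and>
    smat (-1) 0 0 0 0 0 2 0 0 1 0 0 0 0 0 \<in> ?K \<and> smat (-2) 0 0 0 0 0 2 0 0 2 0 0 0 0 0 \<in> ?K \<and>
    smat 0 0 0 0 0 0 0 2 0 0 0 0 0 0 0 \<in> ?K \<and> smat 0 0 0 0 0 2 0 0 0 0 0 0 0 0 0 \<in> ?K"
    unfolding hol_def by (simp add: hol_lift[OF k] lift_eq_0_iff)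
  also have "\<dots> \<longleftrightarrow> n_minus \<subseteq> ?K \<and> root_z1 \<in> ?K \<and> cartan 1 (-1) 0 \<in> ?K"
    (is "?A \<longleftrightarrow> ?B")
  proof
    assume A: ?A
    have z1: "root_z1 \<in> ?K" using A by blast
    have "root_z1 + smat 0 (-1) 0 0 0 0 0 0 0 0 0 0 1 0 0 \<in> ?K" using A by (intro sub) blast+
    then have r1: "root_r1 \<in> ?K" by (simp only: smat_simps) simp
    have r2: "root_r2 \<in> ?K" using A by blast
    have "smat 0 (1/2) 0 0 0 0 0 0 1 0 0 0 (-1) 0 0 - (1/2) *\<^sub>R root_z1 + root_r1 \<in> ?K"
      using A by (intro sub r1) blast+
    then have x4: "root_x4 \<in> ?K" by (simp only: smat_simps) simp
    have "smat (-1) 0 0 0 0 0 2 0 0 1 0 0 0 0 0 - smat (-2) 0 0 0 0 0 2 0 0 2 0 0 0 0 0 \<in> ?K"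
      using A by (intro sub) blast+
    then have c: "cartan 1 (-1) 0 \<in> ?K" by (simp only: smat_simps cartan_smat) simp
    have "(1/2) *\<^sub>R (smat (-1) 0 0 0 0 0 2 0 0 1 0 0 0 0 0 + cartan 1 (-1) 0) \<in> ?K"
      using A by (intro sub c) blast+
    then have x2: "root_x2 \<in> ?K" by (simp only: smat_simps cartan_smat) simp
    have "(1/2) *\<^sub>R smat 0 0 0 0 0 0 0 2 0 0 0 0 0 0 0 \<in> ?K" using A by (intro sub) blast+
    then have x3: "root_x3 \<in> ?K" by (simp only: smat_simps) simp
    have "(1/2) *\<^sub>R smat 0 0 0 0 0 2 0 0 0 0 0 0 0 0 0 \<in> ?K" using A by (intro sub) blast+
    then have x1: "root_x1 \<in> ?K" by (simp only: smat_simps) simp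
    have "X \<in> ?K" if X: "X \<in> n_minus" for X
    proof -
      obtain y1 y2 y3 y4 u1 u2 where X: "X = smat 0 0 0 0 0 y1 y2 y3 y4 0 0 0 u1 u2 0"
        using X by (auto simp: n_minus_eq)
      have "y1 *\<^sub>R root_x1 + (y2 *\<^sub>R root_x2
        + (y3 *\<^sub>R root_x3 + (y4 *\<^sub>R root_x4
        + (u1 *\<^sub>R root_r1 + u2 *\<^sub>R root_r2)))) \<in> ?K"
        by (intro sub x1 x2 x3 x4 r1 r2)
      then show ?thesis by (simp only: smat_simps X) simp
    qed
    then show ?B using z1 c by blast
  next
    assume B: ?B
    have n: "smat 0 0 0 0 0 x1 x2 x3 x4 0 0 0 r1 r2 0 \<in> ?K" for x1 x2 x3 x4 r1 r2
      using B unfolding n_minus_eq by blast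
    let ?c = "cartan 1 (-1) 0"
    have zc: "root_z1 \<in> ?K" "?c \<in> ?K" using B by blast+
    have "root_r1 - root_z1 \<in> ?K"
      "smat 0 0 0 0 0 0 0 0 1 0 0 0 (-1) 0 0 + (1/2) *\<^sub>R root_z1 \<in> ?K"
      "smat 0 0 0 0 0 0 2 0 0 0 0 0 0 0 0 - ?c \<in> ?K"
      "smat 0 0 0 0 0 0 2 0 0 0 0 0 0 0 0 - 2 *\<^sub>R ?c \<in> ?K"
      by (intro sub n zc)+
    then show ?A using zc(1) n[of 0 0 0 0 0 1] n[of 0 0 2 0 0 0] n[of 2 0 0 0 0 0]
      by (simp add: smat_simps cartan_smat)
  qed
  finally show ?thesis using k by (auto simp: lowest_def)
qed

lemma hol_kernel_trivial:
  assumes "w1 \<noteq> 0"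
  shows "hol_kernel V \<rho> = {0}"
proof -
  have "v = 0" if v: "v \<in> hol_kernel V \<rho>" for v
  proof -
    have "v \<in> V" using v by (simp add: hol_kernel_def)
    then obtain k where k: "k \<in> V" "lift k = v" by (rule lift_surj)
    then have low: "lowest k" and c: "act (cartan 1 (-1) 0) k = 0"
      using v lift_in_hol_kernel_iff by blast+
    obtain l where l: "l \<noteq> 0" "lowest l" "weight_vector l" using lowest_weight_vector_exists by blast
    have "weight_vector k" using lowest_in_line[OF l low] span_line(1)[OF l(2,3)] by blast
    \<comment> \<open>The coroot acts on lowest weight vectors by \<open>- w1\<close>, as the
      contributions of the two other fundamental weights cancel.\<close>
    from this[unfolded weight_vector_def, rule_format, of 1 "-1" 0]
    have "k = 0" using c assms by simp
    then show ?thesis using k(2) linear_0[OF lift_linear] by simp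
  qed
  then show ?thesis using subspace_0[OF subspace_hol_kernel[OF rep]] by blast
qed

text \<open>\<open>root_z2\<close> raises the eigenvalue of \<open>gradE\<close> by 1, so its
  exponential changes a vector of lowest degree only by terms of higher degree.\<close>

lemma Xproj_lift:
  assumes k: "k \<in> eig gradE lowest_grade"
  shows "Xproj V \<rho> (lift k) = k"
proof (rule Xproj_eqI[OF k])
  have "(act root_z2 ^^ n) k \<in> eig gradE (lowest_grade + real n)" for n
  proof (induction n)
    case (Suc n)
    have "lie gradE root_z2 = 1 *\<^sub>R root_z2" by (simp add: gradE_smat lie_smat)
    from eig_raise[OF gradE_so24 smat_in_so24 this Suc] show ?case by (simp add: ac_simps)
  qed (use k in simp)
  from this[of "Suc _"] have "(act root_z2 ^^ Suc n) k \<in> (\<Union>d\<in>{d. d \<noteq> lowest_grade}. eig gradE d)" for n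
    by (intro UN_I[of "lowest_grade + real (Suc n)"]) auto
  then show "lift k - k \<in> span (\<Union>d\<in>{d. d \<noteq> lowest_grade}. eig gradE d)"
    unfolding lift_def by (intro lin_exp_minus_in_subspace act_linear subspace_span span_base)
qed

lemma lowest_weight_vector_iff: "lowest_weight_vector V \<rho> l \<longleftrightarrow> l \<noteq> 0 \<and> lowest l"
  unfolding lowest_weight_vector_def lowest_def using n_minus_so24 by (auto simp: act_eq subset_iff)

lemma lowest_is_weight_vector: "lowest l \<Longrightarrow> weight_vector l"
  using lowest_weight_vector_exists lowest_in_line span_line(1) by blast

text \<open>For \<open>w1 = 0\<close> the coroot kills every lowest vector \<open>k\<close>. Since
  brackets of \<open>n_minus\<close> with \<open>root_z1\<close> lie in \<open>n_minus\<close> plus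
  the line of the coroot, \<open>act root_z1 k\<close> is again a lowest vector. Its height exceeds
  the only one possible for lowest vectors by 1, so it is 0.\<close>

lemma hol_kernel_eq:
  assumes w1: "w1 = 0" and l: "l \<noteq> 0" "lowest l"
  shows "hol_kernel V \<rho> = lift ` span {l, J l}"
proof -
  have lw: "weight_vector l" by (rule lowest_is_weight_vector[OF l(2)])
  have key: "act root_z1 k = 0 \<and> act (cartan 1 (-1) 0) k = 0"
    if k: "lowest k" for k
  proof -
    have kV: "k \<in> V" using k by (simp add: lowest_def)
    have kw: "weight_vector k" by (rule lowest_is_weight_vector[OF k])
    have c: "act (cartan 1 (-1) 0) k = 0"
      using kw[unfolded weight_vector_def, rule_format, of 1 "-1" 0] w1 by simp
    have "act Y (act root_z1 k) = 0" if Y: "Y \<in> n_minus" for Y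
    proof -
      obtain x1 x2 x3 x4 r1 r2 where Y': "Y = smat 0 0 0 0 0 x1 x2 x3 x4 0 0 0 r1 r2 0"
        using Y by (auto simp: n_minus_eq)
      have "lie Y root_z1 = smat 0 0 0 0 0 0 0 0 0 0 0 0 x2 x3 0 - x1 *\<^sub>R cartan 1 (-1) 0"
        by (simp add: Y' lie_smat cartan_smat smat_simps)
      moreover have "smat 0 0 0 0 0 0 0 0 0 0 0 0 x2 x3 0 \<in> n_minus" unfolding n_minus_eq by blast
      ultimately have "act (lie Y root_z1) k = 0"
        using k c by (simp add: act.diff_left act.scaleR_left lowest_def)
      moreover have "act Y (act root_z1 k) = act root_z1 (act Y k) + act (lie Y root_z1) k"
        using act_lie[of Y root_z1 k] kV Y' by simp
      ultimately show ?thesis using k Y by (simp add: lowest_def act.zero_right)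
    qed
    then have zl: "lowest (act root_z1 k)" by (simp add: lowest_def)
    have "lie (cartan 2 1 0) root_z1 = 1 *\<^sub>R root_z1" by (simp add: cartan_smat lie_smat)
    from eig_raise[OF cartan_so24 smat_in_so24 this weight_vector_eig[OF k kw]]
    have "act (cartan 2 1 0) (act root_z1 k) = (lowest_G + 1) *\<^sub>R act root_z1 k" by (simp add: eig_def)
    moreover have "act (cartan 2 1 0) (act root_z1 k) = lowest_G *\<^sub>R act root_z1 k"
      using weight_vector_eig[OF zl lowest_is_weight_vector[OF zl]] by (simp add: eig_def)
    ultimately have "act root_z1 k = 0" by (metis scaleR_right_imp_eq add_cancel_left_right zero_neq_one)
    with c show ?thesis by simp
  qed
  show ?thesis
  proof (intro equalityI subsetI)
    fix v assume v: "v \<in> hol_kernel V \<rho>"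
    then have "v \<in> V" by (simp add: hol_kernel_def)
    then obtain k where k: "k \<in> V" "lift k = v" by (rule lift_surj)
    then have "lowest k" using v lift_in_hol_kernel_iff by blast
    then show "v \<in> lift ` span {l, J l}" using lowest_in_line[OF l lw] k(2) by blast
  next
    fix v assume "v \<in> lift ` span {l, J l}"
    then obtain k where k: "k \<in> span {l, J l}" "v = lift k" by blast
    then have low: "lowest k" using span_line(1)[OF l(2) lw] by blast
    then show "v \<in> hol_kernel V \<rho>"
      using lift_in_hol_kernel_iff key[OF low] k(2) by (simp add: lowest_def)
  qed
qed

text \<open>After conjugation, \<open>Omega 3\<close> is \<open>root_x3\<close>, which kills
  \<open>l\<close>, plus \<open>cartan 0 (-2) 1\<close>. The lowest weight evaluated on the latter
  produces both coefficients.\<close>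

lemma Omega_3_lift:
  assumes l: "lowest l"
  shows "act (Omega 3) (lift l) = (real w2 + real w3) *\<^sub>R lift l + ((real w2 - real w3) / 2) *\<^sub>R J (lift l)"
proof -
  have lV: "l \<in> V" using l by (simp add: lowest_def)
  have split: "smat 0 0 0 0 0 0 0 1 0 (-2) 0 0 0 0 1 = root_x3 + cartan 0 (-2) 1"
    by (simp add: cartan_smat smat_simps)
  have nm: "root_x3 \<in> n_minus" unfolding n_minus_eq by blast
  have "act (smat 0 0 0 0 0 0 0 1 0 (-2) 0 0 0 0 1) l =
      (real w2 + real w3) *\<^sub>R l + ((real w2 - real w3) / 2) *\<^sub>R J l"
  proof -
    have "- (real w1 * 0 + (real w2 + real w3) * (0 + - 2) / 2) = real w2 + real w3"
      by (simp add: field_simps)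
    with lowest_is_weight_vector[OF l, unfolded weight_vector_def, rule_format, of 0 "-2" 1]
    have "act (cartan 0 (-2) 1) l = (real w2 + real w3) *\<^sub>R l + ((real w2 - real w3) / 2) *\<^sub>R J l"
      by (simp only: mult_1_right)
    then show ?thesis using l nm split
      by (simp add: act.add_left lowest_def)
  qed
  then show ?thesis
    unfolding hol_lift[OF lV] by (simp add: linear_add[OF lift_linear] linear_scale[OF lift_linear] lift_J[OF lV])
qed

end

section \<open>Parallel tractors on the group\<close>

lemma k_mat_eqD: "k_mat x t = k_mat y u \<Longrightarrow> x = y \<and> t = u"
  unfolding k_mat_blk blk_eq_iff by (simp add: vec_eq_iff forall_4)

lemma blk_diff: "blk a b c d p q r s - blk a' b' c' d' p' q' r' s' =
    blk (a - a') (b - b') (c - c') (d - d') (p - p') (q - q') (r - r') (s - s')"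
  by (simp add: blk_def vec_eq_iff forall_4)

lemma lie_k_mat:
  "lie (k_mat x t) (k_mat y u) = blk 0 (2 * x$3 * u - 2 * t * y$3) 0 0
     ((2 * x$4 + t - x$1) * y$1 - (2 * y$4 + u - y$1) * x$1)
     (2 * (x$3 - x$2) * (2 * y$4 + u - y$1) - 2 * (2 * x$4 + t - x$1) * (y$3 - y$2))
     (2 * x$1 * (y$3 - y$2) - 2 * (x$3 - x$2) * y$1)
     (x$1 * (2 * y$4 + u - y$1) - y$1 * (2 * x$4 + t - x$1))"
  by (simp add: lie_def k_mat_blk blk_mult blk_diff blk_eq_iff algebra_simps)

text \<open>This is \<open>- root_r1\<close>, up to sign an element of \<open>hol\<close>. So the
  isotropy acts trivially on \<open>hol_kernel\<close>, and equivariance under \<open>H\<close>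
  reduces to invariance there.\<close>

lemma isotropy_smat: "isotropy = smat 0 0 0 0 0 0 0 0 0 0 0 0 (-1) 0 0"
proof -
  have the: "(THE c. \<exists>t. lie (k_mat 0 1) (k_mat y 0) = k_mat c t) = c"
    if "lie (k_mat 0 1) (k_mat y 0) = k_mat c t" for y c t
    using that by (intro the_equality) (auto dest: k_mat_eqD)
  have "lie (k_mat 0 1) (k_mat (axis 1 1) 0) = k_mat (vector [0, -1, 0, 0]) 0"
    "lie (k_mat 0 1) (k_mat (axis 2 1) 0) = k_mat (vector [0, 0, 0, 1]) 0"
    "lie (k_mat 0 1) (k_mat (axis 3 1) 0) = k_mat (vector [0, 0, 0, 0]) (-2)"
    "lie (k_mat 0 1) (k_mat (axis 4 1) 0) = k_mat (vector [0, 0, 0, 0]) 0"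
    unfolding lie_k_mat unfolding k_mat_blk blk_eq_iff by (simp_all add: axis_def)
  note cols = this[THEN the]
  have "(\<chi> i j. (THE c. \<exists>t. lie (k_mat 0 1) (k_mat (axis j 1) 0) = k_mat c t) $ i) = so_mat 0 0 0 (-1) 0 0"
    unfolding so_mat_def eq_vector_4 vec_lambda_beta cols by simp
  then show ?thesis by (simp add: isotropy_def so24_mat_eq_smat)
qed

lemma lin_exp_fixed:
  fixes v :: "'v::real_normed_vector"
  assumes "T v = 0" "T 0 = 0"
  shows "lin_exp T v = v"
proof -
  have "lin_exp T v = lin_exp (\<lambda>v. 0) v"
    by (rule lin_exp_cong[where V = "{v, 0}"]) (use assms in auto)
  then show ?thesis by (simp add: lin_exp_zero)
qed

text \<open>Boundedness of \<open>sinq\<close> near 0 suffices, since the other factor tends to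
  0.\<close>

lemma tendsto_sinq_mult:
  assumes "(d \<longlongrightarrow> 0) F" "(n \<longlongrightarrow> 0) F"
  shows "((\<lambda>z. sinq (d z) * n z) \<longlongrightarrow> 0) F"
proof (rule Lim_null_comparison)
  have "\<forall>\<^sub>F z in F. \<bar>d z\<bar> < 1" using order_tendstoD(2)[OF tendsto_rabs[OF assms(1)], of 1] by simp
  then show "\<forall>\<^sub>F z in F. norm (sinq (d z) * n z) \<le> exp 1 * \<bar>n z\<bar>"
  proof eventually_elim
    case (elim z)
    then show ?case using sinq_bounded[of "d z"] by (simp add: abs_mult mult_right_mono)
  qed
  show "((\<lambda>z. exp 1 * \<bar>n z\<bar>) \<longlongrightarrow> 0) F"
    using tendsto_mult[OF tendsto_const tendsto_rabs[OF assms(2)], of "exp 1"] by simp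
qed

lemma tendsto_cosq:
  assumes "(d \<longlongrightarrow> 0) F"
  shows "((\<lambda>z. cosq (d z)) \<longlongrightarrow> 1) F"
proof -
  have "((\<lambda>z. sinq (d z) * (sinq (d z) * d z)) \<longlongrightarrow> 0) F"
    by (intro tendsto_sinq_mult assms)
  then have "((\<lambda>z. sqrt (1 + sinq (d z) * (sinq (d z) * d z))) \<longlongrightarrow> sqrt (1 + 0)) F"
    by (intro tendsto_intros)
  moreover have "\<forall>\<^sub>F z in F. \<bar>d z\<bar> < 1" using order_tendstoD(2)[OF tendsto_rabs[OF assms], of 1] by simp
  then have "\<forall>\<^sub>F z in F. sqrt (1 + sinq (d z) * (sinq (d z) * d z)) = cosq (d z)"
    by eventually_elim (simp add: cosq_eq_sqrt power2_eq_square ac_simps)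
  ultimately show ?thesis using Lim_transform_eventually by fastforce
qed

text \<open>The differential equation controls tractors along \<open>c_tilde\<close>, whereas the
  representation is tested on exponentials. The decomposition connects them; the upper block shows
  that it preserves the third coordinate, the only one on which parallel tractors depend.\<close>

lemma eventually_mexp_decomposition:
  assumes "e > 0"
  shows "\<forall>\<^sub>F (x, t) in nhds (0, 0). \<exists>y s. y \<in> ball 0 e \<and> y$3 = x$3 \<and> mexp (k_mat x t) = c_tilde y ** H_elem s"
proof -
  let ?F = "nhds (0::real^4, 0::real)"
  \<comment> \<open>The square of the lower block is this scalar, the negative of its
    determinant.\<close>
  define d where "d z = (fst z$3 - fst z$2)\<^sup>2 + (2 * fst z$4 + snd z - fst z$1) * fst z$1"
    for z :: "(real^4) \<times> real"
  define p where "p z = cosq (d z) + sinq (d z) * (fst z$3 - fst z$2)" for z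
  define q where "q z = sinq (d z) * (2 * fst z$4 + snd z - fst z$1)" for z
  define r where "r z = sinq (d z) * fst z$1" for z
  define u where "u z = cosq (d z) - sinq (d z) * (fst z$3 - fst z$2)" for z
  define b where "b z = sinq ((fst z$3)\<^sup>2) * snd z" for z :: "(real^4) \<times> real"
  define s where "s z = b z / exp (fst z$3)" for z
  define y where "y z = (vector [arctan (r z / p z), fst z$3 - ln (sqrt ((p z)\<^sup>2 + (r z)\<^sup>2)), fst z$3,
      (p z * (q z - s z * p z) + r z * (u z - s z * r z)) / (2 * ((p z)\<^sup>2 + (r z)\<^sup>2))] :: real^4)" for z
  have x0: "((\<lambda>z. fst z$i) \<longlongrightarrow> 0) ?F" for i
    using tendsto_vec_nth[OF tendsto_fst[OF filterlim_ident[of "nhds (0::real^4, 0::real)"]], of i] by simp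
  have t0: "(snd \<longlongrightarrow> 0) ?F"
    using tendsto_snd[OF filterlim_ident[of "nhds (0::real^4, 0::real)"]] by simp
  have n0: "((\<lambda>z. fst z$3 - fst z$2) \<longlongrightarrow> 0) ?F" "((\<lambda>z. 2 * fst z$4 + snd z - fst z$1) \<longlongrightarrow> 0) ?F"
    by (rule tendsto_eq_intros x0 t0 refl | simp)+
  have d0: "(d \<longlongrightarrow> 0) ?F"
    unfolding d_def[abs_def] by (rule tendsto_eq_intros n0 x0 refl | simp)+
  have p1: "(p \<longlongrightarrow> 1) ?F" and u1: "(u \<longlongrightarrow> 1) ?F"
    unfolding p_def[abs_def] u_def[abs_def]
    by (rule tendsto_eq_intros tendsto_cosq tendsto_sinq_mult d0 n0 refl | simp)+
  have q0: "(q \<longlongrightarrow> 0) ?F" and r0: "(r \<longlongrightarrow> 0) ?F"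
    unfolding q_def[abs_def] r_def[abs_def] by (intro tendsto_sinq_mult d0 n0 x0)+
  have b0: "(b \<longlongrightarrow> 0) ?F"
    unfolding b_def[abs_def] by (intro tendsto_sinq_mult t0) (rule tendsto_eq_intros x0 refl | simp)+
  have s0: "(s \<longlongrightarrow> 0) ?F"
    unfolding s_def[abs_def] by (rule tendsto_eq_intros b0 x0 refl | simp)+
  have y0: "(y \<longlongrightarrow> 0) ?F"
  proof (rule vec_tendstoI)
    have "((\<lambda>z. arctan (r z / p z)) \<longlongrightarrow> 0) ?F"
      "((\<lambda>z. fst z$3 - ln (sqrt ((p z)\<^sup>2 + (r z)\<^sup>2))) \<longlongrightarrow> 0) ?F"
      "((\<lambda>z. (p z * (q z - s z * p z) + r z * (u z - s z * r z)) / (2 * ((p z)\<^sup>2 + (r z)\<^sup>2))) \<longlongrightarrow> 0) ?F"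
      by (rule tendsto_eq_intros p1 u1 q0 r0 s0 x0 refl | simp)+
    then show "((\<lambda>z. y z $ i) \<longlongrightarrow> 0 $ i) ?F" for i
      using x0 exhaust_4[of i] by (elim disjE) (simp_all add: y_def)
  qed
  have "\<forall>\<^sub>F z in ?F. y z \<in> ball 0 e"
    using tendstoD[OF y0 assms] by (simp add: dist_commute)
  moreover have "\<forall>\<^sub>F z in ?F. 0 < p z" using order_tendstoD(1)[OF p1] by simp
  ultimately have "\<forall>\<^sub>F z in ?F. \<exists>y s. y \<in> ball 0 e \<and> y$3 = fst z$3 \<and>
      mexp (k_mat (fst z) (snd z)) = c_tilde y ** H_elem s"
  proof eventually_elim
    case (elim z)
    have "p z * u z - q z * r z = 1"
      using cosq_sinq[of "d z"] unfolding p_def q_def r_def u_def d_def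
      by (simp add: algebra_simps power2_eq_square)
    from c_tilde_H_elem_decomposition[OF elim(2) this, of "fst z$3" "b z"]
    have "blk (exp (fst z$3)) (b z) 0 (exp (- fst z$3)) (p z) (q z) (r z) (u z) = c_tilde (y z) ** H_elem (s z)"
      by (simp only: y_def s_def)
    moreover have "mexp (k_mat (fst z) (snd z)) =
        blk (exp (fst z$3)) (b z) 0 (exp (- fst z$3)) (p z) (q z) (r z) (u z)"
      using mexp_blk[of "fst z$3" "snd z" "fst z$3 - fst z$2" "2 * fst z$4 + snd z - fst z$1" "fst z$1"]
      by (simp add: k_mat_blk p_def q_def r_def u_def b_def d_def cosq_square sinq_square
          cosh_plus_sinh cosh_minus_sinh)
    moreover have "y z$3 = fst z$3" by (simp add: y_def)
    ultimately show ?case using elim(1) by metis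
  qed
  then show ?thesis by (rule eventually_mono) (simp only: case_prod_beta)
qed

text \<open>For a parallel section, the codifferential condition and the cohomology class of the
  derivative vanish trivially. It is thus the splitting of its own projection, and that projection
  solves the first BGG equation.\<close>

lemma normal_solution_iff:
  assumes rep: "lie_rep V \<rho>"
  shows "normal_solution V \<rho> U \<sigma> \<longleftrightarrow> (\<exists>s. parallel_on V \<rho> U s \<and> (\<forall>x\<in>U. \<sigma> x = Xproj V \<rho> (s x)))"
proof
  assume "normal_solution V \<rho> U \<sigma>"
  then show "\<exists>s. parallel_on V \<rho> U s \<and> (\<forall>x\<in>U. \<sigma> x = Xproj V \<rho> (s x))"
    unfolding normal_solution_def splitting_def by metis
next
  assume "\<exists>s. parallel_on V \<rho> U s \<and> (\<forall>x\<in>U. \<sigma> x = Xproj V \<rho> (s x))"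
  then obtain s where s: "parallel_on V \<rho> U s" "\<forall>x\<in>U. \<sigma> x = Xproj V \<rho> (s x)" by blast
  have Z: "Zpos i \<in> so24" for i using exhaust_4[of i] by (elim disjE) (simp_all add: Zpos_smat)
  have V0: "0 \<in> V" by (rule subspace_0[OF lie_repD(1)[OF rep]])
  have r0: "\<rho> X 0 = 0" if "X \<in> so24" for X
    using lie_repD(3)[OF rep that V0 V0, of 1] by simp
  have nab: "tractor_nabla \<rho> s x = (\<lambda>i. 0)" if "x \<in> U" for x
    using s(1) that by (auto simp: parallel_on_def)
  have "(\<lambda>i. 0) = codiff2 \<rho> (\<lambda>i j. 0)" by (rule ext) (simp add: codiff2_def r0 Z)
  then have "(\<lambda>i. 0) \<in> codiff2_image V \<rho>" unfolding codiff2_image_def using V0 by fastforce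
  moreover have "splitting V \<rho> U \<sigma> s"
    using s nab by (auto simp: splitting_def parallel_on_def codiff1_def r0 Z)
  ultimately show "normal_solution V \<rho> U \<sigma>"
    unfolding normal_solution_def BGG_solution_def using s(1) nab by metis
qed

context holonomy_character
begin

lemma \<rho>_isotropy: "v \<in> N \<Longrightarrow> \<rho> isotropy v = 0"
proof -
  assume v: "v \<in> N"
  have "subspace {X \<in> so24. \<rho> X v = 0}" using lie_rep_kernel_subspace[OF rep N_V[OF v]] .
  moreover have "root_r1 \<in> {X \<in> so24. \<rho> X v = 0}"
    using v by (simp add: hol_kernel_def hol_def)
  ultimately have "- root_r1 \<in> {X \<in> so24. \<rho> X v = 0}" by (rule subspace_neg)
  then show ?thesis by (simp add: isotropy_smat smat_minus)
qed

lemma exp_isotropy: "v \<in> N \<Longrightarrow> lin_exp (\<lambda>v. - t *\<^sub>R \<rho> isotropy v) v = v"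
  by (rule lin_exp_fixed) (simp_all add: \<rho>_isotropy subspace_0[OF N_subspace])

definition \<Phi> :: "real^4 \<Rightarrow> real \<Rightarrow> 'v \<Rightarrow> 'v" where
  "\<Phi> x t v = x$3 *\<^sub>R (a *\<^sub>R v + b *\<^sub>R J v)"

lemma linear_\<Phi>: "linear (\<Phi> x t)"
  by (rule linearI) (simp_all add: \<Phi>_def linear_add[OF J] linear_scale[OF J] algebra_simps)

text \<open>Along the ray through \<open>x\<close>, the section satisfies the linear differential
  equation of the exponential.\<close>

lemma exp_\<Phi>:
  assumes v: "v \<in> N"
  shows "lin_exp (\<lambda>v. - \<Phi> x t v) v = exp_sec a b v (J v) x"
proof -
  let ?e = "exp_sec a b v (J v)"
  have "((\<lambda>\<tau>. ?e (\<tau> *\<^sub>R x)) has_vector_derivative - \<Phi> x t (?e (\<tau> *\<^sub>R x))) (at \<tau>)" for \<tau>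
  proof -
    have "((\<lambda>\<tau>::real. \<tau> *\<^sub>R x) has_derivative (\<lambda>h. h *\<^sub>R x)) (at \<tau>)" by (auto intro!: derivative_eq_intros)
    from has_derivative_compose[OF this exp_sec_J_has_derivative[OF v]]
    have "((\<lambda>\<tau>. ?e (\<tau> *\<^sub>R x)) has_derivative (\<lambda>h. - ((h *\<^sub>R x)$3) *\<^sub>R (a *\<^sub>R ?e (\<tau> *\<^sub>R x) + b *\<^sub>R J (?e (\<tau> *\<^sub>R x))))) (at \<tau>)" .
    then show ?thesis by (simp add: has_vector_derivative_def \<Phi>_def algebra_simps)
  qed
  from lin_exp_ode_unique[OF linear_compose_neg[OF linear_\<Phi>] this, of 1]
  have "?e x = lin_exp (\<lambda>v. - \<Phi> x t v) (?e 0)" by simp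
  moreover have "?e 0 = v" by (simp add: exp_sec_def)
  ultimately show ?thesis by simp
qed

lemma parallel_on_K_value:
  assumes f: "parallel_on_K V \<rho> W f" "mat 1 \<in> W"
  shows "f (mat 1) \<in> N" "\<forall>\<^sub>F (x, t) in nhds (0, 0). f (mexp (k_mat x t)) = exp_sec a b (f (mat 1)) (J (f (mat 1))) x"
proof -
  have U: "open (c_tilde -` W)" using f open_c_tilde_vimage by (simp add: parallel_on_K_def)
  have U0: "0 \<in> c_tilde -` W" using f(2) by (simp add: c_tilde_0)
  have par: "parallel_on V \<rho> (c_tilde -` W) (f \<circ> c_tilde)" using f by (simp add: parallel_on_K_def)
  show N1: "f (mat 1) \<in> N" using parallel_in_N[OF U par U0] by (simp add: c_tilde_0)
  obtain e where e: "e > 0" "ball 0 e \<subseteq> c_tilde -` W" using U U0 openE by blast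
  \<comment> \<open>The preimage of \<open>W\<close> may be disconnected; on a ball, parallel
    sections are determined by one vector.\<close>
  have "parallel_on V \<rho> (ball 0 e) (f \<circ> c_tilde)"
  proof -
    have Ck: "Ck_on k (ball 0 e) g" if "Ck_on k (c_tilde -` W) g" for k and g :: "real^4 \<Rightarrow> 'v"
      using that
    proof (induction k arbitrary: g)
      case 0
      then show ?case using e(2) continuous_on_subset by auto
    next
      case (Suc k)
      then show ?case using e(2) by auto
    qed
    then show ?thesis
      using par e(2) unfolding parallel_on_def tractor_on_def smooth_on_def by blast
  qed
  then obtain v where v: "v \<in> N" "\<And>x. x \<in> ball 0 e \<Longrightarrow> f (c_tilde x) = exp_sec a b v (J v) x"
    using parallel_iff[of "ball 0 e" "f \<circ> c_tilde"] by auto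
  have v1: "f (mat 1) = v" using v(2)[of 0] e(1) by (simp add: c_tilde_0 exp_sec_def)
  show "\<forall>\<^sub>F (x, t) in nhds (0, 0). f (mexp (k_mat x t)) = exp_sec a b (f (mat 1)) (J (f (mat 1))) x"
    using eventually_mexp_decomposition[OF e(1)]
  proof eventually_elim
    case (elim z)
    obtain x t where z: "z = (x, t)" by (cases z)
    obtain y s where ys: "y \<in> ball 0 e" "y$3 = x$3" "mexp (k_mat x t) = c_tilde y ** H_elem s"
      using elim z by auto
    have yW: "c_tilde y \<in> W" using ys(1) e(2) by blast
    have "f (c_tilde y ** H_elem s) = lin_exp (\<lambda>v. - s *\<^sub>R \<rho> isotropy v) (f (c_tilde y))"
      using f(1) yW by (simp add: parallel_on_K_def)
    also have "\<dots> = f (c_tilde y)" unfolding v(2)[OF ys(1)] by (rule exp_isotropy[OF exp_sec_N[OF v(1)]])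
    also have "\<dots> = exp_sec a b v (J v) x" using v(2)[OF ys(1)] ys(2) by (simp add: exp_sec_def)
    finally show ?case by (simp add: z ys(3) v1)
  qed
qed

lemma Nspace_eq: "Nspace V \<rho> = N"
proof (intro equalityI subsetI)
  fix v assume "v \<in> Nspace V \<rho>"
  then show "v \<in> N" using parallel_on_K_value(1) by (auto simp: Nspace_def)
next
  fix v assume v: "v \<in> N"
  \<comment> \<open>The upper left entry of \<open>c_tilde x\<close> is the exponential of the third
    coordinate, and right multiplication by \<open>H\<close> leaves it unchanged. Its logarithm
    therefore extends that coordinate to the whole group.\<close>
  define f where "f k = exp_sec a b v (J v) (vector [0, 0, ln (k$1$1), 0])" for k :: "real^4^4"
  have fc: "f \<circ> c_tilde = exp_sec a b v (J v)"
    by (rule ext) (simp add: f_def c_tilde_blk blk_def exp_sec_def)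
  have "k ** H_elem t \<in> K_group \<and> f (k ** H_elem t) = f k" if k: "k \<in> K_group" for k t
  proof -
    obtain c d p q r s where k: "k = blk c d 0 (1/c) p q r s" "c > 0" "p * s - q * r = 1"
      using k by (auto simp: K_group_blk)
    have kH: "k ** H_elem t = blk c (c * t + d) 0 (1/c) p (p * t + q) r (r * t + s)"
      by (simp add: k(1) H_elem_blk blk_mult)
    have "p * (r * t + s) - (p * t + q) * r = 1" using k(3) by (simp add: algebra_simps)
    then have "k ** H_elem t \<in> K_group" unfolding kH K_group_blk using k(2) by blast
    moreover have "(k ** H_elem t)$1$1 = c" unfolding kH by (simp add: blk_def)
    moreover have "k$1$1 = c" unfolding k(1) by (simp add: blk_def)
    ultimately show ?thesis by (simp add: f_def)
  qed
  moreover have "f k \<in> N" for k unfolding f_def by (rule exp_sec_N[OF v])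
  ultimately have "parallel_on_K V \<rho> K_group f"
    unfolding parallel_on_K_def fc using parallel_exp_sec[OF v] exp_isotropy N_V by simp
  moreover have "mat 1 \<in> K_group" using c_tilde_in_K_group[of 0] by (simp add: c_tilde_0)
  moreover have "f (mat 1) = v" by (simp add: f_def mat_def exp_sec_def)
  ultimately show "v \<in> Nspace V \<rho>" unfolding Nspace_def by blast
qed

lemma normal_solution_exp_sec:
  assumes "open U" "connected U"
  shows "normal_solution V \<rho> U \<sigma> \<longleftrightarrow> (\<exists>v\<in>N. \<forall>x\<in>U. \<sigma> x = Xproj V \<rho> (exp_sec a b v (J v) x))"
  unfolding normal_solution_iff[OF rep] parallel_iff[OF assms] by (metis (no_types))

lemma describes: "describes_normal_solutions V \<rho> \<Phi>"
  unfolding describes_normal_solutions_def Nspace_eq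
proof (intro conjI allI ballI impI)
  show "subspace N" by (rule N_subspace)
  show "\<Phi> x t v \<in> N" if "v \<in> N" for x t v
    unfolding \<Phi>_def using that
    by (intro subspace_scale[OF N_subspace] subspace_add[OF N_subspace] J_kernel)
  show "\<Phi> x t (v + c *\<^sub>R w) = \<Phi> x t v + c *\<^sub>R \<Phi> x t w" for x t v w c
    by (simp add: linear_add[OF linear_\<Phi>] linear_scale[OF linear_\<Phi>])
  show "\<Phi> (x + c *\<^sub>R y) (t + c * u) v = \<Phi> x t v + c *\<^sub>R \<Phi> y u v" for x t y u v c
    by (simp add: \<Phi>_def scaleR_add_left)
  show "\<Phi> z r v = \<Phi> x t (\<Phi> y u v) - \<Phi> y u (\<Phi> x t v)"
    if "lie (k_mat x t) (k_mat y u) = k_mat z r" for x t y u z r v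
  proof -
    \<comment> \<open>Brackets have third coordinate 0, and the operators on the right commute,
      being multiples of one operator: both sides vanish.\<close>
    have "z$3 = 0" using that by (simp add: lie_k_mat k_mat_blk[of z] blk_eq_iff)
    then have "\<Phi> z r v = 0" by (simp add: \<Phi>_def)
    moreover have e: "\<Phi> x t (\<Phi> y u v) = (x$3 * y$3) *\<^sub>R \<Phi> (axis 3 1) 0 (\<Phi> (axis 3 1) 0 v)" for x t y u
      by (simp add: \<Phi>_def linear_add[OF J] linear_scale[OF J] axis_def algebra_simps)
    have "\<Phi> x t (\<Phi> y u v) = \<Phi> y u (\<Phi> x t v)"
      unfolding e[of x t y u] e[of y u x t] by (simp only: mult.commute)
    ultimately show ?thesis by simp
  qed
  show "\<forall>\<^sub>F (x, t) in nhds (0, 0). f (mexp (k_mat x t)) = lin_exp (\<lambda>v. - \<Phi> x t v) (f (mat 1))"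
    if f: "parallel_on_K V \<rho> W f \<and> mat 1 \<in> W" for W f
    using parallel_on_K_value[of W f] f by (simp add: exp_\<Phi>)
  show "normal_solution V \<rho> U \<sigma> \<longleftrightarrow> (\<exists>v\<in>N. \<forall>x\<in>U. \<sigma> x =
      Xproj V \<rho> (lin_exp (\<lambda>v. - \<Phi> (vector [0, 0, 0, x$4]) 0 v)
        (lin_exp (\<lambda>v. - \<Phi> (vector [0, x$2, x$3, 0]) 0 v)
          (lin_exp (\<lambda>v. - \<Phi> (vector [x$1, 0, 0, 0]) 0 v) v))))"
    if U: "open U \<and> connected U" for U \<sigma>
  proof -
    have "lin_exp (\<lambda>v. - \<Phi> (vector [0, 0, 0, x$4]) 0 v)
        (lin_exp (\<lambda>v. - \<Phi> (vector [0, x$2, x$3, 0]) 0 v)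
          (lin_exp (\<lambda>v. - \<Phi> (vector [x$1, 0, 0, 0]) 0 v) v)) = exp_sec a b v (J v) x"
      if v: "v \<in> N" for x :: "real^4" and v
    proof -
      have "lin_exp (\<lambda>v. - \<Phi> y 0 v) w = w" if "y$3 = 0" "w \<in> N" for y w
        using that by (simp add: exp_\<Phi> exp_sec_def)
      moreover have "lin_exp (\<lambda>v. - \<Phi> (vector [0, x$2, x$3, 0]) 0 v) v = exp_sec a b v (J v) x"
        using v by (simp add: exp_\<Phi> exp_sec_def)
      ultimately show ?thesis using v exp_sec_N[OF v] by simp
    qed
    then show ?thesis unfolding normal_solution_exp_sec[OF conjunct1[OF U] conjunct2[OF U]] by simp
  qed
qed

end

section \<open>Normal solutions\<close>

lemma span_pair: "v \<in> span {x, y :: 'v::real_vector} \<longleftrightarrow> (\<exists>\<alpha> \<beta>. v = \<alpha> *\<^sub>R x + \<beta> *\<^sub>R y)"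
proof
  assume "v \<in> span {x, y}"
  then obtain \<alpha> where "v - \<alpha> *\<^sub>R x \<in> span {y}" using span_breakdown_eq by blast
  then obtain \<beta> where "v - \<alpha> *\<^sub>R x = \<beta> *\<^sub>R y" by (auto simp: span_singleton)
  then show "\<exists>\<alpha> \<beta>. v = \<alpha> *\<^sub>R x + \<beta> *\<^sub>R y" by (metis add.commute diff_add_cancel)
next
  assume "\<exists>\<alpha> \<beta>. v = \<alpha> *\<^sub>R x + \<beta> *\<^sub>R y"
  then show "v \<in> span {x, y}" by (auto intro!: span_add span_scale simp: span_base)
qed

lemma cscale_add: "cscale J (z + y) v = cscale J z v + cscale J y v"
  by (simp add: cscale_def algebra_simps)

lemma cscale_mult:
  assumes "linear J" "J (J v) = - v"
  shows "cscale J (c * z) v = cscale J c (cscale J z v)"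
  using assms by (simp add: cscale_def linear_add linear_scale algebra_simps)

text \<open>Multiplying by the conjugate number leaves the square of the modulus of \<open>z\<close>
  as a real factor.\<close>

lemma cscale_eq_0:
  assumes J: "linear J" "J (J v) = - v" and "v \<noteq> 0" "cscale J z v = 0"
  shows "z = 0"
proof -
  have "cscale J (cnj z * z) v = 0"
    unfolding cscale_mult[OF J] assms(4) by (simp add: cscale_def linear_0[OF J(1)])
  then have "((Re z)\<^sup>2 + (Im z)\<^sup>2) *\<^sub>R v = 0"
    by (simp add: cscale_def power2_eq_square)
  then show ?thesis using \<open>v \<noteq> 0\<close> by (simp add: complex_eq_iff sum_power2_eq_zero_iff)
qed

lemma exp_sec_cscale:
  "exp_sec a b v (J v) x = cscale J (exp (- of_real (x$3) * Complex a b)) v"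
  by (simp add: exp_sec_def cscale_def Re_exp Im_exp algebra_simps)

context highest_weight_rep
begin

lemma Xproj_line:
  assumes "lowest l" "k \<in> span {l, J l}"
  shows "Xproj V \<rho> (lift k) = k" "k \<in> Xspace V \<rho>"
proof -
  have "lowest k" using assms span_line(1) lowest_is_weight_vector by blast
  then have "k \<in> eig gradE lowest_grade" using weight_vector_grade lowest_is_weight_vector by blast
  then show "Xproj V \<rho> (lift k) = k" "k \<in> Xspace V \<rho>" by (simp_all add: Xproj_lift Xspace_eq)
qed

lemma character:
  assumes w1: "w1 = 0" and l: "l \<noteq> 0" "lowest l"
  shows "holonomy_character V \<rho> J (real w2 + real w3) ((real w2 - real w3) / 2)"
proof (rule holonomy_character.intro)
  note N = hol_kernel_eq[OF w1 l]
  have low: "lowest k" if "k \<in> span {l, J l}" for k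
    using that span_line(1)[OF l(2) lowest_is_weight_vector[OF l(2)]] by blast
  show "lie_rep V \<rho>" "linear J" by (rule rep, rule J)
  show "J v \<in> hol_kernel V \<rho>" if v: "v \<in> hol_kernel V \<rho>" for v
  proof -
    obtain k where k: "k \<in> span {l, J l}" "v = lift k" using v unfolding N by fast
    then have "k \<in> V" using low by (simp add: lowest_def)
    then have "J v = lift (J k)" using k(2) by (simp add: lift_J)
    moreover have "J k \<in> span {l, J l}"
      using span_line(2)[OF l(2) lowest_is_weight_vector[OF l(2)]] k(1) by blast
    ultimately show ?thesis unfolding N by fast
  qed
  show "J (J v) = - v" if "(real w2 - real w3) / 2 \<noteq> 0" "v \<in> hol_kernel V \<rho>" for v
    using that J_square[of v] by (auto simp: hol_kernel_def split: if_splits)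
  show "\<rho> (Omega 3) v = (real w2 + real w3) *\<^sub>R v + ((real w2 - real w3) / 2) *\<^sub>R J v"
    if v: "v \<in> hol_kernel V \<rho>" for v
  proof -
    obtain k where k: "k \<in> span {l, J l}" "v = lift k" using v unfolding N by fast
    have "v \<in> V" using v by (simp add: hol_kernel_def)
    then show ?thesis using Omega_3_lift[OF low[OF k(1)]] k(2) by (simp add: act_eq)
  qed
qed

lemma normal_solution_trivial:
  assumes "w1 \<noteq> 0" "open U" "normal_solution V \<rho> U \<sigma>" "x \<in> U"
  shows "\<sigma> x = 0"
proof -
  obtain s where s: "parallel_on V \<rho> U s" "\<sigma> x = Xproj V \<rho> (s x)"
    using assms(3,4) normal_solution_iff[OF rep] by blast
  have "s x \<in> hol_kernel V \<rho>"
    using parallel_imp_hol_kernel[OF rep assms(2) s(1) assms(4)] s(1) assms(4)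
    by (simp add: hol_kernel_def parallel_on_def tractor_on_def)
  then have "s x = 0" using hol_kernel_trivial[OF assms(1)] by blast
  moreover have "Xproj V \<rho> 0 = 0"
    by (rule Xproj_eqI) (simp_all add: subspace_0[OF subspace_eig] span_zero)
  ultimately show ?thesis using s(2) by simp
qed

lemma complex_family:
  assumes w1: "w1 = 0" and w: "w2 \<noteq> w3" and l: "l \<noteq> 0" "lowest l"
  shows "bij_betw (\<lambda>z. cscale J z (lift l)) UNIV (hol_kernel V \<rho>)"
    and "Xproj V \<rho> (cscale J z (lift l)) = cscale J z l"
    and "J (J (lift l)) = - lift l"
proof -
  have lV: "l \<in> V" using l(2) by (simp add: lowest_def)
  have lift_cscale: "lift (cscale J z l) = cscale J z (lift l)" for z
    by (simp add: cscale_def linear_add[OF lift_linear] linear_scale[OF lift_linear] lift_J[OF lV])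
  show JJ: "J (J (lift l)) = - lift l" using J_square[OF lift_V[OF lV]] w by simp
  have line: "span {l, J l} = range (\<lambda>z. cscale J z l)"
  proof (intro equalityI subsetI)
    fix v assume "v \<in> span {l, J l}"
    then obtain \<alpha> \<beta> where "v = cscale J (Complex \<alpha> \<beta>) l" by (auto simp: span_pair cscale_def)
    then show "v \<in> range (\<lambda>z. cscale J z l)" by blast
  qed (auto simp: span_pair cscale_def)
  show "Xproj V \<rho> (cscale J z (lift l)) = cscale J z l"
    using Xproj_line(1)[OF l(2), of "cscale J z l"] line by (simp add: lift_cscale)
  have "hol_kernel V \<rho> = range (\<lambda>z. cscale J z (lift l))"
    by (simp only: hol_kernel_eq[OF w1 l] line image_image lift_cscale)
  moreover have "inj (\<lambda>z. cscale J z (lift l))"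
  proof (rule injI)
    fix z y assume "cscale J z (lift l) = cscale J y (lift l)"
    then have "cscale J (z - y) (lift l) = 0" by (simp add: cscale_def algebra_simps)
    moreover have "lift l \<noteq> 0" using l(1) by (simp add: lift_eq_0_iff)
    ultimately show "z = y" using cscale_eq_0[OF J JJ] by force
  qed
  ultimately show "bij_betw (\<lambda>z. cscale J z (lift l)) UNIV (hol_kernel V \<rho>)" by (simp add: bij_betw_def)
qed

lemma complex_normal_solutions:
  assumes w1: "w1 = 0" and w: "w2 \<noteq> w3" and l: "l \<noteq> 0" "lowest l" and U: "open U" "connected U"
  shows "normal_solution V \<rho> U \<sigma> \<longleftrightarrow> (\<exists>z. \<forall>x\<in>U. \<sigma> x =
    cscale J (exp (- of_real (x$3) * Complex (real w2 + real w3) ((real w2 - real w3) / 2)) * z) l)"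
proof -
  interpret H: holonomy_character V \<rho> J "real w2 + real w3" "(real w2 - real w3) / 2"
    by (rule character[OF w1 l])
  note cf = complex_family[OF w1 w l]
  have N: "H.N = range (\<lambda>z. cscale J z (lift l))" using cf(1) by (simp add: bij_betw_def)
  show ?thesis
    unfolding H.normal_solution_exp_sec[OF U] exp_sec_cscale N
    by (simp add: cscale_mult[OF J cf(3), symmetric] cf(2))
qed

end

text \<open>The given \<open>J\<close> is controlled only on \<open>V\<close>, and only for
  different \<open>w2\<close> and \<open>w3\<close>. In that case it is replaced by a linear
  extension from \<open>V\<close>; for equal coefficients the imaginary part of the weight is 0 and
  the identity can be chosen.\<close>

lemma irrep_highest_weight_rep:
  assumes irrep: "irrep_of_weight w1 w2 w3 V \<rho> J"
  obtains J' where "highest_weight_rep V \<rho> J' w1 w2 w3" "\<And>v. w2 \<noteq> w3 \<Longrightarrow> v \<in> V \<Longrightarrow> J' v = J v"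
    "w2 = w3 \<Longrightarrow> J' = (\<lambda>v. v)"
proof -
  have rep: "lie_rep V \<rho>" using irrep by (simp add: irrep_of_weight_def)
  note repD = lie_repD[OF rep]
  obtain v where v: "v \<in> V" "v \<noteq> 0" "\<forall>X\<in>n_plus. \<rho> X v = 0"
    "\<And>a b r. \<rho> (cartan a b r) v = cscale J (of_nat w1 * fund_weight1 a b r + of_nat w2 * fund_weight2 a b r
                     + of_nat w3 * fund_weight3 a b r) v"
    using irrep unfolding irrep_of_weight_def by blast
  have wt: "\<rho> (cartan a b r) v = (real w1 * a + (real w2 + real w3) * (a + b) / 2) *\<^sub>R v
      + ((real w2 - real w3) * r / 2) *\<^sub>R J v" for a b r
  proof -
    have "Re (of_nat w1 * fund_weight1 a b r + of_nat w2 * fund_weight2 a b r + of_nat w3 * fund_weight3 a b r)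
        = real w1 * a + (real w2 + real w3) * (a + b) / 2"
      "Im (of_nat w1 * fund_weight1 a b r + of_nat w2 * fund_weight2 a b r + of_nat w3 * fund_weight3 a b r)
        = (real w2 - real w3) * r / 2"
      by (simp_all add: fund_weight1_def fund_weight2_def fund_weight3_def field_simps)
    then show ?thesis unfolding v(4) cscale_def by simp
  qed
  show thesis
  proof (cases "w2 = w3")
    case True
    have "highest_weight_rep V \<rho> (\<lambda>v. v) w1 w2 w3"
    proof (rule highest_weight_rep.intro)
      show "linear (\<lambda>v::'a. v)" by (rule linearI) auto
      show "W = {0} \<or> W = V" if "invariant_subspace V \<rho> W" for W
        using that irrep True by (simp add: irrep_of_weight_def)
      show "\<exists>v\<in>V. v \<noteq> 0 \<and> (\<forall>X\<in>n_plus. \<rho> X v = 0) \<and> (\<forall>a b r. \<rho> (cartan a b r) v =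
          (real w1 * a + (real w2 + real w3) * (a + b) / 2) *\<^sub>R v + ((real w2 - real w3) * r / 2) *\<^sub>R v)"
        using v(1-3) wt True by (intro bexI[of _ v]) simp_all
    qed (use rep True in auto)
    then show thesis using that True by blast
  next
    case False
    have cs: "complex_structure V \<rho> J"
      and irr: "\<And>W. invariant_subspace V \<rho> W \<and> J ` W \<subseteq> W \<longrightarrow> W = {0} \<or> W = V"
      using irrep False by (auto simp: irrep_of_weight_def)
    obtain J' where J': "linear J'" "\<And>v. v \<in> V \<Longrightarrow> J' v = J v"
      using linear_extension[OF repD(1), of J] cs unfolding complex_structure_def by metis
    have "highest_weight_rep V \<rho> J' w1 w2 w3"
    proof (rule highest_weight_rep.intro)
      show "J' v \<in> V" if "v \<in> V" for v using that cs J' by (simp add: complex_structure_def)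
      show "\<rho> X (J' v) = J' (\<rho> X v)" if "X \<in> so24" "v \<in> V" for X v
        using that cs J' repD(2) by (simp add: complex_structure_def)
      show "if w2 = w3 then J' v = v else J' (J' v) = - v" if "v \<in> V" for v
        using that cs J' False by (simp add: complex_structure_def)
      show "W = {0} \<or> W = V" if W: "invariant_subspace V \<rho> W" "J' ` W \<subseteq> W" for W
      proof -
        have "W \<subseteq> V" using W(1) by (simp add: invariant_subspace_def)
        then have "J ` W \<subseteq> W" using W(2) J'(2) by (auto simp: image_subset_iff subset_iff)
        then show ?thesis using irr W(1) by blast
      qed
      show "\<exists>v\<in>V. v \<noteq> 0 \<and> (\<forall>X\<in>n_plus. \<rho> X v = 0) \<and> (\<forall>a b r. \<rho> (cartan a b r) v =
          (real w1 * a + (real w2 + real w3) * (a + b) / 2) *\<^sub>R v + ((real w2 - real w3) * r / 2) *\<^sub>R J' v)"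
        using v(1-3) wt J'(2) by (intro bexI[of _ v]) simp_all
    qed (use rep J' in auto)
    then show thesis using that[of J'] J'(2) False by blast
  qed
qed

text \<open>For the second fundamental weight, the exponents \<open>w2 + w3\<close> and
  \<open>(w2 - w3) / 2\<close> are 1 and 1/2. Injectivity of the coordinate map identifies multiples
  of \<open>b2\<close> with spinors whose first component is 0.\<close>

lemma twistor_spinors:
  fixes spin :: "real^6^6 \<Rightarrow> complex^4 \<Rightarrow> complex^4" and s :: "real^4 \<Rightarrow> complex^2"
  assumes irrep: "irrep_of_weight 0 1 0 UNIV spin (\<lambda>v. \<i> *s v)"
    and bij: "bij_betw (\<lambda>s :: complex^2. s$1 *s b1 + s$2 *s b2) UNIV (Xspace UNIV spin)"
    and b2: "lowest_weight_vector UNIV spin b2" and U: "open U" "connected U"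
  shows "normal_solution UNIV spin U (\<lambda>x. s x $ 1 *s b1 + s x $ 2 *s b2) \<longleftrightarrow>
    (\<exists>v1 v2. \<forall>x\<in>U. s x = vector [0, exp (- of_real (x$3) * (1 + (1/2) * \<i>)) * Complex v1 v2])"
proof -
  obtain J' where H: "highest_weight_rep UNIV spin J' 0 1 0" "\<And>v. J' v = \<i> *s v"
    using irrep_highest_weight_rep[OF irrep] by (metis UNIV_I zero_neq_one)
  interpret highest_weight_rep UNIV spin J' 0 1 0 by (rule H(1))
  have l: "b2 \<noteq> 0" "lowest b2" using b2 lowest_weight_vector_iff by auto
  have cs: "cscale J' z b2 = z *s b2" for z
    by (simp add: cscale_def H(2) vec_eq_iff complex_eq_iff)
  have s: "s$1 *s b1 + s$2 *s b2 = z *s b2 \<longleftrightarrow> s = vector [0, z]" for s :: "complex^2" and z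
  proof
    assume "s$1 *s b1 + s$2 *s b2 = z *s b2"
    then have "s$1 *s b1 + s$2 *s b2 = (vector [0, z] :: complex^2)$1 *s b1 + (vector [0, z] :: complex^2)$2 *s b2"
      by simp
    then show "s = vector [0, z]" using bij unfolding bij_betw_def inj_def by blast
  qed simp
  have c: "Complex (real 1 + real 0) ((real 1 - real 0) / 2) = 1 + (1/2) * \<i>"
    by (simp add: complex_eq_iff)
  have ex: "(\<exists>z. P z) \<longleftrightarrow> (\<exists>v1 v2. P (Complex v1 v2))" for P by (metis complex_surj)
  show ?thesis
    unfolding complex_normal_solutions[OF refl one_neq_zero l U] cs s c ex ..
qed

section \<open>The adjoint representation and conformal Killing fields\<close>

lemma lie_jacobi: "lie (lie X Y) Z = lie X (lie Y Z) - lie Y (lie X Z)"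
proof -
  have "A ** (B - C) = A ** B - A ** C" "(B - C) ** A = B ** A - C ** A" for A B C :: "real^'a^'a"
    by (simp_all add: vec_eq_iff matrix_matrix_mult_def sum_subtractf algebra_simps)
  then show ?thesis by (simp add: lie_def matrix_mul_assoc)
qed

lemma lie_left:
  "lie (X + Y) B = lie X B + lie Y B" "lie (c *\<^sub>R X) B = c *\<^sub>R lie X B"
  by (simp_all add: lie_def vec_eq_iff matrix_matrix_mult_def sum.distrib sum_distrib_left algebra_simps)

lemma lie_rep_adjoint: "lie_rep so24 lie"
  unfolding lie_rep_def
  using subspace_so24 lie_in_so24 by (simp add: lie_right lie_left lie_jacobi)

text \<open>The image of the lowest root vector \<open>root_x4\<close> under
  \<open>exp (ad root_z2)\<close>.\<close>

abbreviation "killing_tractor \<equiv> smat 0 (1/2) 0 0 0 0 0 0 1 0 0 0 1 0 0"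

text \<open>The centralizer of the holonomy algebra, computed in coordinates. This direct route
  gives the conformal Killing fields without verifying irreducibility of the adjoint
  representation.\<close>

lemma hol_kernel_adjoint: "hol_kernel so24 lie = range (\<lambda>c. c *\<^sub>R killing_tractor)"
proof (intro equalityI subsetI)
  fix M assume M: "M \<in> hol_kernel so24 lie"
  then have "M \<in> so24" by (simp add: hol_kernel_def)
  then obtain a z1 z2 z3 z4 x1 x2 x3 x4 p q1 q2 r1 r2 s
    where M': "M = smat a z1 z2 z3 z4 x1 x2 x3 x4 p q1 q2 r1 r2 s" by (rule so24E)
  have hol0: "lie X M = 0" if "X \<in> hol" for X using M that by (simp add: hol_kernel_def)
  note eqs = M' lie_smat smat_0[symmetric] smat_eq_iff
  have "lie root_z1 M = 0" by (rule hol0) (simp add: hol_def)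
  then have 1: "x1 = 0" "p = a" "q1 = 0" "q2 = 0" "x2 = 0" "x3 = 0" by (simp_all add: eqs)
  have "lie root_r1 M = 0" by (rule hol0) (simp add: hol_def)
  then have 2: "z2 = 0" "z4 = 0" "p = 0" by (simp_all add: eqs)
  have "lie root_r2 M = 0" by (rule hol0) (simp add: hol_def)
  then have 3: "z3 = 0" "s = 0" by (simp_all add: eqs)
  have "lie (smat 1 0 0 0 0 0 2 0 0 1 0 0 0 0 0) M = 0" by (rule hol0) (simp add: hol_def)
  then have 4: "z1 = r1 / 2" "x4 = r1" "r2 = 0" using 1 2 3 by (simp_all add: eqs)
  have "M = r1 *\<^sub>R killing_tractor" using 1 2 3 4 by (simp add: M' smat_scale smat_eq_iff)
  then show "M \<in> range (\<lambda>c. c *\<^sub>R killing_tractor)" by blast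
next
  fix M assume "M \<in> range (\<lambda>c. c *\<^sub>R killing_tractor)"
  then show "M \<in> hol_kernel so24 lie"
    by (auto simp: hol_kernel_def hol_def smat_scale lie_smat smat_0[symmetric] smat_eq_iff)
qed

lemma E_eigenspace_adjoint:
  "smat a z1 z2 z3 z4 x1 x2 x3 x4 p q1 q2 r1 r2 s \<in> E_eigenspace so24 lie c \<longleftrightarrow>
    (c = 0 \<or> a = 0) \<and> (c = 1 \<or> z1 = 0) \<and> (c = 1 \<or> z2 = 0) \<and> (c = 1 \<or> z3 = 0) \<and> (c = 1 \<or> z4 = 0) \<and>
    (c = - 1 \<or> x1 = 0) \<and> (c = - 1 \<or> x2 = 0) \<and> (c = - 1 \<or> x3 = 0) \<and> (c = - 1 \<or> x4 = 0) \<and>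
    (c = 0 \<or> p = 0) \<and> (c = 0 \<or> q1 = 0) \<and> (c = 0 \<or> q2 = 0) \<and> (c = 0 \<or> r1 = 0) \<and> (c = 0 \<or> r2 = 0) \<and>
    (c = 0 \<or> s = 0)"
proof -
  have neg: "(- x = c * x) = (c = - 1 \<or> x = 0)" for x
  proof -
    have "(- x = c * x) = ((c + 1) * x = 0)" unfolding distrib_right mult_1_left by linarith
    also have "\<dots> = (c + 1 = 0 \<or> x = 0)" by (rule mult_eq_0_iff)
    also have "\<dots> = (c = - 1 \<or> x = 0)" by (simp add: eq_neg_iff_add_eq_0)
    finally show ?thesis .
  qed
  have pos: "(z = c * z) = (c = 1 \<or> z = 0)" "(0 = c * y) = (c = 0 \<or> y = 0)" for y z by auto
  have "lie gradE (smat a z1 z2 z3 z4 x1 x2 x3 x4 p q1 q2 r1 r2 s) =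
      smat 0 z1 z2 z3 z4 (- x1) (- x2) (- x3) (- x4) 0 0 0 0 0 0"
    by (simp add: gradE_smat lie_smat)
  then show ?thesis
    unfolding E_eigenspace_def by (simp only: smat_scale smat_eq_iff neg pos mem_Collect_eq smat_in_so24 simp_thms)
qed

lemma lowest_E_adjoint: "lowest_E so24 lie = - 1"
  unfolding lowest_E_def
proof (rule Min_eqI)
  have sub: "{c. E_eigenspace so24 lie c \<noteq> {0}} \<subseteq> {-1, 0, 1}"
  proof
    fix c assume c: "c \<in> {c. E_eigenspace so24 lie c \<noteq> {0}}"
    have "0 \<in> E_eigenspace so24 lie c"
      using E_eigenspace_adjoint[of 0 0 0 0 0 0 0 0 0 0 0 0 0 0 0 c] by (simp add: smat_0)
    then obtain M where M: "M \<in> E_eigenspace so24 lie c" "M \<noteq> 0" using c by blast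
    then have "M \<in> so24" by (simp add: E_eigenspace_def)
    then show "c \<in> {-1, 0, 1}"
      using M by (elim so24E) (auto simp: E_eigenspace_adjoint smat_0[symmetric] smat_eq_iff)
  qed
  then show "finite {c. E_eigenspace so24 lie c \<noteq> {0}}" by (rule finite_subset) simp
  show "- 1 \<le> c" if "c \<in> {c. E_eigenspace so24 lie c \<noteq> {0}}" for c using sub that by auto
  have "root_x1 \<in> E_eigenspace so24 lie (- 1)" by (simp add: E_eigenspace_adjoint)
  moreover have "root_x1 \<noteq> 0" by (simp add: smat_0[symmetric] smat_eq_iff)
  ultimately show "- 1 \<in> {c. E_eigenspace so24 lie c \<noteq> {0}}" by blast
qed

lemma Xproj_adjoint:
  "Xproj so24 lie (smat a z1 z2 z3 z4 x1 x2 x3 x4 p q1 q2 r1 r2 s) = smat 0 0 0 0 0 x1 x2 x3 x4 0 0 0 0 0 0"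
proof -
  let ?M = "smat a z1 z2 z3 z4 x1 x2 x3 x4 p q1 q2 r1 r2 s"
  let ?S = "span (\<Union>c\<in>{c. c \<noteq> - 1}. E_eigenspace so24 lie c)"
  \<comment> \<open>The complement of the lowest eigenspace; it contains the span of the other
    eigenspaces and gives uniqueness of the projection.\<close>
  define P where "P = {smat a z1 z2 z3 z4 0 0 0 0 p q1 q2 r1 r2 s | a z1 z2 z3 z4 p q1 q2 r1 r2 s. True}"
  have "subspace P"
    unfolding P_def subspace_def by (force simp: smat_simps smat_0[symmetric])
  moreover have "(\<Union>c\<in>{c. c \<noteq> - 1}. E_eigenspace so24 lie c) \<subseteq> P"
  proof
    fix N assume "N \<in> (\<Union>c\<in>{c. c \<noteq> - 1}. E_eigenspace so24 lie c)"
    then obtain c where c: "c \<noteq> - 1" "N \<in> E_eigenspace so24 lie c" by blast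
    then have "N \<in> so24" by (simp add: E_eigenspace_def)
    then show "N \<in> P" using c unfolding P_def by (elim so24E) (simp add: E_eigenspace_adjoint, blast)
  qed
  ultimately have SP: "?S \<subseteq> P" using span_minimal by blast
  show ?thesis
    unfolding Xproj_def Xspace_def lowest_E_adjoint
  proof (rule the_equality)
    have "smat 0 z1 z2 z3 z4 0 0 0 0 0 0 0 0 0 0 \<in> ?S"
      by (intro span_base UN_I[of 1]) (simp_all add: E_eigenspace_adjoint)
    moreover have "smat a 0 0 0 0 0 0 0 0 p q1 q2 r1 r2 s \<in> ?S"
      by (intro span_base UN_I[of 0]) (simp_all add: E_eigenspace_adjoint)
    ultimately have "smat 0 z1 z2 z3 z4 0 0 0 0 0 0 0 0 0 0 + smat a 0 0 0 0 0 0 0 0 p q1 q2 r1 r2 s \<in> ?S"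
      by (rule span_add)
    then show "smat 0 0 0 0 0 x1 x2 x3 x4 0 0 0 0 0 0 \<in> E_eigenspace so24 lie (- 1) \<and>
        ?M - smat 0 0 0 0 0 x1 x2 x3 x4 0 0 0 0 0 0 \<in> ?S"
      by (simp add: E_eigenspace_adjoint smat_simps)
    fix u assume u: "u \<in> E_eigenspace so24 lie (- 1) \<and> ?M - u \<in> ?S"
    then have "u \<in> so24" by (simp add: E_eigenspace_def)
    then obtain a' z1' z2' z3' z4' x1' x2' x3' x4' p' q1' q2' r1' r2' s'
      where u': "u = smat a' z1' z2' z3' z4' x1' x2' x3' x4' p' q1' q2' r1' r2' s'" by (rule so24E)
    have "?M - u \<in> P" using u SP by blast
    then have "x1' = x1 \<and> x2' = x2 \<and> x3' = x3 \<and> x4' = x4"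
      by (auto simp: P_def u' smat_simps smat_eq_iff)
    then show "u = smat 0 0 0 0 0 x1 x2 x3 x4 0 0 0 0 0 0"
      using u by (simp add: u' E_eigenspace_adjoint)
  qed
qed

lemma coframe_eq: "coframe x u = coords x u"
  unfolding coframe_def
proof (rule the_equality)
  show "u = (\<Sum>i\<in>UNIV. coords x u $ i *\<^sub>R frame x i)" by (rule coords_expansion)
  fix c :: "real^4" assume "u = (\<Sum>i\<in>UNIV. c $ i *\<^sub>R frame x i)"
  then show "c = coords x u"
    using basis_expansion[of c]
    by (simp add: linear_sum[OF linear_coords] linear_scale[OF linear_coords] coords_frame scalar_mult_eq_scaleR)
qed

lemma coords_eq_axis_4: "coords x u = k *\<^sub>R axis 4 1 \<longleftrightarrow> u = k *\<^sub>R axis 4 1"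
proof -
  have f: "frame x 4 = axis 4 1" by (simp add: frame_def vec_eq_iff forall_4 axis_def)
  have "coords x (k *\<^sub>R axis 4 1) = k *\<^sub>R axis 4 1"
    using coords_frame[of x 4] by (simp add: linear_scale[OF linear_coords] f)
  moreover have "u = (\<Sum>i\<in>UNIV. (k *\<^sub>R axis 4 1 :: real^4) $ i *\<^sub>R frame x i)" if "coords x u = k *\<^sub>R axis 4 1"
    using coords_expansion[of u x] that by simp
  then have "u = k *\<^sub>R axis 4 1" if "coords x u = k *\<^sub>R axis 4 1"
    using that by (simp add: sum_4 axis_def[of 4] f)
  ultimately show ?thesis by metis
qed

lemma conformal_Killing_fields:
  assumes U: "open U" "connected U"
  shows "normal_conformal_Killing U \<xi> \<longleftrightarrow> (\<exists>v1. \<forall>x\<in>U. \<xi> x = (v1 * exp (- 2 * x$3)) *\<^sub>R axis 4 1)"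
proof -
  \<comment> \<open>\<open>Omega 3\<close> acts on the centralizer by the real scalar 2, so
    \<open>b = 0\<close> and the zero map is admissible as \<open>J\<close>.\<close>
  interpret H: holonomy_character so24 lie "\<lambda>v. 0" 2 0
  proof (rule holonomy_character.intro)
    show "linear (\<lambda>v::real^6^6. 0 :: real^6^6)" by (rule linear_zero)
    show "0 \<in> hol_kernel so24 lie" by (rule subspace_0[OF subspace_hol_kernel[OF lie_rep_adjoint]])
    show "lie (Omega 3) M = 2 *\<^sub>R M + 0 *\<^sub>R 0" if "M \<in> hol_kernel so24 lie" for M
      using that unfolding hol_kernel_adjoint by (auto simp: Omega_simps smat_scale lie_smat)
  qed (simp_all add: lie_rep_adjoint)
  have 0: "so_mat 0 0 0 0 0 0 = 0" by (simp add: so_mat_def vec_eq_iff forall_4)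
  have "so24_mat 0 0 y 0 = Xproj so24 lie (exp_sec 2 0 (c *\<^sub>R killing_tractor) 0 x) \<longleftrightarrow>
      y = (c * exp (- 2 * x$3)) *\<^sub>R axis 4 1" for y c and x :: "real^4"
  proof -
    have "so24_mat 0 0 y 0 = smat 0 0 0 0 0 (y$1) (y$2) (y$3) (y$4) 0 0 0 0 0 0"
      using so24_mat_eq_smat[of 0 0 y 0 0 0 0 0 0] by (simp add: 0)
    moreover have "y = k *\<^sub>R axis 4 1 \<longleftrightarrow> y$1 = 0 \<and> y$2 = 0 \<and> y$3 = 0 \<and> y$4 = k" for k
      by (simp add: vec_eq_iff forall_4 axis_def)
    ultimately show ?thesis
      by (simp add: exp_sec_def smat_scale Xproj_adjoint smat_eq_iff mult.commute)
  qed
  then show ?thesis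
    unfolding normal_conformal_Killing_def H.normal_solution_exp_sec[OF U] hol_kernel_adjoint
    by (simp add: coframe_eq coords_eq_axis_4)
qed

lemma ex_lowest_weight_vector:
  assumes "irrep_of_weight w1 w2 w3 V \<rho> J"
  shows "\<exists>l. lowest_weight_vector V \<rho> l"
proof -
  obtain J' where "highest_weight_rep V \<rho> J' w1 w2 w3"
    using irrep_highest_weight_rep[OF assms] by metis
  then interpret highest_weight_rep V \<rho> J' w1 w2 w3 .
  show ?thesis using lowest_weight_vector_exists lowest_weight_vector_iff by blast
qed

lemma complex_case:
  assumes irrep: "irrep_of_weight w1 w2 w3 V \<rho> J" and w: "w1 = 0" "w2 \<noteq> w3"
    and l: "lowest_weight_vector V \<rho> l"
  shows "l \<in> Xspace V \<rho> \<and>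
          (\<exists>\<Phi> (n :: complex \<Rightarrow> 'v::euclidean_space).
             describes_normal_solutions V \<rho> \<Phi> \<and>
             bij_betw n UNIV (Nspace V \<rho>) \<and>
             (\<forall>z y. n (z + y) = n z + n y) \<and> (\<forall>c z. n (c * z) = cscale J c (n z)) \<and>
             (\<forall>x t v1 v2. \<Phi> x t (n (Complex v1 v2)) =
                n ((of_real ((real w2 + real w3) * x$3)
                    + of_real ((1/2) * (real w2 - real w3)) * \<i> * of_real (x$3)) * Complex v1 v2)) \<and>
             (\<forall>v1 v2. Xproj V \<rho> (n (Complex v1 v2)) = cscale J (Complex v1 v2) l))"
proof -
  obtain J' where H: "highest_weight_rep V \<rho> J' w1 w2 w3" "\<And>v. v \<in> V \<Longrightarrow> J' v = J v"
    using irrep_highest_weight_rep[OF irrep] w(2) by metis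
  interpret highest_weight_rep V \<rho> J' w1 w2 w3 by (rule H(1))
  have l: "l \<noteq> 0" "lowest l" using l by (simp_all add: lowest_weight_vector_iff)
  then have lV: "l \<in> V" by (simp add: lowest_def)
  interpret C: holonomy_character V \<rho> J' "real w2 + real w3" "(real w2 - real w3) / 2"
    by (rule character[OF w(1) l])
  note cf = complex_family[OF w l]
  \<comment> \<open>The lift of the multiple \<open>z l\<close>. The projection to the lowest
    eigenspace undoes the lift, so \<open>n\<close> parametrizes \<open>Nspace\<close> by the
    leading part.\<close>
  define n where "n z = cscale J' z (lift l)" for z
  have nV: "n z \<in> V" for z
    unfolding n_def cscale_def using lift_V[OF lV] J_V
    by (intro subspace_add[OF V_subspace] subspace_scale[OF V_subspace])
  have cs: "cscale J' z v = cscale J z v" if "v \<in> V" for z v using H(2)[OF that] by (simp add: cscale_def)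
  have n_mult: "n (c * z) = cscale J' c (n z)" for c z unfolding n_def by (rule cscale_mult[OF J cf(3)])
  have "C.\<Phi> x t (n z) = n ((of_real ((real w2 + real w3) * x$3)
      + of_real ((1/2) * (real w2 - real w3)) * \<i> * of_real (x$3)) * z)" for x t z
    unfolding n_mult by (simp add: C.\<Phi>_def cscale_def algebra_simps)
  moreover have "bij_betw n UNIV (Nspace V \<rho>)" using cf(1) by (simp add: C.Nspace_eq n_def[abs_def])
  moreover have "n (z + y) = n z + n y" for z y by (simp add: n_def cscale_add)
  moreover have "n (c * z) = cscale J c (n z)" for c z by (simp add: n_mult cs nV)
  moreover have "Xproj V \<rho> (n z) = cscale J z l" for z by (simp add: n_def cf(2) cs lV)
  moreover have "l \<in> Xspace V \<rho>" using Xproj_line(2)[OF l(2), of l] by (simp add: span_base)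
  ultimately show ?thesis
    using C.describes by blast
qed

lemma real_case:
  assumes irrep: "irrep_of_weight w1 w2 w3 V \<rho> J" and w: "w1 = 0" "w2 = w3"
    and l: "lowest_weight_vector V \<rho> l"
  shows "l \<in> Xspace V \<rho> \<and>
          (\<exists>\<Phi> (n :: real \<Rightarrow> 'v::euclidean_space).
             describes_normal_solutions V \<rho> \<Phi> \<and>
             bij_betw n UNIV (Nspace V \<rho>) \<and> linear n \<and>
             (\<forall>x t v1. \<Phi> x t (n v1) = n (2 * real w2 * x$3 * v1)) \<and>
             (\<forall>v1. Xproj V \<rho> (n v1) = v1 *\<^sub>R l))"
proof -
  have H: "highest_weight_rep V \<rho> (\<lambda>v. v) w1 w2 w3"
    using irrep_highest_weight_rep[OF irrep] w(2) by metis
  interpret highest_weight_rep V \<rho> "\<lambda>v. v" w1 w2 w3 by (rule H)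
  have l: "l \<noteq> 0" "lowest l" using l by (simp_all add: lowest_weight_vector_iff)
  interpret C: holonomy_character V \<rho> "\<lambda>v. v" "real w2 + real w3" "(real w2 - real w3) / 2"
    by (rule character[OF w(1) l])
  define n where "n v1 = v1 *\<^sub>R lift l" for v1
  have line: "span {l, l} = range (\<lambda>v1. v1 *\<^sub>R l)" by (simp add: span_singleton)
  have "Nspace V \<rho> = range n"
    unfolding C.Nspace_eq hol_kernel_eq[OF w(1) l] line image_image n_def linear_scale[OF lift_linear] ..
  moreover have "inj n" using l(1) by (auto intro!: injI simp: n_def lift_eq_0_iff)
  ultimately have "bij_betw n UNIV (Nspace V \<rho>)" by (simp add: bij_betw_def)
  moreover have "linear n" by (rule linearI) (simp_all add: n_def scaleR_add_left)
  moreover have "C.\<Phi> x t (n v1) = n (2 * real w2 * x$3 * v1)" for x t v1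
    unfolding C.\<Phi>_def n_def using w(2) by (simp add: mult.commute)
  moreover have "Xproj V \<rho> (n v1) = v1 *\<^sub>R l" for v1
    using Xproj_line(1)[OF l(2), of "v1 *\<^sub>R l"]
    by (simp add: n_def linear_scale[OF lift_linear] span_base span_scale)
  moreover have "l \<in> Xspace V \<rho>" using Xproj_line(2)[OF l(2), of l] by (simp add: span_base)
  ultimately show ?thesis
    using C.describes by blast
qed

theorem proposition4p5:
  fixes V :: "'v::euclidean_space set"
    and \<rho> :: "real^6^6 \<Rightarrow> 'v \<Rightarrow> 'v"
    and J :: "'v \<Rightarrow> 'v"
    and w1 w2 w3 :: nat
  assumes irrep: "irrep_of_weight w1 w2 w3 V \<rho> J"
  shows
    "(w1 \<noteq> 0 \<longrightarrow>
        (\<forall>U \<sigma>. open U \<and> normal_solution V \<rho> U \<sigma> \<longrightarrow> (\<forall>x\<in>U. \<sigma> x = 0)))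
     \<and>
     (w1 = 0 \<and> w2 \<noteq> w3 \<longrightarrow>
        (\<exists>l. lowest_weight_vector V \<rho> l) \<and>
        (\<forall>l. lowest_weight_vector V \<rho> l \<longrightarrow> l \<in> Xspace V \<rho> \<and>
          (\<exists>\<Phi> (n :: complex \<Rightarrow> 'v).
             describes_normal_solutions V \<rho> \<Phi> \<and>
             bij_betw n UNIV (Nspace V \<rho>) \<and>
             (\<forall>z y. n (z + y) = n z + n y) \<and> (\<forall>c z. n (c * z) = cscale J c (n z)) \<and>
             (\<forall>x t v1 v2. \<Phi> x t (n (Complex v1 v2)) =
                n ((of_real ((real w2 + real w3) * x$3)
                    + of_real ((1/2) * (real w2 - real w3)) * \<i> * of_real (x$3)) * Complex v1 v2)) \<and>
             (\<forall>v1 v2. Xproj V \<rho> (n (Complex v1 v2)) = cscale J (Complex v1 v2) l))))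
     \<and>
     (w1 = 0 \<and> w2 = w3 \<longrightarrow>
        (\<exists>l. lowest_weight_vector V \<rho> l) \<and>
        (\<forall>l. lowest_weight_vector V \<rho> l \<longrightarrow> l \<in> Xspace V \<rho> \<and>
          (\<exists>\<Phi> (n :: real \<Rightarrow> 'v).
             describes_normal_solutions V \<rho> \<Phi> \<and>
             bij_betw n UNIV (Nspace V \<rho>) \<and> linear n \<and>
             (\<forall>x t v1. \<Phi> x t (n v1) = n (2 * real w2 * x$3 * v1)) \<and>
             (\<forall>v1. Xproj V \<rho> (n v1) = v1 *\<^sub>R l))))
     \<and>
     (\<forall>(spin :: real^6^6 \<Rightarrow> complex^4 \<Rightarrow> complex^4) b1 b2 \<mu>.
        irrep_of_weight 0 1 0 UNIV spin (\<lambda>v. \<i> *s v) \<and>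
        bij_betw (\<lambda>s :: complex^2. s$1 *s b1 + s$2 *s b2) UNIV (Xspace UNIV spin) \<and>
        (\<forall>a b r. spin (cartan a b r) b1 = \<mu> a b r *s b1) \<and>
        lowest_weight_vector UNIV spin b2 \<longrightarrow>
        (\<forall>U (s :: real^4 \<Rightarrow> complex^2). open U \<and> connected U \<longrightarrow>
           (normal_solution UNIV spin U (\<lambda>x. s x $ 1 *s b1 + s x $ 2 *s b2) \<longleftrightarrow>
            (\<exists>v1 v2. \<forall>x\<in>U.
               s x = vector [0, exp (- of_real (x$3) * (1 + (1/2) * \<i>)) * Complex v1 v2]))))
     \<and>
     (\<forall>U \<xi>. open U \<and> connected U \<longrightarrow>
        (normal_conformal_Killing U \<xi> \<longleftrightarrow>
         (\<exists>v1. \<forall>x\<in>U. \<xi> x = (v1 * exp (- 2 * x$3)) *\<^sub>R axis 4 1)))"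
  apply (intro conjI impI)
  subgoal
    using irrep_highest_weight_rep[OF irrep] highest_weight_rep.normal_solution_trivial by metis
  subgoal by (rule ex_lowest_weight_vector[OF irrep])
  subgoal by (intro allI impI, rule complex_case[OF irrep]) simp_all
  subgoal by (rule ex_lowest_weight_vector[OF irrep])
  subgoal by (intro allI impI, rule real_case[OF irrep]) simp_all
  subgoal by (intro allI impI, elim conjE, rule twistor_spinors) assumption+
  subgoal using conformal_Killing_fields by simp
  done

end
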